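(* Let $q>64$ be a prime power, $E$ an elliptic curve over $\mathbb{F}_q$, and $D=\{P_1,\dots,P_n\}\subseteq E(\mathbb{F}_q)$ a set of $n\ge q+2$ rational points. Let $k$ be an integer with $3<k<q-1$ and let $G'$ be a divisor on $E$ of degree $k$ with support disjoint from $D$. Then the elliptic curve code $C_{\mathscr{L}}(D,G')$ (an $[n,k]$ code) has minimum distance exactly $n-k$.
   Context: For a divisor $V$ on $E$, $\mathscr{L}(V)$ is the $\mathbb{F}_q$-vector space of rational functions $f\in\mathbb{F}_q(E)$ with $\mathrm{div}(f)\ge -V$, together with $0$; for $\deg V=k>0$ it has dimension $k$. The code $C_{\mathscr{L}}(D,V)$ is the image of the evaluation map $\mathscr{L}(V)\to\mathbb{F}_q^n$, $f\mapsto(f(P_1),\dots,f(P_n))$. The minimum distance is the minimum Hamming weight of a nonzero codeword. *)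

theory Defs
  imports "HOL-Computational_Algebra.Polynomial" "HOL-Computational_Algebra.Fraction_Field"
begin

text \<open>Elliptic curve E over a finite field 'a = F_q, in long Weierstrass form
  y^2 + a1 x y + a3 y = x^3 + a2 x^2 + a4 x + a6 with nonzero discriminant.
  Coefficients are bundled as a 5-tuple (a1,a2,a3,a4,a6).\<close>

type_synonym 'a wcoeffs = "'a \<times> 'a \<times> 'a \<times> 'a \<times> 'a"

fun discriminant :: "'a::field wcoeffs \<Rightarrow> 'a" where
  "discriminant (a1, a2, a3, a4, a6) =
    (let b2 = a1^2 + 4*a2; b4 = 2*a4 + a1*a3; b6 = a3^2 + 4*a6;
         b8 = a1^2*a6 + 4*a2*a6 - a1*a3*a4 + a2*a3^2 - a4^2
     in - (b2^2*b8) - 8*b4^3 - 27*b6^2 + 9*b2*b4*b6)"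

definition elliptic :: "'a::field wcoeffs \<Rightarrow> bool" where
  "elliptic c \<longleftrightarrow> discriminant c \<noteq> 0"

datatype 'a point = Inf | Aff 'a 'a

fun on_curve :: "'a::field wcoeffs \<Rightarrow> 'a point \<Rightarrow> bool" where
  "on_curve c Inf = True"
| "on_curve (a1, a2, a3, a4, a6) (Aff x y) =
     (y^2 + a1*x*y + a3*y = x^3 + a2*x^2 + a4*x + a6)"

text \<open>The function field F_q(E) = F_q(x)[y]/(W): an element (r,s) stands for r + s*y
  with r, s in the rational function field F_q(x).\<close>

type_synonym 'a ff = "'a poly fract \<times> 'a poly fract"

definition ffX :: "'a::field poly fract" where "ffX = Fract [:0, 1:] 1"
definition ffC :: "'a::field \<Rightarrow> 'a poly fract" where "ffC c = Fract [:c:] 1"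

definition fconst :: "'a::field \<Rightarrow> 'a ff" where "fconst c = (ffC c, 0)"
definition fX :: "'a::field ff" where "fX = (ffX, 0)"
definition fY :: "'a::field ff" where "fY = (0, 1)"

definition fzero :: "'a::field ff" where "fzero = (0, 0)"

definition fadd :: "'a::field ff \<Rightarrow> 'a ff \<Rightarrow> 'a ff" where
  "fadd f g = (fst f + fst g, snd f + snd g)"
definition fsub :: "'a::field ff \<Rightarrow> 'a ff \<Rightarrow> 'a ff" where
  "fsub f g = (fst f - fst g, snd f - snd g)"

text \<open>Multiplication uses y^2 = gW - hW*y with gW = x^3+a2x^2+a4x+a6, hW = a1 x + a3.\<close>
fun fmul :: "'a::field wcoeffs \<Rightarrow> 'a ff \<Rightarrow> 'a ff \<Rightarrow> 'a ff" where
  "fmul (a1, a2, a3, a4, a6) (r1, s1) (r2, s2) =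
    (let gW = ffX^3 + ffC a2 * ffX^2 + ffC a4 * ffX + ffC a6;
         hW = ffC a1 * ffX + ffC a3
     in (r1*r2 + s1*s2*gW, r1*s2 + r2*s1 - s1*s2*hW))"

text \<open>Places of F_q(E)/F_q, represented by their normalized discrete valuations
  (with the convention v fzero = 0; the value at 0 is never used).\<close>
definition is_place :: "'a::field wcoeffs \<Rightarrow> ('a ff \<Rightarrow> int) \<Rightarrow> bool" where
  "is_place c v \<longleftrightarrow>
     v fzero = 0 \<and>
     (\<forall>f g. f \<noteq> fzero \<longrightarrow> g \<noteq> fzero \<longrightarrow> v (fmul c f g) = v f + v g) \<and>
     (\<forall>f g. f \<noteq> fzero \<longrightarrow> g \<noteq> fzero \<longrightarrow> fadd f g \<noteq> fzero \<longrightarrow> v (fadd f g) \<ge> min (v f) (v g)) \<and>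
     (\<forall>a. a \<noteq> 0 \<longrightarrow> v (fconst a) = 0) \<and>
     (\<exists>t. t \<noteq> fzero \<and> v t = 1)"

definition val_ring :: "('a::field ff \<Rightarrow> int) \<Rightarrow> 'a ff set" where
  "val_ring v = {f. f = fzero \<or> v f \<ge> 0}"
definition res_rel :: "('a::field ff \<Rightarrow> int) \<Rightarrow> ('a ff \<times> 'a ff) set" where
  "res_rel v = {(f, g). f \<in> val_ring v \<and> g \<in> val_ring v \<and> (f = g \<or> v (fsub f g) > 0)}"
definition place_deg :: "('a::{finite,field} ff \<Rightarrow> int) \<Rightarrow> nat" where
  "place_deg v = (THE d. card (val_ring v // res_rel v) = card (UNIV :: 'a set) ^ d)"

definition is_divisor :: "'a::field wcoeffs \<Rightarrow> (('a ff \<Rightarrow> int) \<Rightarrow> int) \<Rightarrow> bool" where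
  "is_divisor c V \<longleftrightarrow> finite {v. V v \<noteq> 0} \<and> (\<forall>v. V v \<noteq> 0 \<longrightarrow> is_place c v)"
definition div_deg :: "(('a::{finite,field} ff \<Rightarrow> int) \<Rightarrow> int) \<Rightarrow> int" where
  "div_deg V = (\<Sum>v\<in>{v. V v \<noteq> 0}. V v * int (place_deg v))"

definition LL :: "'a::field wcoeffs \<Rightarrow> (('a ff \<Rightarrow> int) \<Rightarrow> int) \<Rightarrow> 'a ff set" where
  "LL c V = {f. f = fzero \<or> (\<forall>v. is_place c v \<longrightarrow> v f \<ge> - V v)}"

definition place_of :: "'a::field wcoeffs \<Rightarrow> 'a point \<Rightarrow> ('a ff \<Rightarrow> int)" where
  "place_of c P = (THE v. is_place c v \<and>
     (case P of Inf \<Rightarrow> v fX < 0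
      | Aff a b \<Rightarrow> v (fsub fX (fconst a)) > 0 \<and> v (fsub fY (fconst b)) > 0))"

definition eval_at :: "'a::field wcoeffs \<Rightarrow> 'a point \<Rightarrow> 'a ff \<Rightarrow> 'a" where
  "eval_at c P f = (THE a. let v = place_of c P; g = fsub f (fconst a) in g = fzero \<or> v g > 0)"

definition ag_code :: "'a::field wcoeffs \<Rightarrow> 'a point list \<Rightarrow> (('a ff \<Rightarrow> int) \<Rightarrow> int)
    \<Rightarrow> (nat \<Rightarrow> 'a) set" where
  "ag_code c Ps V = (\<lambda>f. \<lambda>i. if i < length Ps then eval_at c (Ps ! i) f else 0) ` LL c V"

definition hweight :: "(nat \<Rightarrow> 'a::zero) \<Rightarrow> nat" where
  "hweight w = card {i. w i \<noteq> 0}"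

definition min_distance :: "(nat \<Rightarrow> 'a::zero) set \<Rightarrow> nat" where
  "min_distance C = Min (hweight ` (C - {\<lambda>_. 0}))"

end

theory Submission
  imports "HOL-Algebra.Algebraic_Closure_Type" "HOL-Algebra.Coset" "HOL-Algebra.FiniteProduct"
    Complex_Main "HOL-Computational_Algebra.Polynomial_Factorial" Defs
begin

text \<open>A codeword of weight n - k comes from a function f such that div(f) + G' is a sum of k distinct
  points of D, so the theorem asks for k elements of D with a prescribed sum in the group of points;
  fewer than n - k nonzero coordinates are impossible because principal divisors have degree zero.
  The group structure comes from the bijection between rational points and divisor classes of
  degree one, which rests on Riemann's inequality and on the absence of functions with a single
  simple pole.

  For the size N of this group, a descent on the heights of the Frobenius image of the generic point
  and its translates (Manin's elementary approach to the Hasse bound) gives 4 N \<le> 5 q + 36, hence N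
  is well below 2 |D| even if D is shrunk to q + 2 points. If k or |D| - k is small, then all but
  three of the elements can be chosen freely, and three distinct elements of a set with more than half of the group reach everything.
  For the remaining k the subsets taking one element of each of logarithmically many pairs
  already reach the whole group.\<close>

section \<open>Subset products in finite abelian groups\<close>

text \<open>The definitions quantify over all normalised valuations of the function field and
  measure degrees by the size of residue class sets, so no place may be overlooked: those that are
  nonnegative at x are pinned down by their prime ideals in the coordinate ring, and exactly one
  place has a pole at x. Since the constants form a finite field, dimension counts become counts of
  elements, q^m functions against q^s conditions. The long Weierstrass form is kept throughout, with
  traces and norms of A + B y over K(x) and with the quantities b2, b4, b6, b8, so that all
  characteristics are treated together.

  The factor 5/4 is what the combinatorics asks for: it gives D a density above 1/2 with a margin
  proportional to q, and this margin pays for the logarithmically many pairs. The bounds on k are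
  symmetric: with |D| = q + 2 both k and |D| - k are at least 4, so passing to complements keeps the
  problem unchanged.\<close>

context comm_group
begin

text \<open>The elements sought form the intersection of D with its image under the involution e ->
  h / e; two subsets of size |D| in a group of order N meet in at least 2 |D| - N elements.\<close>

lemma card_representations:
  assumes fin: "finite (carrier G)" and D: "D \<subseteq> carrier G" and h: "h \<in> carrier G"
  shows "2 * card D \<le> card {d \<in> D. h \<otimes> inv d \<in> D} + Coset.order G"
proof -
  let ?f = "\<lambda>e. h \<otimes> inv e"
  have finD: "finite D" using fin D finite_subset by blast
  have invol: "?f (?f e) = e" if "e \<in> carrier G" for e
    using that h by (simp add: inv_mult_group m_assoc[symmetric] m_comm[of h])
  have eq: "{d \<in> D. h \<otimes> inv d \<in> D} = D \<inter> ?f ` D"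
  proof (intro equalityI subsetI)
    fix d assume "d \<in> {d \<in> D. h \<otimes> inv d \<in> D}"
    thus "d \<in> D \<inter> ?f ` D" using invol[of d] D by (auto simp: image_iff intro!: bexI[of _ "?f d"])
  next
    fix d assume "d \<in> D \<inter> ?f ` D"
    thus "d \<in> {d \<in> D. h \<otimes> inv d \<in> D}" using invol D by auto
  qed
  have inj: "inj_on ?f D" using invol D by (metis (no_types, lifting) inj_onI subsetD)
  have sub: "D \<union> ?f ` D \<subseteq> carrier G" using D h by auto
  have "card (D \<union> ?f ` D) \<le> Coset.order G"
    unfolding Coset.order_def by (rule card_mono[OF fin sub])
  moreover have "card (D \<union> ?f ` D) + card (D \<inter> ?f ` D) = card D + card (?f ` D)"
    using card_Un_Int[of D "?f ` D"] finD by simp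
  ultimately show ?thesis unfolding eq using card_image[OF inj] by linarith
qed

text \<open>The same count with a translate of D in place of the reflected set.\<close>

lemma card_differences:
  assumes fin: "finite (carrier G)" and D: "D \<subseteq> carrier G" and h: "h \<in> carrier G"
  shows "2 * card D \<le> card {d \<in> D. d \<otimes> h \<in> D} + Coset.order G"
proof -
  let ?f = "\<lambda>e. e \<otimes> inv h"
  have finD: "finite D" using fin D finite_subset by blast
  have c1: "?f e \<otimes> h = e" "?f (e \<otimes> h) = e" if "e \<in> carrier G" for e
    using that h by (auto simp add: m_assoc)
  have eq: "{d \<in> D. d \<otimes> h \<in> D} = D \<inter> ?f ` D"
    using c1 D by (auto simp: image_iff subset_iff) metis
  have inj: "inj_on ?f D" using c1(1) D by (metis (no_types, lifting) inj_onI subsetD)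
  have sub: "D \<union> ?f ` D \<subseteq> carrier G" using D h by auto
  have "card (D \<union> ?f ` D) \<le> Coset.order G"
    unfolding Coset.order_def by (rule card_mono[OF fin sub])
  moreover have "card (D \<union> ?f ` D) + card (D \<inter> ?f ` D) = card D + card (?f ` D)"
    using card_Un_Int[of D "?f ` D"] finD by simp
  ultimately show ?thesis unfolding eq using card_image[OF inj] by linarith
qed

text \<open>A first factor d is fixed such that h / d has at most one square root in D. Of the at
  least four e in D with h / (d e) in D, at most three produce a coincidence among the factors, so
  one remains.\<close>

lemma three_distinct_factors:
  assumes fin: "finite (carrier G)" and D: "D \<subseteq> carrier G" and h: "h \<in> carrier G"
    and big: "Coset.order G + 4 \<le> 2 * card D"
  obtains a b c where "a \<in> D" "b \<in> D" "c \<in> D" "a \<noteq> b" "a \<noteq> c" "b \<noteq> c" "a \<otimes> (b \<otimes> c) = h"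
proof -
  have finD: "finite D" using fin D finite_subset by blast
  let ?t = "\<lambda>d. {e \<in> D. e \<otimes> e = h \<otimes> inv d}"
  \<comment> \<open>A given e in D is a square root of h / d for one d only, so the sets
    \<open>?t d\<close> have total size at most |D| and cannot all have two elements.\<close>
  have ex: "\<exists>d\<in>D. card (?t d) \<le> 1"
  proof (rule ccontr)
    assume "\<not> ?thesis"
    hence "2 * card D \<le> (\<Sum>d\<in>D. card (?t d))"
      using sum_bounded_below[of D 2 "\<lambda>d. card (?t d)"] by (force simp: mult.commute)
    also have "\<dots> = card (SIGMA d:D. ?t d)" using finD by simp
    also have "\<dots> \<le> card D"
    proof (rule card_inj_on_le[of snd])
      show "inj_on snd (SIGMA d:D. ?t d)"
      proof (rule inj_onI)
        fix u v assume uv: "u \<in> (SIGMA d:D. ?t d)" "v \<in> (SIGMA d:D. ?t d)" "snd u = snd v"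
        have G: "fst u \<in> carrier G" "fst v \<in> carrier G" using uv D by auto
        have "h \<otimes> inv fst u = h \<otimes> inv fst v" using uv by auto
        hence "inv fst u = inv fst v" using h G by simp
        hence "fst u = fst v" using G by (metis inv_inv)
        thus "u = v" using uv by (simp add: prod_eq_iff)
      qed
    qed (use finD in auto)
    finally have "card D = 0" by simp
    thus False using big by simp
  qed
  then obtain d where d: "d \<in> D" "card (?t d) \<le> 1" by blast
  have dG: "d \<in> carrier G" using d D by auto
  let ?R = "{e \<in> D. (h \<otimes> inv d) \<otimes> inv e \<in> D}"
  \<comment> \<open>The bad choices of e: a square root of h / d makes the last two factors equal;
    the other two make e or the third factor equal to d.\<close>
  let ?B = "?t d \<union> {d, (h \<otimes> inv d) \<otimes> inv d}"
  have R4: "4 \<le> card ?R"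
    using card_representations[OF fin D, of "h \<otimes> inv d"] h dG big by simp
  have "card ?B \<le> card (?t d) + card {d, (h \<otimes> inv d) \<otimes> inv d}" by (rule card_Un_le)
  also have "\<dots> \<le> 1 + 2" using d(2) by (intro add_mono) (auto simp: card_insert_if)
  finally have B3: "card ?B \<le> 3" by simp
  have "\<not> ?R \<subseteq> ?B"
    using card_mono[of ?B ?R] finD R4 B3 by auto
  then obtain e where e: "e \<in> ?R" "e \<notin> ?B" by blast
  define f where "f = (h \<otimes> inv d) \<otimes> inv e"
  have fD: "f \<in> D" and eD: "e \<in> D" using e f_def by auto
  have G: "e \<in> carrier G" "f \<in> carrier G" using fD eD D by auto
  have fe: "f \<otimes> e = h \<otimes> inv d" using G h dG by (simp add: f_def m_assoc)
  have ef: "e \<otimes> f = h \<otimes> inv d" using fe G m_comm by metis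
  have "e \<noteq> f" using ef e eD by auto
  moreover have "d \<noteq> e" using e by auto
  moreover have "d \<noteq> f"
  proof
    assume "d = f"
    hence "e = (h \<otimes> inv d) \<otimes> inv d" using ef G dG h by (metis inv_solve_right inv_closed m_closed)
    thus False using e by auto
  qed
  moreover have "d \<otimes> (e \<otimes> f) = h" unfolding ef using dG h
    by (metis inv_closed inv_solve_right m_closed m_comm)
  ultimately show ?thesis using that d(1) eD fD by blast
qed

section \<open>Products over subsets of prescribed size\<close>

lemma finprod_id_closed [simp]:
  "S \<subseteq> carrier G \<Longrightarrow> finprod G (\<lambda>x. x) S \<in> carrier G"
  by (rule finprod_closed) auto

lemma finprod_id_Un:
  assumes "finite S" "finite T" "S \<inter> T = {}" "S \<subseteq> carrier G" "T \<subseteq> carrier G"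
  shows "finprod G (\<lambda>x. x) (S \<union> T) = finprod G (\<lambda>x. x) S \<otimes> finprod G (\<lambda>x. x) T"
  by (rule finprod_Un_disjoint) (use assms in auto)

text \<open>Any k - 3 elements are set aside as factors. The other |D| - k + 3 elements must meet
  the density condition of \<open>three_distinct_factors\<close>, and this is the bound on
  k.\<close>

lemma subset_product_small:
  assumes fin: "finite (carrier G)" and D: "D \<subseteq> carrier G" and h: "h \<in> carrier G"
    and k: "3 \<le> k" "k \<le> card D" and big: "Coset.order G + 2 * k \<le> 2 * card D + 2"
  shows "\<exists>S\<subseteq>D. card S = k \<and> finprod G (\<lambda>x. x) S = h"
proof -
  have finD: "finite D" using fin D finite_subset by blast
  obtain U where U: "U \<subseteq> D" "card U = k - 3" "finite U"
    using k obtain_subset_with_card_n[of "k - 3" D] by (metis diff_le_self le_trans)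
  have UG: "U \<subseteq> carrier G" using U D by auto
  let ?u = "finprod G (\<lambda>x. x) U"
  have cD: "card (D - U) = card D - (k - 3)" using U by (simp add: card_Diff_subset)
  have pre: "D - U \<subseteq> carrier G" "h \<otimes> inv ?u \<in> carrier G" "Coset.order G + 4 \<le> 2 * card (D - U)"
    using cD big k D h UG by auto
  obtain a b c where abc: "a \<in> D - U" "b \<in> D - U" "c \<in> D - U" "a \<noteq> b" "a \<noteq> c" "b \<noteq> c"
     "a \<otimes> (b \<otimes> c) = h \<otimes> inv ?u"
    by (rule three_distinct_factors[OF fin pre])
  have G: "a \<in> carrier G" "b \<in> carrier G" "c \<in> carrier G" using abc D by auto
  have "finprod G (\<lambda>x. x) {a,b,c} = a \<otimes> (b \<otimes> c)"
    using abc G by (simp add: finprod_insert)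
  moreover have "finprod G (\<lambda>x. x) (U \<union> {a,b,c}) = ?u \<otimes> finprod G (\<lambda>x. x) {a,b,c}"
    by (rule finprod_id_Un) (use abc G UG U in auto)
  ultimately have "finprod G (\<lambda>x. x) (U \<union> {a,b,c}) = h"
    using abc(7) h UG by (metis finprod_id_closed inv_closed inv_solve_right m_closed m_comm)
  moreover have "card (U \<union> {a,b,c}) = k"
    using abc U k by (subst card_Un_disjoint) auto
  moreover have "U \<union> {a,b,c} \<subseteq> D" using abc U by auto
  ultimately show ?thesis by blast
qed

text \<open>A subset whose product is the product of D divided by h has a complement in D with
  product h.\<close>

lemma subset_product_complement:
  assumes fin: "finite (carrier G)" and D: "D \<subseteq> carrier G" and k: "k \<le> card D"
    and all: "\<And>h. h \<in> carrier G \<Longrightarrow> \<exists>S\<subseteq>D. card S = card D - k \<and> finprod G (\<lambda>x. x) S = h"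
    and h: "h \<in> carrier G"
  shows "\<exists>S\<subseteq>D. card S = k \<and> finprod G (\<lambda>x. x) S = h"
proof -
  have finD: "finite D" using fin D finite_subset by blast
  let ?p = "finprod G (\<lambda>x. x)"
  obtain S where S: "S \<subseteq> D" "card S = card D - k" "?p S = ?p D \<otimes> inv h"
    using all[of "?p D \<otimes> inv h"] D h by auto
  have finS: "finite S" using S finD finite_subset by blast
  have "?p (S \<union> (D - S)) = ?p S \<otimes> ?p (D - S)"
    by (rule finprod_id_Un) (use S D finD finS in auto)
  moreover have "S \<union> (D - S) = D" using S by auto
  ultimately have e: "?p D = (?p D \<otimes> inv h) \<otimes> ?p (D - S)" using S by simp
  have cl: "?p D \<in> carrier G" "?p (D - S) \<in> carrier G" using D by (auto intro!: finprod_id_closed)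
  have "?p (D - S) = h"
  proof -
    have "?p D \<otimes> \<one> = ?p D \<otimes> (inv h \<otimes> ?p (D - S))"
      using e cl h by (simp add: m_assoc)
    hence "inv h \<otimes> ?p (D - S) = \<one>" using cl h by (metis Units_eq Units_l_cancel inv_closed m_closed one_closed)
    thus ?thesis using cl h by (metis inv_closed inv_inv inv_unique' inv_equality m_comm)
  qed
  moreover have "card (D - S) = k" using S k finS by (simp add: card_Diff_subset)
  ultimately show ?thesis by blast
qed

text \<open>Averaging over d: the pairs (d, y) with y and y d in Y inject into Y x Y by (y, y d), so
  the mean size of the intersections is at most |Y|^2 / N.\<close>

lemma exists_small_translate_intersection:
  assumes fin: "finite (carrier G)" and Y: "Y \<subseteq> carrier G"
  shows "\<exists>d\<in>carrier G. Coset.order G * card {y \<in> Y. y \<otimes> d \<in> Y} \<le> card Y ^ 2"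
proof (rule ccontr)
  assume "\<not> ?thesis"
  hence *: "card Y ^ 2 < Coset.order G * card {y \<in> Y. y \<otimes> d \<in> Y}" if "d \<in> carrier G" for d
    using that by (meson not_le)
  have finY: "finite Y" using fin Y finite_subset by blast
  have ne: "carrier G \<noteq> {}" by auto
  have "(\<Sum>d\<in>carrier G. card Y ^ 2) < (\<Sum>d\<in>carrier G. Coset.order G * card {y \<in> Y. y \<otimes> d \<in> Y})"
    by (rule sum_strict_mono) (use * fin ne in auto)
  also have "\<dots> = Coset.order G * (\<Sum>d\<in>carrier G. card {y \<in> Y. y \<otimes> d \<in> Y})"
    by (simp add: sum_distrib_left)
  also have "(\<Sum>d\<in>carrier G. card {y \<in> Y. y \<otimes> d \<in> Y}) = card (SIGMA d:carrier G. {y \<in> Y. y \<otimes> d \<in> Y})"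
    using fin finY by simp
  also have "\<dots> \<le> card (Y \<times> Y)"
  proof (rule card_inj_on_le[of "\<lambda>(d,y). (y, y \<otimes> d)"])
    show "inj_on (\<lambda>(d, y). (y, y \<otimes> d)) (SIGMA d:carrier G. {y \<in> Y. y \<otimes> d \<in> Y})"
      using Y by (auto simp: inj_on_def subset_iff)
  qed (use finY in auto)
  finally show False by (simp add: Coset.order_def power2_eq_square card_cartesian_product)
qed

text \<open>The set Q grows by a pair x, y of fresh elements with x = y d. A product missed by the
  new subsets forces both a missed element and its translate by d to be missed by the old ones, so for
  a d chosen by averaging the density of the missed elements is at most squared.\<close>

lemma subset_products_cover:
  assumes fin: "finite (carrier G)" and D: "D \<subseteq> carrier G"
    and big: "Coset.order G + 4 * i \<le> 2 * card D + 2"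
  shows "\<exists>Q\<subseteq>D. card Q = 2 * i \<and>
     real (card (carrier G - finprod G (\<lambda>x. x) ` {T. T \<subseteq> Q \<and> card T = i}))
       \<le> real (Coset.order G) * (1 - 1 / real (Coset.order G)) ^ (2 ^ i)"
  using big
proof (induction i)
  case 0
  have N: "Coset.order G > 0" using fin order_gt_0_iff_finite by blast
  \<comment> \<open>The empty product reaches only the unit: the density of missed elements starts
    at 1 - 1/N and is squared in every round.\<close>
  have "{T. T \<subseteq> {} \<and> card T = 0} = {{} :: 'a set}" by auto
  hence "card (carrier G - finprod G (\<lambda>x. x) ` {T. T \<subseteq> {} \<and> card T = 0}) = Coset.order G - 1"
    using fin by (simp add: Coset.order_def)
  thus ?case using N by (intro exI[of _ "{}"]) (auto simp: field_simps)
next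
  case (Suc i)
  let ?p = "finprod G (\<lambda>x. x)"
  let ?N = "real (Coset.order G)"
  have N: "Coset.order G > 0" using fin order_gt_0_iff_finite by blast
  have finD: "finite D" using fin D finite_subset by blast
  obtain Q where Q: "Q \<subseteq> D" "card Q = 2 * i" and
    bnd: "real (card (carrier G - ?p ` {T. T \<subseteq> Q \<and> card T = i})) \<le> ?N * (1 - 1 / ?N) ^ (2 ^ i)"
    using Suc by auto
  have finQ: "finite Q" using Q finD finite_subset by blast
  define Z where "Z = ?p ` {T. T \<subseteq> Q \<and> card T = i}"
  define Y where "Y = carrier G - Z"
  have XG: "Z \<subseteq> carrier G" using Q D unfolding Z_def by (auto intro!: finprod_id_closed)
  have YG: "Y \<subseteq> carrier G" unfolding Y_def by auto
  have "\<exists>T\<subseteq>Q. card T = i" using Q obtain_subset_with_card_n[of i Q] by (metis le_add1 mult_2)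
  hence Xne: "Z \<noteq> {}" unfolding Z_def by auto
  have cY: "card Y < Coset.order G" unfolding Y_def Coset.order_def
    using XG Xne fin by (intro psubset_card_mono) auto
  have cD: "card (D - Q) = card D - 2 * i" using Q finQ by (simp add: card_Diff_subset)
  \<comment> \<open>The elements x and y are distinct only if d is not the unit. If nothing is
    missed, any other d will do; otherwise the unit violates the average, because Y is a proper
    subset of the group.\<close>
  have *: "\<exists>d\<in>carrier G. d \<noteq> \<one> \<and> Coset.order G * card {y \<in> Y. y \<otimes> d \<in> Y} \<le> card Y ^ 2"
  proof (cases "Y = {}")
    case True
    have "card (D - Q) > 1"
      using cD Suc.prems card_mono[OF fin D] by (simp add: Coset.order_def)
    moreover have "card (D - Q) \<le> card (carrier G)" using D by (intro card_mono fin) auto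
    ultimately have "card (carrier G) > 1" by linarith
    hence "\<not> carrier G \<subseteq> {\<one>}" using card_mono[of "{\<one>}" "carrier G"] by auto
    hence "\<exists>d\<in>carrier G. d \<noteq> \<one>" by auto
    thus ?thesis using True by auto
  next
    case False
    obtain d where d: "d \<in> carrier G" "Coset.order G * card {y \<in> Y. y \<otimes> d \<in> Y} \<le> card Y ^ 2"
      using exists_small_translate_intersection[OF fin YG] by blast
    have "d \<noteq> \<one>"
    proof
      assume "d = \<one>"
      hence "{y \<in> Y. y \<otimes> d \<in> Y} = Y" using YG by auto
      hence "Coset.order G * card Y \<le> card Y * card Y" using d by (simp add: power2_eq_square)
      moreover have "card Y > 0" using False fin YG by (simp add: card_gt_0_iff finite_subset)
      ultimately show False using cY by simp
    qed
    thus ?thesis using d by blast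
  qed
  then obtain d where d: "d \<in> carrier G" "d \<noteq> \<one>" "Coset.order G * card {y \<in> Y. y \<otimes> d \<in> Y} \<le> card Y ^ 2"
    by blast
  \<comment> \<open>The size hypothesis for i + 1 gives 2 |D - Q| \<ge> N + 2, so a fresh pair with
    quotient d exists.\<close>
  have "D - Q \<subseteq> carrier G" using D by auto
  from card_differences[OF fin this d(1)]
  have "card {y \<in> D - Q. y \<otimes> d \<in> D - Q} \<noteq> 0" using cD Suc.prems by arith
  then obtain y where y: "y \<in> D - Q" "y \<otimes> d \<in> D - Q" by (metis (no_types, lifting) card.empty equals0I mem_Collect_eq)
  define x where "x = y \<otimes> d"
  have yG: "y \<in> carrier G" and xG: "x \<in> carrier G" using y D x_def by auto
  have xy: "x \<noteq> y" using d yG unfolding x_def by simp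
  define Q' where "Q' = Q \<union> {x,y}"
  have Q': "Q' \<subseteq> D" "card Q' = 2 * Suc i"
  proof -
    have xyD: "x \<in> D - Q" "y \<in> D - Q" using y x_def by auto
    thus "Q' \<subseteq> D" using Q unfolding Q'_def by auto
    have "card Q' = card Q + card {x, y}" unfolding Q'_def using xyD finQ by (intro card_Un_disjoint) auto
    thus "card Q' = 2 * Suc i" using xy Q by simp
  qed
  define Z' where "Z' = ?p ` {T. T \<subseteq> Q' \<and> card T = Suc i}"
  have ins: "u \<otimes> z \<in> Z'" if "u \<in> Z" "z = x \<or> z = y" for u z
  proof -
    from that(1) obtain T where T0: "u = ?p T" "T \<in> {T. T \<subseteq> Q \<and> card T = i}" unfolding Z_def by (rule imageE)
    hence T: "T \<subseteq> Q" "card T = i" "u = ?p T" by simp_all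
    have finT: "finite T" using T finQ finite_subset by blast
    have z: "z \<notin> Q" "z \<in> carrier G" using that y(1) y(2)[folded x_def] xG yG by auto
    have "?p (insert z T) = z \<otimes> ?p T"
      by (rule finprod_insert) (use T z finT Q D in auto)
    moreover have "?p T \<in> carrier G" using T Q D by auto
    ultimately have "?p (insert z T) = u \<otimes> z" using T z m_comm by auto
    moreover have "insert z T \<subseteq> Q'" "card (insert z T) = Suc i"
      using T z finT that unfolding Q'_def by (auto simp: card_insert_if)
    ultimately show ?thesis unfolding Z'_def by (intro image_eqI[of _ _ "insert z T"]) auto
  qed
  have "card (carrier G - Z') \<le> card {v \<in> Y. v \<otimes> d \<in> Y}"
  proof (rule card_inj_on_le[of "\<lambda>g. g \<otimes> inv x"])
    show "inj_on (\<lambda>g. g \<otimes> inv x) (carrier G - Z')" using xG by (auto simp: inj_on_def)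
    show "(\<lambda>g. g \<otimes> inv x) ` (carrier G - Z') \<subseteq> {v \<in> Y. v \<otimes> d \<in> Y}"
    proof (rule image_subsetI)
      fix g assume "g \<in> carrier G - Z'"
      hence g: "g \<in> carrier G" "g \<notin> Z'" by auto
      have "g \<otimes> inv x \<otimes> x = g" using g xG by (simp add: m_assoc)
      hence 1: "g \<otimes> inv x \<notin> Z" using ins[of "g \<otimes> inv x" x] g by auto
      \<comment> \<open>As x = y d, translating g / x by d gives g / y.\<close>
      have "g \<otimes> inv x \<otimes> d \<otimes> y = g \<otimes> inv x \<otimes> x" unfolding x_def using g yG d xG
        by (simp add: m_assoc m_comm[of d y])
      hence "g \<otimes> inv x \<otimes> d \<otimes> y = g" using \<open>g \<otimes> inv x \<otimes> x = g\<close> by simp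
      hence 2: "g \<otimes> inv x \<otimes> d \<notin> Z" using ins[of "g \<otimes> inv x \<otimes> d" y] g by auto
      show "g \<otimes> inv x \<in> {v \<in> Y. v \<otimes> d \<in> Y}" using 1 2 g xG d unfolding Y_def by auto
    qed
    show "finite {v \<in> Y. v \<otimes> d \<in> Y}" using finite_subset[OF YG fin] by simp
  qed
  hence "Coset.order G * card (carrier G - Z') \<le> card Y ^ 2" using d(3) by (meson le_trans mult_le_mono2)
  hence "?N * real (card (carrier G - Z')) \<le> real (card Y) ^ 2"
    by (metis of_nat_le_iff of_nat_mult of_nat_power)
  also have "\<dots> \<le> (?N * (1 - 1 / ?N) ^ (2 ^ i)) ^ 2"
    by (rule power_mono) (use bnd in \<open>auto simp: Z_def Y_def\<close>)
  also have "\<dots> = ?N * (?N * (1 - 1 / ?N) ^ (2 ^ Suc i))"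
    by (simp add: power2_eq_square power_add[symmetric] mult_2)
  finally have "real (card (carrier G - Z')) \<le> ?N * (1 - 1 / ?N) ^ (2 ^ Suc i)" using N by simp
  thus ?case using Q' unfolding Z'_def by (intro exI[of _ Q'] conjI)
qed

end

lemma half_power_bound:
  assumes "N > 0" shows "(1 - 1 / real N) ^ N \<le> 1/2"
proof -
  have "1 - 1/real N \<le> exp (- (1/real N))" using exp_ge_add_one_self[of "- (1/real N)"] by simp
  hence "(1 - 1 / real N) ^ N \<le> exp (- (1/real N)) ^ N" using assms by (intro power_mono) auto
  also have "\<dots> = exp (-1)" using assms by (simp add: exp_of_nat_mult[symmetric])
  also have "\<dots> \<le> 1/2" using exp_ge_add_one_self[of 1] by (simp add: exp_minus field_simps)
  finally show ?thesis .
qed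

text \<open>From N < 2^j and j \<le> 2^i follows 2^(i+j) \<ge> N j, so the bound of
  \<open>subset_products_cover\<close> is at most N / 2^j < 1 and no element is missed. The
  remaining k - (i+j) factors are taken outside Q.\<close>

lemma (in comm_group) subset_products_everything:
  assumes fin: "finite (carrier G)" and D: "D \<subseteq> carrier G" and h: "h \<in> carrier G"
    and j: "Coset.order G < 2 ^ j" "j \<le> 2 ^ i"
    and big: "Coset.order G + 4 * (i + j) \<le> 2 * card D + 2"
    and k: "i + j \<le> k" "k + (i + j) \<le> card D"
  shows "\<exists>S\<subseteq>D. card S = k \<and> finprod G (\<lambda>x. x) S = h"
proof -
  let ?p = "finprod G (\<lambda>x. x)"
  let ?N = "real (Coset.order G)"
  have N: "Coset.order G > 0" using fin order_gt_0_iff_finite by blast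
  have finD: "finite D" using fin D finite_subset by blast
  obtain Q where Q: "Q \<subseteq> D" "card Q = 2 * (i + j)" and
    bnd: "real (card (carrier G - ?p ` {T. T \<subseteq> Q \<and> card T = i + j})) \<le> ?N * (1 - 1 / ?N) ^ (2 ^ (i + j))"
    using subset_products_cover[OF fin D big] by auto
  have finQ: "finite Q" using Q finD finite_subset by blast
  have "Coset.order G * j \<le> 2 ^ (i + j)" using j by (simp add: power_add mult.commute mult_mono less_imp_le)
  hence "(1 - 1 / ?N) ^ (2 ^ (i + j)) \<le> (1 - 1 / ?N) ^ (Coset.order G * j)"
    using N by (intro power_decreasing) auto
  also have "\<dots> = ((1 - 1 / ?N) ^ Coset.order G) ^ j" by (simp add: power_mult)
  also have "\<dots> \<le> (1/2) ^ j" using half_power_bound[OF N] N by (intro power_mono) auto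
  finally have "?N * (1 - 1 / ?N) ^ (2 ^ (i + j)) \<le> ?N * (1/2) ^ j" using N by (intro mult_left_mono) auto
  also have "\<dots> < 1"
  proof -
    have "?N < 2 ^ j" using j(1) by (metis of_nat_less_iff of_nat_numeral of_nat_power)
    thus ?thesis by (simp add: field_simps power_divide)
  qed
  finally have "card (carrier G - ?p ` {T. T \<subseteq> Q \<and> card T = i + j}) = 0" using bnd by linarith
  hence cov: "carrier G \<subseteq> ?p ` {T. T \<subseteq> Q \<and> card T = i + j}" using fin by auto
  have "card (D - Q) = card D - 2 * (i + j)" using Q finQ by (simp add: card_Diff_subset)
  then obtain W where W: "W \<subseteq> D - Q" "card W = k - (i + j)" "finite W"
    using obtain_subset_with_card_n[of "k - (i + j)" "D - Q"] k
    by (metis diff_le_mono diff_diff_left mult_2 add_le_imp_le_diff)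
  have WG: "W \<subseteq> carrier G" using W D by auto
  have "h \<otimes> inv (?p W) \<in> carrier G" using h WG by auto
  with cov have "h \<otimes> inv (?p W) \<in> ?p ` {T. T \<subseteq> Q \<and> card T = i + j}" by (rule subsetD)
  then obtain T where "h \<otimes> inv (?p W) = ?p T" "T \<in> {T. T \<subseteq> Q \<and> card T = i + j}" by (rule imageE)
  hence T: "T \<subseteq> Q" "card T = i + j" "?p T = h \<otimes> inv (?p W)" by simp_all
  have finT: "finite T" using T finQ finite_subset by blast
  have "?p (T \<union> W) = ?p T \<otimes> ?p W"
    by (rule finprod_id_Un) (use T W finT Q D in auto)
  also have "\<dots> = h" using T h WG by (simp add: m_assoc)
  finally have "?p (T \<union> W) = h" .
  moreover have "card (T \<union> W) = k" using T W finT k by (subst card_Un_disjoint) auto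
  moreover have "T \<union> W \<subseteq> D" using T W Q by auto
  ultimately show ?thesis by blast
qed

text \<open>Turns 2^(j-1) \<le> N \<le> 5 q / 4 + 9 into a lower bound for q that is linear in j, as
  the number of pairs is.\<close>

lemma exponent_margin: "8 \<le> j \<Longrightarrow> 40 * j + 1 \<le> 2 ^ j + (65 :: nat)"
  by (induction j rule: nat_induct_at_least) auto

theorem (in comm_group) subset_products_large:
  assumes fin: "finite (carrier G)" and D: "D \<subseteq> carrier G" and h: "h \<in> carrier G"
    and q: "65 \<le> q" "card D = q + 2" and N: "4 * Coset.order G \<le> 5 * q + 36"
    and k: "4 \<le> k" "k \<le> q - 2"
  shows "\<exists>S\<subseteq>D. card S = k \<and> finprod G (\<lambda>x. x) S = h"
proof -
  consider "Coset.order G + 2 * k \<le> 2 * card D + 2" | "Coset.order G + 2 * (card D - k) \<le> 2 * card D + 2"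
    | "2 * card D + 2 < Coset.order G + 2 * k" "2 * card D + 2 < Coset.order G + 2 * (card D - k)"
    by linarith
  thus ?thesis
  proof cases
    case 1
    thus ?thesis using subset_product_small[OF fin D h] k q by simp
  next
    case 2
    show ?thesis
      by (rule subset_product_complement[OF fin D _ _ h], use k q in simp,
          rule subset_product_small[OF fin D]) (use 2 k q in auto)
  next
    case 3
    \<comment> \<open>j is the least exponent from 7 on with N < 2^j. For these j one has j \<le>
      2^(j-4), which allows i = j - 4; the value 6 would still fail.\<close>
    have "\<exists>j\<ge>7. Coset.order G < 2 ^ j \<and> (j = 7 \<or> 2 ^ (j - 1) \<le> Coset.order G)"
    proof (cases "Coset.order G < 2 ^ 7")
      case True thus ?thesis by (intro exI[of _ 7]) auto
    next
      case False
      define j where "j = (LEAST j. Coset.order G < 2 ^ j)"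
      have j: "Coset.order G < 2 ^ j" unfolding j_def by (rule LeastI[of _ "Coset.order G"]) simp
      have "7 < j"
      proof (rule ccontr)
        assume "\<not> 7 < j" hence "(2::nat) ^ j \<le> 2 ^ 7" by (intro power_increasing) auto
        thus False using False j by simp
      qed
      moreover have "\<not> Coset.order G < 2 ^ (j - 1)"
        using not_less_Least[of "j - 1" "\<lambda>j. Coset.order G < 2 ^ j"] \<open>7 < j\<close> j_def by auto
      ultimately show ?thesis using j by (intro exI[of _ j]) auto
    qed
    then obtain j where j: "7 \<le> j" "Coset.order G < 2 ^ j" "j = 7 \<or> 2 ^ (j - 1) \<le> Coset.order G" by blast
    have i: "j \<le> 2 ^ (j - 4)"
      using j(1)
    proof (induction j rule: nat_induct_at_least)
      case (Suc n)
      hence "Suc n - 4 = Suc (n - 4)" by simp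
      thus ?case using Suc by simp
    qed simp
    \<comment> \<open>Four times the size requirement for i + j = 2 j - 4 pairs reads 4 N + 16 (2 j
      - 4) \<le> 8 q + 24; the bound on N leaves 3 q - 12 for the pairs.\<close>
    have "16 * (2 * j - 4) \<le> 3 * q - 12"
    proof (cases "j = 7")
      case True thus ?thesis using q by simp
    next
      case False
      hence j8: "8 \<le> j" using j by simp
      have "(2::nat) ^ j = 2 * 2 ^ (j - 1)" using j8 by (cases j) auto
      hence "2 * 2 ^ j \<le> 5 * q + 36" using j(3) False N by linarith
      moreover have "40 * j + 1 \<le> 2 ^ j + (65 :: nat)" by (rule exponent_margin[OF j8])
      moreover have "(2::nat) ^ 8 \<le> 2 ^ j" by (rule power_increasing) (use j8 in auto)
      ultimately show ?thesis using j8 by simp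
    qed
    hence big: "Coset.order G + 4 * (j - 4 + j) \<le> 2 * card D + 2" using N q j(1) by simp
    \<comment> \<open>As neither of the first two cases applies, \<open>big\<close> makes k and |D|
      - k both larger than 2 (i + j).\<close>
    show ?thesis
      by (rule subset_products_everything[OF fin D h j(2) i big]) (use 3 N q j(1) big in auto)
  qed
qed

section \<open>Polynomials over a field\<close>

lemma poly_bezout:
  fixes a b :: "'a::field poly"
  shows "\<exists>d u v. d = u * a + v * b \<and> d dvd a \<and> d dvd b"
proof (induction "if b = 0 then 0 else Suc (degree b)" arbitrary: a b rule: less_induct)
  case less
  show ?case
  proof (cases "b = 0")
    case True
    thus ?thesis by (intro exI[of _ a] exI[of _ 1] exI[of _ 0]) auto
  next
    case False
    have "(if a mod b = 0 then 0 else Suc (degree (a mod b))) < (if b = 0 then 0 else Suc (degree b))"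
      using False degree_mod_less[of b a] by auto
    from less[OF this] obtain d u v where d: "d = u * b + v * (a mod b)" "d dvd b" "d dvd a mod b" by blast
    have m: "a mod b = a - (a div b) * b" by (simp add: minus_div_mult_eq_mod)
    have "d = v * a + (u - v * (a div b)) * b" unfolding d(1) m by (simp add: algebra_simps)
    moreover have "d dvd a" using d(2,3) by (metis dvd_mod_iff)
    ultimately show ?thesis using d(2) by blast
  qed
qed

lemma irreducible_bezout:
  fixes p a :: "'a::field poly"
  assumes "irreducible p" "\<not> p dvd a"
  obtains u v where "u * p + v * a = 1"
proof -
  obtain d u v where d: "d = u * p + v * a" "d dvd p" "d dvd a" using poly_bezout by blast
  from d(2) obtain e where e: "p = d * e" by auto
  have "\<not> e dvd 1"
  proof
    assume "e dvd 1"
    hence "p dvd d" using e by (metis dvd_refl mult.right_neutral mult_dvd_mono)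
    thus False using d(3) assms(2) dvd_trans by blast
  qed
  hence "d dvd 1" using assms(1) e irreducibleD by blast
  then obtain w where "1 = d * w" by auto
  hence "(w * u) * p + (w * v) * a = 1" using d(1) by (simp add: algebra_simps)
  thus ?thesis using that by blast
qed

lemma fract_lowest_terms:
  fixes z :: "'a::field poly fract"
  obtains a b u v where "b \<noteq> 0" "z = Fract a b" "u * a + v * b = 1"
proof -
  obtain a b where ab: "z = Fract a b" "b \<noteq> 0" by (cases z) auto
  obtain d u v where d: "d = u * a + v * b" "d dvd a" "d dvd b" using poly_bezout by blast
  obtain a' where a': "a = d * a'" using d(2) by (rule dvdE)
  obtain b' where b': "b = d * b'" using d(3) by (rule dvdE)
  note * = a' b'
  have d0: "d \<noteq> 0" "b' \<noteq> 0" using ab(2) b' by auto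
  have "d * (u * a' + v * b') = u * a + v * b" unfolding * by (simp add: algebra_simps)
  hence "d * (u * a' + v * b') = d * 1" using d(1) by simp
  hence "u * a' + v * b' = 1" using d0 by simp
  moreover have "z = Fract a' b'" unfolding ab(1) * using d0 by (simp add: eq_fract)
  ultimately show ?thesis using that d0 by blast
qed

lemma exists_irreducible_divisor:
  fixes p :: "'a::field poly"
  assumes "degree p > 0"
  shows "\<exists>r. irreducible r \<and> r dvd p"
  using assms
proof (induction "degree p" arbitrary: p rule: less_induct)
  case less
  show ?case
  proof (cases "irreducible p")
    case True thus ?thesis by (intro exI[of _ p]) auto
  next
    case False
    have "p \<noteq> 0" using less.prems by auto
    moreover from this have "\<not> p dvd 1" using less.prems is_unit_iff_degree[of p] by auto
    ultimately obtain a b where ab: "p = a * b" "\<not> a dvd 1" "\<not> b dvd 1"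
      using False by (auto simp: irreducible_def)
    have nz: "a \<noteq> 0" "b \<noteq> 0" using ab \<open>p \<noteq> 0\<close> by auto
    have "degree a > 0" "degree b > 0" using ab nz by (auto simp: is_unit_iff_degree)
    moreover have "degree p = degree a + degree b" using ab nz by (simp add: degree_mult_eq)
    ultimately show ?thesis using less.hyps[of a] ab by (metis dvd_mult2 less_add_same_cancel1)
  qed
qed

lemma irreducible_poly_degree_pos: "irreducible (p :: 'a::field poly) \<Longrightarrow> degree p > 0"
  by (metis (no_types, lifting) irreducible_def is_unit_iff_degree neq0_conv)

section \<open>Fractions inside the algebraic closure\<close>

definition pemb :: "'a::field poly \<Rightarrow> 'a poly fract alg_closure" where
  "pemb p = to_ac (Fract p 1)"

lemma pemb_hom [simp]:
  fixes p r :: "'a::field poly"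
  shows "pemb (0 :: 'a poly) = 0" "pemb (1 :: 'a poly) = 1" "pemb (p + r) = pemb p + pemb r" "pemb (p - r) = pemb p - pemb r"
  "pemb (p * r) = pemb p * pemb r" "pemb (- p) = - pemb p" "pemb (p ^ n) = pemb p ^ n"
  "pemb (numeral m :: 'a poly) = numeral m"
proof -
  have m: "pemb (x * y) = pemb x * pemb y" for x y :: "'a poly"
    by (simp add: pemb_def flip: to_ac_mult)
  have o: "pemb (1 :: 'a poly) = 1" by (simp add: pemb_def flip: One_fract_def)
  have "Fract (numeral m :: 'a poly) 1 = numeral m"
    by (metis Fract_of_nat_eq of_nat_numeral)
  thus "pemb (numeral m :: 'a poly) = numeral m" by (simp add: pemb_def)
  show "pemb (p ^ n) = pemb p ^ n" by (induction n) (simp_all add: m o)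
  show "pemb (p * r) = pemb p * pemb r" "pemb (1 :: 'a poly) = 1" by (fact m o)+
qed (simp_all add: pemb_def Zero_fract_def flip: to_ac_add to_ac_diff to_ac_minus)

lemma pemb_eq_iff [simp]: "pemb p = pemb r \<longleftrightarrow> p = r"
  by (simp add: pemb_def eq_fract)

lemma pemb_eq_0_iff [simp]: "pemb p = 0 \<longleftrightarrow> p = 0"
  using pemb_eq_iff[of p 0] by (simp del: pemb_eq_iff)

lemma to_ac_Fract: "v \<noteq> 0 \<Longrightarrow> to_ac (Fract u v) = pemb u / pemb v"
  by (simp add: pemb_def flip: to_ac_divide)

section \<open>Weierstrass curves\<close>

locale weierstrass =
  fixes a1 a2 a3 a4 a6 :: "'a::{finite,field}" and q :: nat
  defines q_def: "q \<equiv> card (UNIV :: 'a set)"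
  assumes disc: "discriminant (a1, a2, a3, a4, a6) \<noteq> 0"
begin

abbreviation "cc \<equiv> (a1, a2, a3, a4, a6)"
definition hp :: "'a poly" where "hp = [:a3, a1:]"
definition gp :: "'a poly" where "gp = [:a6, a4, a2, 1:]"

lemma deg_gp [simp]: "degree gp = 3" by (simp add: gp_def)
lemma deg_hp: "degree hp \<le> 1" by (simp add: hp_def)

definition b2 where "b2 = a1\<^sup>2 + 4 * a2"
definition b4 where "b4 = 2 * a4 + a1 * a3"
definition b6 where "b6 = a3\<^sup>2 + 4 * a6"
definition b8 where "b8 = a1\<^sup>2 * a6 + 4 * a2 * a6 - a1 * a3 * a4 + a2 * a3\<^sup>2 - a4\<^sup>2"

lemma disc_b: "- (b2\<^sup>2 * b8) - 8 * b4 ^ 3 - 27 * b6\<^sup>2 + 9 * b2 * b4 * b6 \<noteq> 0"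
  using disc by (simp add: b2_def b4_def b6_def b8_def Let_def)

text \<open>Either root of the Weierstrass equation over K(x) will do; the other one is
  \<open>yb\<close>.\<close>

definition yy :: "'a poly fract alg_closure" where
  "yy = (SOME y. y\<^sup>2 + pemb hp * y = pemb gp)"

lemma yy_eq: "yy\<^sup>2 + pemb hp * yy = pemb gp"
  unfolding yy_def
proof (rule someI_ex)
  let ?p = "[:- pemb gp, pemb hp, 1:]"
  obtain x where "poly ?p x = 0"
    using alg_closed_imp_poly_has_root[of ?p] by auto
  thus "\<exists>x. x\<^sup>2 + pemb hp * x = pemb gp"
    by (intro exI[of _ x]) (simp add: algebra_simps power2_eq_square)
qed

lemma yy_sq: "yy * yy = pemb gp - pemb hp * yy"
  using yy_eq by (simp add: power2_eq_square algebra_simps)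

definition on_aff :: "'a \<Rightarrow> 'a \<Rightarrow> bool" where
  "on_aff x0 y0 \<longleftrightarrow> y0\<^sup>2 + poly hp x0 * y0 = poly gp x0"

lemma on_aff_iff: "on_aff x0 y0 \<longleftrightarrow> on_curve cc (Aff x0 y0)"
  unfolding on_aff_def by (simp add: hp_def gp_def algebra_simps power2_eq_square power3_eq_cube)

text \<open>The weighted degrees of A and B y have different parity, so their contributions cannot cancel.\<close>

lemma norm_degree:
  assumes "A \<noteq> 0 \<or> B \<noteq> 0"
  shows "A * A - A * B * hp - B * B * gp \<noteq> 0"
    and "int (degree (A * A - A * B * hp - B * B * gp)) =
      max (if A = 0 then 0 else 2 * int (degree A)) (if B = 0 then 0 else 2 * int (degree B) + 3)"
proof -
  let ?N = "A * A - A * B * hp - B * B * gp"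
  have *: "?N \<noteq> 0 \<and> int (degree ?N) = max (if A = 0 then 0 else 2 * int (degree A)) (if B = 0 then 0 else 2 * int (degree B) + 3)"
  proof (cases "A = 0 \<or> B = 0")
    case True
    have "gp \<noteq> 0" using deg_gp by (metis degree_0 zero_neq_numeral)
    thus ?thesis using True assms by (auto simp: degree_mult_eq)
  next
    case False
    have gp0: "gp \<noteq> 0" using deg_gp by (metis degree_0 zero_neq_numeral)
    have dA: "degree (A * A) = 2 * degree A" and dB: "degree (B * B * gp) = 2 * degree B + 3"
      using False gp0 by (simp_all add: degree_mult_eq)
    have dAB: "degree (A * B * hp) \<le> degree A + degree B + 1"
      using False deg_hp by (metis degree_mult_le add_mono le_trans degree_mult_eq order_refl)
    show ?thesis
    proof (cases "2 * degree A > 2 * degree B + 3")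
      case True
      have "degree (- (A * B * hp) - B * B * gp) < 2 * degree A"
        using dB dAB True by (intro degree_diff_less) auto
      hence "degree (A * A + (- (A * B * hp) - B * B * gp)) = 2 * degree A"
        using degree_add_eq_left[of "- (A * B * hp) - B * B * gp" "A * A"] dA by simp
      hence "degree ?N = 2 * degree A" by (simp add: algebra_simps)
      thus ?thesis using True False by auto
    next
      case le: False
      hence parity: "degree A \<le> degree B + 1" by presburger
      have "degree (A * A - A * B * hp) < 2 * degree B + 3"
        using dA dAB parity by (intro degree_diff_less) auto
      hence "degree ((A * A - A * B * hp) + - (B * B * gp)) = 2 * degree B + 3"
        using degree_add_eq_right[of "A * A - A * B * hp" "- (B * B * gp)"] dB by simp
      hence "degree ?N = 2 * degree B + 3" by (simp add: algebra_simps)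
      moreover from this have "?N \<noteq> 0" by (metis degree_0 add_is_0 zero_neq_numeral)
      ultimately show ?thesis using le False by auto
    qed
  qed
  thus "?N \<noteq> 0" "int (degree ?N) = max (if A = 0 then 0 else 2 * int (degree A)) (if B = 0 then 0 else 2 * int (degree B) + 3)"
    by auto
qed

text \<open>A relation A + B y = 0 makes the norm A^2 - A B h - B^2 g vanish, which
  \<open>norm_degree\<close> forbids. This is what makes pairs over K(x) and elements of the closure
  correspond faithfully.\<close>

lemma independent:
  assumes "pemb A + pemb B * yy = 0" shows "A = 0 \<and> B = 0"
proof (rule ccontr)
  assume n: "\<not> (A = 0 \<and> B = 0)"
  have A: "pemb A = - (pemb B * yy)" using assms by (simp add: eq_neg_iff_add_eq_0)
  have "pemb (A * A - A * B * hp - B * B * gp) = pemb B * pemb B * (yy * yy - (pemb gp - pemb hp * yy))"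
    unfolding pemb_hom A by (simp add: algebra_simps)
  hence "A * A - A * B * hp - B * B * gp = 0" by (simp add: yy_sq flip: pemb_eq_0_iff)
  thus False using norm_degree(1)[of A B] n by auto
qed

lemma independent_eq:
  "pemb A + pemb B * yy = pemb C + pemb D * yy \<longleftrightarrow> A = C \<and> B = D"
  using independent[of "A - C" "B - D"] by (auto simp: algebra_simps)

section \<open>The function field as a subfield\<close>

text \<open>The function field is realised inside the algebraic closure of K(x), where field arithmetic is
  available; \<open>LF\<close> and \<open>RR\<close> are the images of the function field and of the affine coordinate ring,
  and \<open>sg\<close> is the conjugation over K(x).\<close>

definition emb :: "'a ff \<Rightarrow> 'a poly fract alg_closure" where
  "emb f = to_ac (fst f) + to_ac (snd f) * yy"

definition yb :: "'a poly fract alg_closure" where "yb = - pemb hp - yy"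

lemma yb_sq: "yb * yb = pemb gp - pemb hp * yb"
  unfolding yb_def using yy_sq by (simp add: algebra_simps)

lemma yy_plus_yb: "yy + yb = - pemb hp" and yy_times_yb: "yy * yb = - pemb gp"
  unfolding yb_def using yy_sq by (simp_all add: algebra_simps)

lemma to_ac_gh:
  "to_ac (ffX ^ 3 + ffC a2 * ffX ^ 2 + ffC a4 * ffX + ffC a6) = pemb gp"
  "to_ac (ffC a1 * ffX + ffC a3) = pemb hp"
  unfolding pemb_def ffX_def ffC_def gp_def hp_def
  by (simp_all add: power3_eq_cube power2_eq_square algebra_simps flip: to_ac_add to_ac_mult)

text \<open>Stated for an arbitrary root z of the Weierstrass equation: z = \<open>yy\<close> makes
  \<open>emb\<close> multiplicative, and z = \<open>yb\<close> makes the conjugation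
  \<open>sg\<close> multiplicative.\<close>

lemma fmul_emb:
  assumes z: "z * z = pemb gp - pemb hp * z"
  shows "to_ac (fst (fmul cc f g)) + to_ac (snd (fmul cc f g)) * z =
    (to_ac (fst f) + to_ac (snd f) * z) * (to_ac (fst g) + to_ac (snd g) * z)"
proof -
  obtain r1 s1 r2 s2 where fg: "f = (r1, s1)" "g = (r2, s2)" by (cases f, cases g)
  define G where "G = ffX ^ 3 + ffC a2 * ffX ^ 2 + ffC a4 * ffX + ffC a6"
  define H where "H = ffC a1 * ffX + ffC a3"
  have GH: "to_ac G = pemb gp" "to_ac H = pemb hp" unfolding G_def H_def by (rule to_ac_gh)+
  have "fmul cc f g = (r1 * r2 + s1 * s2 * G, r1 * s2 + r2 * s1 - s1 * s2 * H)"
    unfolding fg G_def H_def by (simp add: Let_def)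
  hence "to_ac (fst (fmul cc f g)) + to_ac (snd (fmul cc f g)) * z =
    to_ac r1 * to_ac r2 + (to_ac r1 * to_ac s2 + to_ac r2 * to_ac s1) * z
      + to_ac s1 * to_ac s2 * (pemb gp - pemb hp * z)"
    by (simp add: GH algebra_simps)
  also have "\<dots> = (to_ac r1 + to_ac s1 * z) * (to_ac r2 + to_ac s2 * z)"
    unfolding z[symmetric] by (simp add: algebra_simps)
  finally show ?thesis by (simp add: fg)
qed

lemma emb_mul: "emb (fmul cc f g) = emb f * emb g"
  unfolding emb_def by (rule fmul_emb[OF yy_sq])
lemma emb_add: "emb (fadd f g) = emb f + emb g"
  unfolding emb_def fadd_def by (simp add: algebra_simps)
lemma emb_sub: "emb (fsub f g) = emb f - emb g"
  unfolding emb_def fsub_def by (simp add: algebra_simps)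
lemma emb_zero [simp]: "emb fzero = 0"
  by (simp add: emb_def fzero_def)
lemma emb_const: "emb (fconst a) = pemb [:a:]"
  by (simp add: emb_def fconst_def ffC_def pemb_def)
lemma emb_X: "emb fX = pemb [:0, 1:]"
  by (simp add: emb_def fX_def ffX_def pemb_def)
lemma emb_Y: "emb fY = yy"
  by (simp add: emb_def fY_def)

lemma emb_eq_0_iff [simp]: "emb f = 0 \<longleftrightarrow> f = fzero"
proof
  assume e: "emb f = 0"
  obtain a b where ab: "fst f = Fract a b" "b \<noteq> 0" by (cases "fst f") auto
  obtain c d where cd: "snd f = Fract c d" "d \<noteq> 0" by (cases "snd f") auto
  have nz: "pemb b \<noteq> 0" "pemb d \<noteq> 0" using ab cd by simp_all
  have "pemb a / pemb b + pemb c / pemb d * yy = 0"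
    using e unfolding emb_def ab cd to_ac_Fract[OF ab(2)] to_ac_Fract[OF cd(2)] .
  hence "pemb b * pemb d * (pemb a / pemb b + pemb c / pemb d * yy) = 0" by simp
  hence "pemb (a * d) + pemb (c * b) * yy = 0"
    using nz by (simp add: distrib_left mult_ac)
  from independent[OF this] have "a = 0" "c = 0" using ab cd by auto
  thus "f = fzero" using ab cd by (simp add: fzero_def prod_eq_iff fract_collapse)
qed simp

lemma inj_emb: "inj emb"
proof (rule injI)
  fix f g assume "emb f = emb g"
  hence "fsub f g = fzero" using emb_sub[of f g] emb_eq_0_iff[of "fsub f g"] by simp
  thus "f = g" by (simp add: fsub_def fzero_def prod_eq_iff)
qed

lemma emb_eq_iff [simp]: "emb f = emb g \<longleftrightarrow> f = g"
  using inj_emb by (simp add: inj_eq)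

definition iemb :: "'a poly fract alg_closure \<Rightarrow> 'a ff" where "iemb = inv_into UNIV emb"

lemma iemb_emb [simp]: "iemb (emb f) = f"
  unfolding iemb_def by (rule inv_f_f[OF inj_emb])

definition LF :: "'a poly fract alg_closure set" where "LF = range emb"
definition RR :: "'a poly fract alg_closure set" where
  "RR = {z. \<exists>A B. z = pemb A + pemb B * yy}"

lemma emb_iemb [simp]: "z \<in> LF \<Longrightarrow> emb (iemb z) = z"
  by (auto simp: LF_def)

lemma emb_LF [simp]: "emb f \<in> LF" by (simp add: LF_def)

lemma RR_I: "pemb A + pemb B * yy \<in> RR" by (auto simp: RR_def)

lemma RR_E: assumes "z \<in> RR" obtains A B where "z = pemb A + pemb B * yy"
  using assms by (auto simp: RR_def)

lemma RR_pemb [simp]: "pemb A \<in> RR" using RR_I[of A 0] by simp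
lemma RR_yy [simp]: "yy \<in> RR" using RR_I[of 0 1] by simp
lemma RR_0 [simp]: "0 \<in> RR" and RR_1 [simp]: "1 \<in> RR"
  using RR_pemb[of 0] RR_pemb[of 1] by (simp_all del: RR_pemb)

lemma RR_add [simp]: assumes "z \<in> RR" "w \<in> RR" shows "z + w \<in> RR"
proof -
  obtain A B C D where "z = pemb A + pemb B * yy" "w = pemb C + pemb D * yy"
    using assms by (metis RR_E)
  thus ?thesis using RR_I[of "A + C" "B + D"] by (simp add: algebra_simps)
qed

lemma RR_uminus [simp]: assumes "z \<in> RR" shows "- z \<in> RR"
proof -
  obtain A B where "z = pemb A + pemb B * yy" using assms by (metis RR_E)
  thus ?thesis using RR_I[of "- A" "- B"] by (simp add: algebra_simps)
qed

lemma RR_diff [simp]: "z \<in> RR \<Longrightarrow> w \<in> RR \<Longrightarrow> z - w \<in> RR"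
  using RR_add[of z "- w"] by simp

lemma RR_mult [simp]: assumes "z \<in> RR" "w \<in> RR" shows "z * w \<in> RR"
proof -
  obtain A B C D where zw: "z = pemb A + pemb B * yy" "w = pemb C + pemb D * yy"
    using assms by (metis RR_E)
  have "z * w = pemb A * pemb C + (pemb A * pemb D + pemb B * pemb C) * yy + pemb B * pemb D * (yy * yy)"
    unfolding zw by (simp add: algebra_simps)
  also have "\<dots> = pemb (A * C + B * D * gp) + pemb (A * D + B * C - B * D * hp) * yy"
    unfolding yy_sq by (simp add: algebra_simps)
  finally show ?thesis using RR_I by metis
qed

lemma RR_power [simp]: "z \<in> RR \<Longrightarrow> z ^ n \<in> RR"
  by (induction n) auto

lemma RR_yb [simp]: "yb \<in> RR" unfolding yb_def by simp

lemma LF_iff: "z \<in> LF \<longleftrightarrow> (\<exists>g\<in>RR. \<exists>C. C \<noteq> 0 \<and> z = g / pemb C)"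
proof
  assume "z \<in> LF"
  then obtain f where f: "z = emb f" by (auto simp: LF_def)
  obtain a b where ab: "fst f = Fract a b" "b \<noteq> 0" by (cases "fst f") auto
  obtain c d where cd: "snd f = Fract c d" "d \<noteq> 0" by (cases "snd f") auto
  have "z = (pemb (a * d) + pemb (c * b) * yy) / pemb (b * d)"
    unfolding f emb_def ab cd using ab(2) cd(2) by (simp add: to_ac_Fract add_divide_distrib)
  moreover have "b * d \<noteq> 0" using ab cd by simp
  ultimately show "\<exists>g\<in>RR. \<exists>C. C \<noteq> 0 \<and> z = g / pemb C" using RR_I by blast
next
  assume "\<exists>g\<in>RR. \<exists>C. C \<noteq> 0 \<and> z = g / pemb C"
  then obtain A B C where z: "C \<noteq> 0" "z = (pemb A + pemb B * yy) / pemb C" by (auto simp: RR_def)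
  have "z = emb (Fract A C, Fract B C)"
    unfolding emb_def z(2) using z(1) by (simp add: to_ac_Fract add_divide_distrib)
  thus "z \<in> LF" by (simp add: LF_def)
qed

lemma LF_E:
  assumes "z \<in> LF" obtains g C where "g \<in> RR" "C \<noteq> 0" "z = g / pemb C"
  using assms LF_iff by blast

lemma RR_LF [simp]: "z \<in> RR \<Longrightarrow> z \<in> LF"
  unfolding LF_iff by (rule bexI[of _ z], rule exI[of _ 1]) auto

lemma LF_add [simp]: "z \<in> LF \<Longrightarrow> w \<in> LF \<Longrightarrow> z + w \<in> LF"
  unfolding LF_def by (auto simp flip: emb_add)
lemma LF_diff [simp]: "z \<in> LF \<Longrightarrow> w \<in> LF \<Longrightarrow> z - w \<in> LF"
  unfolding LF_def by (auto simp flip: emb_sub)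
lemma LF_uminus [simp]: "z \<in> LF \<Longrightarrow> - z \<in> LF"
  using LF_diff[of 0 z] by simp
lemma LF_mult [simp]: "z \<in> LF \<Longrightarrow> w \<in> LF \<Longrightarrow> z * w \<in> LF"
  unfolding LF_def by (auto simp flip: emb_mul)

definition sg :: "'a poly fract alg_closure \<Rightarrow> 'a poly fract alg_closure" where
  "sg z = to_ac (fst (iemb z)) + to_ac (snd (iemb z)) * yb"

lemma sg_emb: "sg (emb f) = to_ac (fst f) + to_ac (snd f) * yb"
  by (simp add: sg_def)

lemma sg_RR: "sg (pemb A + pemb B * yy) = pemb A + pemb B * yb"
  using sg_emb[of "(Fract A 1, Fract B 1)"] by (simp add: emb_def pemb_def)

lemma sg_pemb [simp]: "sg (pemb A) = pemb A" using sg_RR[of A 0] by simp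
lemma sg_0 [simp]: "sg 0 = 0" and sg_1 [simp]: "sg 1 = 1"
  using sg_pemb[of 0] sg_pemb[of 1] by (simp_all del: sg_pemb)

lemma sg_add: "z \<in> LF \<Longrightarrow> w \<in> LF \<Longrightarrow> sg (z + w) = sg z + sg w"
  unfolding LF_def by (auto simp: sg_emb fadd_def algebra_simps simp flip: emb_add)

lemma sg_mult: assumes "z \<in> LF" "w \<in> LF" shows "sg (z * w) = sg z * sg w"
proof -
  obtain f g where fg: "z = emb f" "w = emb g" using assms by (auto simp: LF_def)
  show ?thesis unfolding fg emb_mul[symmetric] sg_emb by (rule fmul_emb[OF yb_sq])
qed

lemma sg_LF [simp]: assumes "z \<in> LF" shows "sg z \<in> LF"
proof -
  obtain f where f: "z = emb f" using assms by (auto simp: LF_def)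
  have "to_ac r \<in> LF" for r
    using emb_LF[of "(r, 0)"] by (simp add: emb_def)
  thus ?thesis unfolding f sg_emb by simp
qed

lemma sg_RR_closed [simp]: "z \<in> RR \<Longrightarrow> sg z \<in> RR"
  by (auto elim!: RR_E simp: sg_RR)

lemma sg_yb [simp]: "sg yb = yy"
  unfolding yb_def using sg_RR[of "- hp" "- 1"] by (simp add: yb_def)

lemma sg_sg [simp]: assumes "z \<in> LF" shows "sg (sg z) = z"
proof -
  obtain f where f: "z = emb f" using assms by (auto simp: LF_def)
  have t: "to_ac r \<in> LF" "sg (to_ac r) = to_ac r" for r
    using emb_LF[of "(r, 0)"] sg_emb[of "(r, 0)"] by (simp_all add: emb_def)
  show ?thesis unfolding f sg_emb by (simp add: sg_add sg_mult t emb_def)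
qed

lemma sg_eq_0_iff [simp]: "z \<in> LF \<Longrightarrow> sg z = 0 \<longleftrightarrow> z = 0"
  by (metis sg_sg sg_0)

lemma norm_RR:
  "(pemb A + pemb B * yy) * sg (pemb A + pemb B * yy) = pemb (A * A - A * B * hp - B * B * gp)"
proof -
  have "(pemb A + pemb B * yy) * sg (pemb A + pemb B * yy) =
    pemb A * pemb A + pemb A * pemb B * (yy + yb) + pemb B * pemb B * (yy * yb)"
    unfolding sg_RR by (simp add: algebra_simps)
  thus ?thesis unfolding yy_plus_yb yy_times_yb by (simp add: algebra_simps)
qed

lemma RR_norm:
  assumes "g \<in> RR" "g \<noteq> 0" obtains N where "g * sg g = pemb N" "N \<noteq> 0"
proof -
  obtain A B where g: "g = pemb A + pemb B * yy" using assms RR_E by metis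
  have "A \<noteq> 0 \<or> B \<noteq> 0" using assms g by auto
  thus ?thesis using that norm_RR[of A B] norm_degree(1)[of A B] g by blast
qed

lemma LF_inverse [simp]: assumes "z \<in> LF" shows "inverse z \<in> LF"
proof (cases "z = 0")
  case False
  obtain g C where g: "g \<in> RR" "C \<noteq> 0" "z = g / pemb C" using assms by (rule LF_E)
  have g0: "g \<noteq> 0" using g False by auto
  obtain N where N: "g * sg g = pemb N" "N \<noteq> 0" using RR_norm[OF g(1) g0] .
  have "inverse z = (pemb C * sg g) / pemb N"
    unfolding g(3) N(1)[symmetric] using g0 g(1) by (simp add: field_simps)
  thus ?thesis unfolding LF_iff using g N by (metis RR_mult RR_pemb sg_RR_closed)
qed simp

lemma LF_divide [simp]: "z \<in> LF \<Longrightarrow> w \<in> LF \<Longrightarrow> z / w \<in> LF"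
  by (simp add: divide_inverse)
lemma LF_power [simp]: "z \<in> LF \<Longrightarrow> z ^ n \<in> LF"
  by (induction n) auto
lemma LF_powi [simp]: "z \<in> LF \<Longrightarrow> z powi n \<in> LF"
  by (simp add: power_int_def)

section \<open>Discrete valuations\<close>

definition is_val :: "('a poly fract alg_closure \<Rightarrow> int) \<Rightarrow> bool" where
  "is_val \<nu> \<longleftrightarrow> (\<forall>x\<in>LF. \<forall>y\<in>LF. x \<noteq> 0 \<longrightarrow> y \<noteq> 0 \<longrightarrow> \<nu> (x * y) = \<nu> x + \<nu> y) \<and>
     (\<forall>x\<in>LF. \<forall>y\<in>LF. x \<noteq> 0 \<longrightarrow> y \<noteq> 0 \<longrightarrow> x + y \<noteq> 0 \<longrightarrow> \<nu> (x + y) \<ge> min (\<nu> x) (\<nu> y)) \<and>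
     (\<forall>a. a \<noteq> 0 \<longrightarrow> \<nu> (pemb [:a:]) = 0) \<and> (\<exists>t\<in>LF. t \<noteq> 0 \<and> \<nu> t = 1)"

definition val :: "('a ff \<Rightarrow> int) \<Rightarrow> 'a poly fract alg_closure \<Rightarrow> int" where
  "val v z = v (iemb z)"

lemma val_emb [simp]: "val v (emb f) = v f" by (simp add: val_def)

lemma is_place_iff: "is_place cc v \<longleftrightarrow> v fzero = 0 \<and> is_val (val v)"
proof -
  have q: "(\<forall>x\<in>LF. Pr x) \<longleftrightarrow> (\<forall>f. Pr (emb f))" "(\<exists>x\<in>LF. Pr x) \<longleftrightarrow> (\<exists>f. Pr (emb f))" for Pr
    by (auto simp: LF_def)
  show ?thesis unfolding is_place_def is_val_def q
    by (simp flip: emb_mul emb_add emb_const)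
qed

lemma place_eqI:
  assumes "is_place cc v" "is_place cc w" "\<And>z. z \<in> LF \<Longrightarrow> z \<noteq> 0 \<Longrightarrow> val v z = val w z"
  shows "v = w"
proof
  fix f show "v f = w f"
    using assms(3)[of "emb f"] assms(1,2) by (cases "f = fzero") (auto simp: is_place_iff)
qed

lemma place_of_is_val:
  assumes "is_val \<nu>"
  obtains v where "is_place cc v" "\<And>z. z \<in> LF \<Longrightarrow> z \<noteq> 0 \<Longrightarrow> val v z = \<nu> z"
proof -
  define v where "v = (\<lambda>f. if f = fzero then 0 else \<nu> (emb f))"
  have e: "val v z = \<nu> z" if "z \<in> LF" "z \<noteq> 0" for z
    using that by (auto simp: LF_def v_def)
  have "is_val (val v)"
    using assms unfolding is_val_def by (auto simp: e)
  thus ?thesis using that[of v] e by (auto simp: is_place_iff v_def)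
qed

text \<open>The number that a valuation assigns to zero carries no information; \<open>ge\<close>
  treats it as infinite, so that the ultrametric laws hold without exceptions for vanishing
  terms.\<close>

definition ge :: "('a poly fract alg_closure \<Rightarrow> int) \<Rightarrow> int \<Rightarrow> 'a poly fract alg_closure \<Rightarrow> bool" where
  "ge \<nu> n x \<longleftrightarrow> x = 0 \<or> \<nu> x \<ge> n"

context
  fixes \<nu> assumes \<nu>: "is_val \<nu>"
begin

lemma v_mult: "x \<in> LF \<Longrightarrow> y \<in> LF \<Longrightarrow> x \<noteq> 0 \<Longrightarrow> y \<noteq> 0 \<Longrightarrow> \<nu> (x * y) = \<nu> x + \<nu> y"
  using \<nu> unfolding is_val_def by blast

lemma v_const: "a \<noteq> 0 \<Longrightarrow> \<nu> (pemb [:a:]) = 0"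
  using \<nu> unfolding is_val_def by blast

lemma v_1 [simp]: "\<nu> 1 = 0"
  using v_const[of 1] by (simp flip: one_pCons)

lemma v_uminus: "x \<in> LF \<Longrightarrow> \<nu> (- x) = \<nu> x"
proof (cases "x = 0")
  case False assume "x \<in> LF"
  have "[:-1:] = - (1 :: 'a poly)" by (simp add: one_pCons)
  hence "- x = pemb [:-1:] * x" by simp
  moreover have "\<nu> (pemb [:-1:]) = 0" by (rule v_const) simp
  ultimately show ?thesis using v_mult[of "pemb [:-1:]" x] False \<open>x \<in> LF\<close> by simp
qed simp

lemma v_power: "x \<in> LF \<Longrightarrow> x \<noteq> 0 \<Longrightarrow> \<nu> (x ^ n) = int n * \<nu> x"
  by (induction n) (simp_all add: v_mult algebra_simps)

lemma v_inverse: "x \<in> LF \<Longrightarrow> x \<noteq> 0 \<Longrightarrow> \<nu> (inverse x) = - \<nu> x"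
  using v_mult[of x "inverse x"] by simp

lemma v_divide: "x \<in> LF \<Longrightarrow> y \<in> LF \<Longrightarrow> x \<noteq> 0 \<Longrightarrow> y \<noteq> 0 \<Longrightarrow> \<nu> (x / y) = \<nu> x - \<nu> y"
  using v_mult[of x "inverse y"] v_inverse[of y] by (simp add: divide_inverse)

lemma v_powi: "x \<in> LF \<Longrightarrow> x \<noteq> 0 \<Longrightarrow> \<nu> (x powi n) = n * \<nu> x"
  by (simp add: power_int_def v_power v_inverse)

lemma ge_0 [simp]: "ge \<nu> n 0" by (simp add: ge_def)

lemma ge_add: "x \<in> LF \<Longrightarrow> y \<in> LF \<Longrightarrow> ge \<nu> n x \<Longrightarrow> ge \<nu> n y \<Longrightarrow> ge \<nu> n (x + y)"
  using \<nu> unfolding is_val_def ge_def by (smt (verit) add.left_neutral add.right_neutral)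

lemma ge_uminus: "x \<in> LF \<Longrightarrow> ge \<nu> n x \<Longrightarrow> ge \<nu> n (- x)"
  unfolding ge_def using v_uminus by auto

lemma ge_diff: "x \<in> LF \<Longrightarrow> y \<in> LF \<Longrightarrow> ge \<nu> n x \<Longrightarrow> ge \<nu> n y \<Longrightarrow> ge \<nu> n (x - y)"
  using ge_add[of x "- y"] ge_uminus[of y] by simp

lemma ge_mult: "x \<in> LF \<Longrightarrow> y \<in> LF \<Longrightarrow> ge \<nu> n x \<Longrightarrow> ge \<nu> m y \<Longrightarrow> ge \<nu> (n + m) (x * y)"
  unfolding ge_def using v_mult by fastforce

lemma ge_mono: "ge \<nu> n x \<Longrightarrow> m \<le> n \<Longrightarrow> ge \<nu> m x"
  unfolding ge_def by auto

lemma ge_const [simp]: "ge \<nu> 0 (pemb [:a:])"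
  using v_const[of a] unfolding ge_def by (cases "a = 0") auto

lemma v_add_eq:
  assumes "x \<in> LF" "y \<in> LF" "y \<noteq> 0" "ge \<nu> (\<nu> y + 1) x"
  shows "x + y \<noteq> 0" "\<nu> (x + y) = \<nu> y"
proof -
  show nz: "x + y \<noteq> 0"
  proof
    assume "x + y = 0"
    hence "x = - y" by (simp add: eq_neg_iff_add_eq_0)
    thus False using assms v_uminus[of y] by (simp add: ge_def)
  qed
  have "ge \<nu> (\<nu> y) (x + y)" by (rule ge_add) (use assms in \<open>auto simp: ge_def\<close>)
  moreover have "\<not> ge \<nu> (\<nu> y + 1) (x + y)"
  proof
    assume "ge \<nu> (\<nu> y + 1) (x + y)"
    hence "ge \<nu> (\<nu> y + 1) (x + y - x)" by (intro ge_diff) (use assms in auto)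
    thus False using assms by (simp add: ge_def)
  qed
  ultimately show "\<nu> (x + y) = \<nu> y" using nz by (simp add: ge_def)
qed

end

section \<open>Prime ideals of the coordinate ring\<close>

text \<open>Expresses that the localisation of \<open>RR\<close> at the prime ideal Q is a discrete
  valuation ring with uniformiser t. Denominators are cleared, so that the localisation itself need
  not be built.\<close>

definition local_param :: "'a poly fract alg_closure set \<Rightarrow> 'a poly fract alg_closure \<Rightarrow> bool" where
  "local_param Q t \<longleftrightarrow> Q \<subseteq> RR \<and> 1 \<notin> Q \<and> (\<forall>x\<in>Q. \<forall>y\<in>Q. x + y \<in> Q) \<and>
     (\<forall>x\<in>Q. \<forall>y\<in>RR. x * y \<in> Q) \<and> (\<forall>x\<in>RR. \<forall>y\<in>RR. x * y \<in> Q \<longrightarrow> x \<in> Q \<or> y \<in> Q) \<and>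
     t \<in> Q \<and> t \<noteq> 0 \<and>
     (\<forall>g\<in>RR. g \<noteq> 0 \<longrightarrow> (\<exists>m. \<exists>u\<in>RR - Q. \<exists>w\<in>RR - Q. u * g = t ^ m * w))"

text \<open>If the localization at Q has principal maximal ideal (t), then every element is t^m times a
  unit: dividing by t must stop because it divides the norm, a polynomial.\<close>

lemma local_paramI:
  assumes Q: "Q \<subseteq> RR" "1 \<notin> Q" "\<And>x y. x \<in> Q \<Longrightarrow> y \<in> Q \<Longrightarrow> x + y \<in> Q"
    "\<And>x y. x \<in> Q \<Longrightarrow> y \<in> RR \<Longrightarrow> x * y \<in> Q"
    "\<And>x y. x \<in> RR \<Longrightarrow> y \<in> RR \<Longrightarrow> x * y \<in> Q \<Longrightarrow> x \<in> Q \<or> y \<in> Q"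
    and t: "t \<in> Q" "t \<noteq> 0"
    and dv: "\<And>g. g \<in> Q \<Longrightarrow> \<exists>u\<in>RR - Q. \<exists>w\<in>RR. u * g = t * w"
    and pl: "\<And>N. N \<noteq> 0 \<Longrightarrow> \<exists>e. \<exists>u\<in>RR - Q. \<exists>w\<in>RR - Q. u * pemb N = t ^ e * w"
  shows "local_param Q t"
proof -
  have mm: "x * y \<in> RR - Q" if "x \<in> RR - Q" "y \<in> RR - Q" for x y using that Q(5) by auto
  have "\<exists>m. \<exists>u\<in>RR - Q. \<exists>w\<in>RR - Q. u * g = t ^ m * w" if g: "g \<in> RR" "g \<noteq> 0" for g
  proof -
    obtain N where N: "g * sg g = pemb N" "N \<noteq> 0" using RR_norm[OF g] .
    obtain e u0 w0 where e: "u0 \<in> RR - Q" "w0 \<in> RR - Q" "u0 * pemb N = t ^ e * w0" using pl[OF N(2)] by blast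
    define P where "P m \<longleftrightarrow> (\<exists>u\<in>RR - Q. \<exists>w\<in>RR. u * g = t ^ m * w)" for m
    have bound: "m \<le> e" if Pm: "P m" for m
    proof (rule ccontr)
      assume "\<not> m \<le> e"
      then obtain k where k: "m = e + Suc k" by (metis less_iff_Suc_add linorder_not_le add_Suc_right)
      obtain u w where uw: "u \<in> RR - Q" "w \<in> RR" "u * g = t ^ m * w" using Pm P_def by blast
      have "t ^ e * (u * w0) = u * (u0 * pemb N)" unfolding e(3) by (simp add: mult_ac)
      also have "\<dots> = u0 * (u * g) * sg g" unfolding N(1)[symmetric] by (simp add: mult_ac)
      also have "\<dots> = t ^ e * (t * (t ^ k * u0 * w * sg g))" unfolding uw(3) k by (simp add: power_add mult_ac)
      finally have "u * w0 = t * (t ^ k * u0 * w * sg g)" using t(2) by simp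
      moreover have "t * (t ^ k * u0 * w * sg g) \<in> Q"
        by (rule Q(4)[OF t(1)]) (use t Q(1) e uw g in auto)
      ultimately show False using mm[OF uw(1) e(2)] by simp
    qed
    have "P 0" unfolding P_def using Q(2) g by (intro bexI[of _ 1] bexI[of _ g]) auto
    define m where "m = (GREATEST m. P m)"
    have Pm: "P m" unfolding m_def by (rule GreatestI_nat[of P 0 e]) (use bound \<open>P 0\<close> in auto)
    have mx: "k \<le> m" if "P k" for k unfolding m_def by (rule Greatest_le_nat[of P k e]) (use bound that in auto)
    obtain u w where uw: "u \<in> RR - Q" "w \<in> RR" "u * g = t ^ m * w" using Pm P_def by blast
    have "w \<notin> Q"
    proof
      assume "w \<in> Q"
      then obtain u' w' where *: "u' \<in> RR - Q" "w' \<in> RR" "u' * w = t * w'" using dv by blast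
      have "u' * u * g = t ^ m * (u' * w)" using uw(3) by (simp add: mult_ac)
      also have "\<dots> = t ^ Suc m * w'" unfolding *(3) by (simp add: mult_ac)
      finally have "P (Suc m)" unfolding P_def using mm[OF *(1) uw(1)] *(2) by blast
      thus False using mx by fastforce
    qed
    thus ?thesis using uw by blast
  qed
  thus ?thesis unfolding local_param_def using Q t by (intro conjI ballI impI) auto
qed

definition local_val :: "'a poly fract alg_closure set \<Rightarrow> 'a poly fract alg_closure \<Rightarrow> 'a poly fract alg_closure \<Rightarrow> int" where
  "local_val Q t z = (THE m. \<exists>a\<in>RR - Q. \<exists>b\<in>RR - Q. a * z = t powi m * b)"

context
  fixes Q t assumes L: "local_param Q t"
begin

lemma Q_RR: "x \<in> Q \<Longrightarrow> x \<in> RR" and Q_1: "1 \<notin> Q" and Q_add: "x \<in> Q \<Longrightarrow> y \<in> Q \<Longrightarrow> x + y \<in> Q"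
  and Q_mult: "x \<in> Q \<Longrightarrow> y \<in> RR \<Longrightarrow> x * y \<in> Q"
  and Q_prime: "x \<in> RR \<Longrightarrow> y \<in> RR \<Longrightarrow> x * y \<in> Q \<Longrightarrow> x \<in> Q \<or> y \<in> Q"
  and t_Q: "t \<in> Q" and t_nz: "t \<noteq> 0"
  and Q_rep: "g \<in> RR \<Longrightarrow> g \<noteq> 0 \<Longrightarrow> \<exists>m. \<exists>u\<in>RR - Q. \<exists>w\<in>RR - Q. u * g = t ^ m * w"
  using L unfolding local_param_def by blast+

lemma t_RR: "t \<in> RR" using t_Q Q_RR by blast

lemma Q_0: "0 \<in> Q" using Q_mult[OF t_Q, of 0] by simp

lemma U_mult: "x \<in> RR - Q \<Longrightarrow> y \<in> RR - Q \<Longrightarrow> x * y \<in> RR - Q"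
  using Q_prime by auto

lemma U_nz: "x \<in> RR - Q \<Longrightarrow> x \<noteq> 0" using Q_0 by auto

lemma local_val_ex:
  assumes "z \<in> LF" "z \<noteq> 0"
  obtains m :: int and a b where "a \<in> RR - Q" "b \<in> RR - Q" "a * z = t powi m * b"
proof -
  obtain g C where g: "g \<in> RR" "C \<noteq> 0" "z = g / pemb C" using assms(1) by (rule LF_E)
  have "g \<noteq> 0" using assms g by auto
  then obtain m u w where 1: "u \<in> RR - Q" "w \<in> RR - Q" "u * g = t ^ m * w" using Q_rep g(1) by blast
  obtain n u' w' where 2: "u' \<in> RR - Q" "w' \<in> RR - Q" "u' * pemb C = t ^ n * w'" using Q_rep[of "pemb C"] g(2) by auto
  have nz: "u \<noteq> 0" "w \<noteq> 0" "u' \<noteq> 0" "w' \<noteq> 0" using 1 2 U_nz by blast+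
  have C0: "pemb C \<noteq> 0" using g(2) by simp
  have "t ^ n * ((u * w') * z) = u * (t ^ n * w') * g / pemb C" unfolding g(3) by (simp add: mult_ac)
  also have "\<dots> = u' * (u * g)" unfolding 2(3)[symmetric] using C0 by simp
  also have "\<dots> = t ^ m * (w * u')" unfolding 1(3) by (simp add: mult_ac)
  finally have "(u * w') * z = t ^ m / t ^ n * (w * u')" using t_nz by (simp add: field_simps)
  also have "t ^ m / t ^ n = t powi (int m - int n)" using t_nz by (simp add: power_int_diff)
  finally show ?thesis by (rule that[OF U_mult[OF 1(1) 2(2)] U_mult[OF 1(2) 2(1)]])
qed

lemma local_val_unique_le:
  assumes "a \<in> RR - Q" "b \<in> RR - Q" "a * z = t powi m * b"
    and "a' \<in> RR - Q" "b' \<in> RR - Q" "a' * z = t powi m' * b'"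
  shows "m' \<le> m"
proof (rule ccontr)
  assume "\<not> m' \<le> m"
  then obtain k where k: "m' = m + int (Suc k)" by (metis less_int_code(1) linorder_not_le zless_iff_Suc_zadd)
  have "t powi m * (a' * b) = a * (a' * z)" using assms(3) by (simp add: mult_ac)
  also have "\<dots> = t powi m * (t * (t ^ k * a * b'))" unfolding assms(6) k using t_nz
    by (simp add: power_int_add power_int_of_nat mult_ac del: of_nat_Suc)
  finally have "a' * b = t * (t ^ k * a * b')" using t_nz by (simp add: power_int_eq_0_iff)
  moreover have "t * (t ^ k * a * b') \<in> Q" by (rule Q_mult[OF t_Q]) (use assms t_RR in auto)
  ultimately show False using U_mult[OF assms(4,2)] by simp
qed

lemma local_val_eqI:
  assumes "a \<in> RR - Q" "b \<in> RR - Q" "a * z = t powi m * b" shows "local_val Q t z = m"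
  unfolding local_val_def
proof (rule the_equality)
  show "\<exists>a\<in>RR - Q. \<exists>b\<in>RR - Q. a * z = t powi m * b" using assms by blast
next
  fix m' assume "\<exists>a\<in>RR - Q. \<exists>b\<in>RR - Q. a * z = t powi m' * b"
  then obtain a' b' where "a' \<in> RR - Q" "b' \<in> RR - Q" "a' * z = t powi m' * b'" by blast
  thus "m' = m" using local_val_unique_le[OF assms] local_val_unique_le[OF _ _ _ assms] by (metis order_antisym)
qed

lemma local_val_rep:
  assumes "z \<in> LF" "z \<noteq> 0"
  obtains a b where "a \<in> RR - Q" "b \<in> RR - Q" "a * z = t powi (local_val Q t z) * b"
  using local_val_ex[OF assms] local_val_eqI by metis

lemma local_val_unit: "u \<in> RR - Q \<Longrightarrow> local_val Q t u = 0"
  by (rule local_val_eqI[of 1 u]) (use Q_1 in auto)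

lemma local_val_t: "local_val Q t t = 1"
  by (rule local_val_eqI[of 1 1]) (use Q_1 in auto)

lemma local_val_RR: assumes "g \<in> RR" "g \<noteq> 0" shows "local_val Q t g \<ge> 0" "local_val Q t g \<ge> 1 \<longleftrightarrow> g \<in> Q"
proof -
  obtain m u w where 1: "u \<in> RR - Q" "w \<in> RR - Q" "u * g = t ^ m * w" using Q_rep assms by blast
  have V: "local_val Q t g = int m" by (rule local_val_eqI[OF 1(1,2)]) (simp add: 1 power_int_of_nat)
  thus "local_val Q t g \<ge> 0" by simp
  show "local_val Q t g \<ge> 1 \<longleftrightarrow> g \<in> Q"
  proof
    assume "local_val Q t g \<ge> 1" thus "g \<in> Q" using local_val_unit[of g] assms by auto
  next
    assume "g \<in> Q"
    have "m \<noteq> 0"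
    proof
      assume "m = 0"
      hence "w = g * u" using 1 by (simp add: mult_ac)
      thus False using Q_mult[OF \<open>g \<in> Q\<close>, of u] 1 by auto
    qed
    thus "local_val Q t g \<ge> 1" using V by simp
  qed
qed

lemma local_val_is_val: "is_val (local_val Q t)"
  unfolding is_val_def
proof (intro conjI ballI allI impI)
  fix x y assume xy: "x \<in> LF" "y \<in> LF" "x \<noteq> 0" "y \<noteq> 0"
  obtain a b where 1: "a \<in> RR - Q" "b \<in> RR - Q" "a * x = t powi (local_val Q t x) * b" using local_val_rep xy by metis
  obtain a' b' where 2: "a' \<in> RR - Q" "b' \<in> RR - Q" "a' * y = t powi (local_val Q t y) * b'" using local_val_rep xy by metis
  show "local_val Q t (x * y) = local_val Q t x + local_val Q t y"
  proof (rule local_val_eqI[OF U_mult[OF 1(1) 2(1)] U_mult[OF 1(2) 2(2)]])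
    have "a * a' * (x * y) = (a * x) * (a' * y)" by (simp add: mult_ac)
    thus "a * a' * (x * y) = t powi (local_val Q t x + local_val Q t y) * (b * b')"
      unfolding 1 2 using t_nz by (simp add: power_int_add mult_ac)
  qed
next
  have main: "local_val Q t x \<le> local_val Q t (x + y)" if xy: "x \<in> LF" "y \<in> LF" "x \<noteq> 0" "y \<noteq> 0" "x + y \<noteq> 0"
    "local_val Q t x \<le> local_val Q t y" for x y
  proof -
    obtain a b where 1: "a \<in> RR - Q" "b \<in> RR - Q" "a * x = t powi (local_val Q t x) * b" using local_val_rep xy by metis
    obtain a' b' where 2: "a' \<in> RR - Q" "b' \<in> RR - Q" "a' * y = t powi (local_val Q t y) * b'" using local_val_rep xy by metis
    obtain k where k: "local_val Q t y = local_val Q t x + int k" using xy(6) zle_iff_zadd by blast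
    define w where "w = b * a' + a * t ^ k * b'"
    have w: "w \<in> RR" unfolding w_def using 1 2 t_RR by auto
    have "a * a' * (x + y) = (a * x) * a' + a * (a' * y)" by (simp add: algebra_simps)
    also have "\<dots> = t powi (local_val Q t x) * w"
      unfolding 1(3) 2(3) k w_def using t_nz by (simp add: power_int_add power_int_of_nat algebra_simps)
    finally have e: "a * a' * (x + y) = t powi (local_val Q t x) * w" .
    have w0: "w \<noteq> 0" using e U_mult[OF 1(1) 2(1)] U_nz xy(5) by (metis mult_eq_0_iff)
    obtain m u w' where 3: "u \<in> RR - Q" "w' \<in> RR - Q" "u * w = t ^ m * w'" using Q_rep[OF w w0] by blast
    have "local_val Q t (x + y) = local_val Q t x + int m"
    proof (rule local_val_eqI[OF U_mult[OF 3(1) U_mult[OF 1(1) 2(1)]] 3(2)])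
      have "u * (a * a') * (x + y) = u * (a * a' * (x + y))" by (simp add: mult_ac)
      also have "\<dots> = t powi (local_val Q t x) * (u * w)" unfolding e by (simp add: mult_ac)
      finally show "u * (a * a') * (x + y) = t powi (local_val Q t x + int m) * w'"
        unfolding 3 using t_nz by (simp add: power_int_add power_int_of_nat mult_ac)
    qed
    thus ?thesis by simp
  qed
  fix x y assume xy: "x \<in> LF" "y \<in> LF" "x \<noteq> 0" "y \<noteq> 0" "x + y \<noteq> 0"
  show "min (local_val Q t x) (local_val Q t y) \<le> local_val Q t (x + y)"
    using main[of x y] main[of y x] xy by (simp add: add.commute min_def)
next
  fix a :: 'a assume a: "a \<noteq> 0"
  have "pemb [:a:] \<notin> Q"
  proof
    assume "pemb [:a:] \<in> Q"
    hence "pemb [:a:] * pemb [:inverse a:] \<in> Q" by (rule Q_mult) simp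
    moreover have "pemb [:a:] * pemb [:inverse a:] = 1" using a by (simp flip: pemb_hom one_pCons)
    ultimately show False using Q_1 by simp
  qed
  thus "local_val Q t (pemb [:a:]) = 0" by (intro local_val_unit) auto
next
  show "\<exists>s\<in>LF. s \<noteq> 0 \<and> local_val Q t s = 1" using local_val_t t_RR t_nz by (intro bexI[of _ t]) auto
qed

text \<open>Elements of \<open>RR\<close> outside Q have value 0 under \<nu>, so \<nu> is
  \<open>local_val Q t\<close> multiplied by \<open>\<nu> t\<close>; an element of value 1 forces
  this positive factor to be 1.\<close>

lemma local_val_unique:
  assumes \<nu>: "is_val \<nu>" and c: "\<And>g. g \<in> RR \<Longrightarrow> ge \<nu> 0 g" "\<And>g. g \<in> RR \<Longrightarrow> ge \<nu> 1 g \<longleftrightarrow> g \<in> Q"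
    and z: "z \<in> LF" "z \<noteq> 0"
  shows "\<nu> z = local_val Q t z"
proof -
  have u: "\<nu> u = 0" if "u \<in> RR - Q" for u
    using c(1)[of u] c(2)[of u] that U_nz[OF that] by (auto simp: ge_def)
  have vt: "\<nu> z = local_val Q t z * \<nu> t" if z: "z \<in> LF" "z \<noteq> 0" for z
  proof -
    obtain a b where 1: "a \<in> RR - Q" "b \<in> RR - Q" "a * z = t powi (local_val Q t z) * b" using local_val_rep z by metis
    have "\<nu> (a * z) = \<nu> z" using v_mult[OF \<nu>, of a z] 1 z U_nz[OF 1(1)] u[OF 1(1)] by simp
    moreover have "\<nu> (t powi (local_val Q t z) * b) = local_val Q t z * \<nu> t"
      using v_mult[OF \<nu>, of "t powi (local_val Q t z)" b] 1 t_RR t_nz U_nz[OF 1(2)] u[OF 1(2)] v_powi[OF \<nu>, of t]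
      by (simp add: power_int_eq_0_iff)
    ultimately show ?thesis using 1(3) by simp
  qed
  obtain s where s: "s \<in> LF" "s \<noteq> 0" "\<nu> s = 1" using \<nu> unfolding is_val_def by blast
  have "1 = local_val Q t s * \<nu> t" using vt[OF s(1,2)] s(3) by simp
  moreover have "\<nu> t \<ge> 1" using c(2)[OF t_RR] t_Q t_nz by (simp add: ge_def)
  ultimately have "\<nu> t = 1" by (metis zmult_eq_1_iff linorder_not_less one_neq_neg_one not_one_le_zero order_trans neg_0_le_iff_le zero_le_one less_le)
  thus ?thesis using vt[OF z] by simp
qed

end

end

text \<open>C2, C3, C4, C6 are the coefficients of the curve after the substitution X -> X + t, Y ->
  Y + r, which preserves the discriminant. It is stated over a ring because t and r will be
  polynomials.\<close>

lemma discriminant_translate: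
  fixes A1 A2 A3 A4 A6 t r :: "'b::comm_ring_1"
  defines "B2 \<equiv> A1^2 + 4*A2" and "B4 \<equiv> 2*A4 + A1*A3" and "B6 \<equiv> A3^2 + 4*A6"
    and "B8 \<equiv> A1^2*A6 + 4*A2*A6 - A1*A3*A4 + A2*A3^2 - A4^2"
  defines "C2 \<equiv> A2 + 3*t" and "C3 \<equiv> A3 + A1*t + 2*r" and "C4 \<equiv> A4 + 2*A2*t + 3*t^2 - A1*r"
    and "C6 \<equiv> A6 + A4*t + A2*t^2 + t^3 - r^2 - A1*t*r - A3*r"
  defines "D2 \<equiv> A1^2 + 4*C2" and "D4 \<equiv> 2*C4 + A1*C3" and "D6 \<equiv> C3^2 + 4*C6"
    and "D8 \<equiv> A1^2*C6 + 4*C2*C6 - A1*C3*C4 + C2*C3^2 - C4^2"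
  shows "- (B2^2*B8) - 8*B4^3 - 27*B6^2 + 9*B2*B4*B6 = - (D2^2*D8) - 8*D4^3 - 27*D6^2 + 9*D2*D4*D6"
proof -
  have 2: "D2 = B2 + 12*t" unfolding D2_def B2_def C2_def by (simp add: algebra_simps)
  have 4: "D4 = B4 + t*B2 + 6*t^2" unfolding D4_def B4_def B2_def C4_def C3_def
    by (simp add: algebra_simps power2_eq_square)
  have 6: "D6 = B6 + 2*t*B4 + t^2*B2 + 4*t^3" unfolding D6_def B6_def B4_def B2_def C6_def C3_def
    by (simp add: algebra_simps power2_eq_square power3_eq_cube)
  have 8: "D8 = B8 + 3*t*B6 + 3*t^2*B4 + t^3*B2 + 3*t^4"
    unfolding D8_def B8_def B6_def B4_def B2_def C2_def C3_def C4_def C6_def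
    by (simp add: algebra_simps eval_nat_numeral)
  \<comment> \<open>As polynomials in t and the four B's the two discriminants differ; they agree
    only modulo this relation, which cannot be used to eliminate B8 in characteristic 2.\<close>
  have rel: "4 * B8 = B2 * B6 - B4^2" unfolding B8_def B6_def B4_def B2_def
    by (simp add: algebra_simps power2_eq_square)
  have "- (D2^2*D8) - 8*D4^3 - 27*D6^2 + 9*D2*D4*D6 =
    - (B2^2*B8) - 8*B4^3 - 27*B6^2 + 9*B2*B4*B6 - (4*B8 - (B2*B6 - B4^2)) * (6*t*B2 + 36*t^2)"
    unfolding 2 4 6 8 by (simp add: algebra_simps eval_nat_numeral)
  thus ?thesis unfolding rel by simp
qed

section \<open>Inert, split and ramified primes of K[x]\<close>

context weierstrass
begin

text \<open>\<open>root_norm r\<close> is the Weierstrass equation at y = r and also the norm of y -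
  r; it is divisible by p iff r is a root modulo p. In that case \<open>root_ideal p r\<close>,
  generated by p and y - r, is the kernel of the map y -> r onto K[x]/p. The ideal
  \<open>inert_ideal p\<close> is the one generated by p alone.\<close>

definition root_norm :: "'a poly \<Rightarrow> 'a poly" where "root_norm r = r * r + r * hp - gp"
definition inert_ideal :: "'a poly \<Rightarrow> 'a poly fract alg_closure set" where
  "inert_ideal p = {z. \<exists>A B. z = pemb A + pemb B * yy \<and> p dvd A \<and> p dvd B}"
definition root_ideal :: "'a poly \<Rightarrow> 'a poly \<Rightarrow> 'a poly fract alg_closure set" where
  "root_ideal p r = {z. \<exists>A B. z = pemb A + pemb B * yy \<and> p dvd A + B * r}"

text \<open>A point on the curve modulo p where the partial derivative in y vanishes is a simple zero of
  the equation, since otherwise the curve would be singular there.\<close>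

lemma norm_root_simple:
  assumes p: "irreducible p" and h: "p dvd 2 * r + hp"
  shows "\<not> p * p dvd root_norm r"
proof
  assume sq: "p * p dvd root_norm r"
  then obtain k where k: "root_norm r = p * p * k" by auto
  have "pderiv (root_norm r) = p * (2 * pderiv p * k + p * pderiv k)"
    unfolding k by (simp add: pderiv_mult algebra_simps)
  hence "p dvd pderiv (root_norm r)" by simp
  \<comment> \<open>Chain rule for F(x, r(x)) with F = y^2 + h y - g: the partial derivative in y is
    divisible by p by assumption, hence so is the one in x.\<close>
  moreover have "pderiv (root_norm r) = pderiv r * (2 * r + hp) - (pderiv gp - pderiv hp * r)"
    unfolding root_norm_def by (simp add: pderiv_mult pderiv_add pderiv_diff algebra_simps)
  ultimately have a: "p dvd pderiv r * (2 * r + hp) - (pderiv gp - pderiv hp * r)" by simp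
  have b: "p dvd pderiv r * (2 * r + hp)" using h by (rule dvd_mult)
  have d4: "p dvd pderiv gp - pderiv hp * r" using dvd_diff[OF b a] by simp
  \<comment> \<open>Taking t = x moves the point (x, r) to the origin. Then C3, - C4 and - C6 are
    the two partial derivatives and the value of F there. All are divisible by p, hence so is the
    discriminant, a nonzero constant.\<close>
  define t where "t = [:0, 1 :: 'a:]"
  define C2 where "C2 = [:a2:] + 3 * t"
  define C3 where "C3 = [:a3:] + [:a1:] * t + 2 * r"
  define C4 where "C4 = [:a4:] + 2 * [:a2:] * t + 3 * t^2 - [:a1:] * r"
  define C6 where "C6 = [:a6:] + [:a4:] * t + [:a2:] * t^2 + t^3 - r^2 - [:a1:] * t * r - [:a3:] * r"
  have "C3 = 2 * r + hp" unfolding C3_def hp_def t_def by simp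
  hence c3: "p dvd C3" using h by simp
  have "C4 = pderiv gp - pderiv hp * r" unfolding C4_def gp_def hp_def t_def
    by (simp add: pderiv_pCons numeral_poly power2_eq_square)
  hence c4: "p dvd C4" using d4 by simp
  have "C6 = - root_norm r" unfolding C6_def root_norm_def gp_def hp_def t_def
    by (simp add: power2_eq_square power3_eq_cube algebra_simps)
  hence c6: "p dvd C6" using sq by (metis dvd_minus_iff dvd_mult_left)
  define D2 where "D2 = [:a1:]^2 + 4*C2"
  define D4 where "D4 = 2*C4 + [:a1:]*C3"
  define D6 where "D6 = C3^2 + 4*C6"
  define D8 where "D8 = [:a1:]^2*C6 + 4*C2*C6 - [:a1:]*C3*C4 + C2*C3^2 - C4^2"
  have d4: "p dvd D4" unfolding D4_def by (intro dvd_add dvd_mult c3 c4)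
  have d6: "p dvd D6" unfolding D6_def power2_eq_square by (intro dvd_add dvd_mult c3 c6)
  have d8: "p dvd D8" unfolding D8_def power2_eq_square by (intro dvd_add dvd_diff dvd_mult c3 c4 c6)
  have "p dvd - (D2^2*D8) - 8*D4^3 - 27*D6^2 + 9*D2*D4*D6"
    unfolding power3_eq_cube power2_eq_square dvd_minus_iff
    by (intro dvd_add dvd_diff dvd_mult d4 d6 d8 iffD2[OF dvd_minus_iff])
  also have "- (D2^2*D8) - 8*D4^3 - 27*D6^2 + 9*D2*D4*D6 =
     - (([:a1:]^2 + 4*[:a2:])^2*([:a1:]^2*[:a6:] + 4*[:a2:]*[:a6:] - [:a1:]*[:a3:]*[:a4:] + [:a2:]*[:a3:]^2 - [:a4:]^2))
     - 8*(2*[:a4:] + [:a1:]*[:a3:])^3 - 27*([:a3:]^2 + 4*[:a6:])^2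
     + 9*([:a1:]^2 + 4*[:a2:])*(2*[:a4:] + [:a1:]*[:a3:])*([:a3:]^2 + 4*[:a6:])"
    unfolding D2_def D4_def D6_def D8_def C2_def C3_def C4_def C6_def
    by (rule discriminant_translate[symmetric])
  also have "\<dots> = [:- (b2\<^sup>2 * b8) - 8 * b4 ^ 3 - 27 * b6\<^sup>2 + 9 * b2 * b4 * b6:]"
    unfolding b2_def b4_def b6_def b8_def by (simp add: numeral_poly power2_eq_square power3_eq_cube mult_ac)
  finally have "p dvd [:- (b2\<^sup>2 * b8) - 8 * b4 ^ 3 - 27 * b6\<^sup>2 + 9 * b2 * b4 * b6:]" .
  moreover have "[:- (b2\<^sup>2 * b8) - 8 * b4 ^ 3 - 27 * b6\<^sup>2 + 9 * b2 * b4 * b6:] dvd 1"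
    using disc_b by (simp add: is_unit_iff_degree)
  ultimately have "p dvd 1" by (rule dvd_trans)
  thus False using p by (simp add: irreducible_def)
qed

lemma inert_ideal_iff: "pemb A + pemb B * yy \<in> inert_ideal p \<longleftrightarrow> p dvd A \<and> p dvd B"
  unfolding inert_ideal_def by (auto simp: independent_eq)
lemma root_ideal_iff: "pemb A + pemb B * yy \<in> root_ideal p r \<longleftrightarrow> p dvd A + B * r"
  unfolding root_ideal_def by (auto simp: independent_eq)
lemma inert_ideal_pemb: "pemb A \<in> inert_ideal p \<longleftrightarrow> p dvd A" using inert_ideal_iff[of A 0 p] by simp
lemma root_ideal_pemb: "pemb A \<in> root_ideal p r \<longleftrightarrow> p dvd A" using root_ideal_iff[of A 0 p r] by simp

lemma RR_product:
  "(pemb A + pemb B * yy) * (pemb C + pemb D * yy) =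
    pemb (A * C + B * D * gp) + pemb (A * D + B * C - B * D * hp) * yy"
proof -
  have "(pemb A + pemb B * yy) * (pemb C + pemb D * yy) =
    pemb A * pemb C + (pemb A * pemb D + pemb B * pemb C) * yy + pemb B * pemb D * (yy * yy)"
    by (simp add: algebra_simps)
  thus ?thesis unfolding yy_sq by (simp add: algebra_simps)
qed

lemma RR_sum: "(pemb A + pemb B * yy) + (pemb C + pemb D * yy) = pemb (A + C) + pemb (B + D) * yy"
  by (simp add: algebra_simps)

lemma root_ideal_mult_iff:
  assumes "p dvd root_norm r"
  shows "(pemb A + pemb B * yy) * (pemb C + pemb D * yy) \<in> root_ideal p r \<longleftrightarrow> p dvd (A + B * r) * (C + D * r)"
proof -
  have e: "A * C + B * D * gp + (A * D + B * C - B * D * hp) * r = (A + B * r) * (C + D * r) - B * D * root_norm r"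
    unfolding root_norm_def by (simp add: algebra_simps)
  show ?thesis unfolding RR_product root_ideal_iff e using assms by (meson dvd_diff_right_iff dvd_mult dvd_diff dvd_diff_commute dvd_add_times_triv_left_iff dvd_diff_left_iff)
qed

lemma prime_ideal_root_ideal:
  assumes p: "irreducible p" and r: "p dvd root_norm r"
  shows "root_ideal p r \<subseteq> RR" "1 \<notin> root_ideal p r" "\<And>x y. x \<in> root_ideal p r \<Longrightarrow> y \<in> root_ideal p r \<Longrightarrow> x + y \<in> root_ideal p r"
    "\<And>x y. x \<in> root_ideal p r \<Longrightarrow> y \<in> RR \<Longrightarrow> x * y \<in> root_ideal p r"
    "\<And>x y. x \<in> RR \<Longrightarrow> y \<in> RR \<Longrightarrow> x * y \<in> root_ideal p r \<Longrightarrow> x \<in> root_ideal p r \<or> y \<in> root_ideal p r"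
proof -
  have pr: "prime_elem p" using p by (rule field_poly_irreducible_imp_prime)
  show sub: "root_ideal p r \<subseteq> RR" by (auto simp: root_ideal_def RR_def)
  show "1 \<notin> root_ideal p r" using root_ideal_pemb[of 1 p r] p by (simp add: irreducible_def)
  show "x + y \<in> root_ideal p r" if x: "x \<in> root_ideal p r" and y: "y \<in> root_ideal p r" for x y
  proof -
    obtain A B where 1: "x = pemb A + pemb B * yy" using x sub RR_E by blast
    obtain C D where 2: "y = pemb C + pemb D * yy" using y sub RR_E by blast
    have "p dvd (A + B * r) + (C + D * r)" using x y unfolding 1 2 root_ideal_iff by (rule dvd_add)
    thus ?thesis unfolding 1 2 RR_sum root_ideal_iff by (simp add: algebra_simps)
  qed
  have m: "x * y \<in> root_ideal p r \<longleftrightarrow> x \<in> root_ideal p r \<or> y \<in> root_ideal p r" if x: "x \<in> RR" and y: "y \<in> RR" for x y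
  proof -
    obtain A B where 1: "x = pemb A + pemb B * yy" using x RR_E by blast
    obtain C D where 2: "y = pemb C + pemb D * yy" using y RR_E by blast
    show ?thesis unfolding 1 2 root_ideal_mult_iff[OF r] unfolding root_ideal_iff using pr by (rule prime_elem_dvd_mult_iff)
  qed
  show "x * y \<in> root_ideal p r" if "x \<in> root_ideal p r" "y \<in> RR" for x y using m[of x y] that sub by blast
  show "x \<in> root_ideal p r \<or> y \<in> root_ideal p r" if "x \<in> RR" "y \<in> RR" "x * y \<in> root_ideal p r" for x y using m[of x y] that by blast
qed

lemma poly_split:
  fixes p N :: "'a poly"
  assumes "irreducible p" "N \<noteq> 0"
  shows "\<exists>j c. N = p ^ j * c \<and> \<not> p dvd c"
  using assms(2)
proof (induction "degree N" arbitrary: N rule: less_induct)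
  case less
  show ?case
  proof (cases "p dvd N")
    case False thus ?thesis by (intro exI[of _ 0] exI[of _ N]) auto
  next
    case True
    then obtain M where M: "N = p * M" by auto
    have nz: "M \<noteq> 0" "p \<noteq> 0" using M less.prems by auto
    have "degree M < degree N" using M nz irreducible_poly_degree_pos[OF assms(1)] by (simp add: degree_mult_eq)
    then obtain j c where "M = p ^ j * c" "\<not> p dvd c" using less.hyps nz by blast
    thus ?thesis using M by (intro exI[of _ "Suc j"] exI[of _ c]) (simp add: mult_ac)
  qed
qed

lemma norm_root: "(yy - pemb r) * (yb - pemb r) = pemb (root_norm r)"
proof -
  have "(yy - pemb r) * (yb - pemb r) = yy * yb - pemb r * (yy + yb) + pemb r * pemb r"
    by (simp add: algebra_simps)
  thus ?thesis unfolding yy_plus_yb yy_times_yb root_norm_def by (simp add: algebra_simps)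
qed

text \<open>The roots r and - h - r are distinct modulo p, so the conjugate factor
  \<open>yb - pemb r\<close> lies outside the ideal. Multiplying by it replaces y - r by
  \<open>root_norm r\<close>, a multiple of p; hence p generates locally.\<close>

lemma local_param_split:
  assumes p: "irreducible p" and r: "p dvd root_norm r" and u: "\<not> p dvd 2 * r + hp"
  shows "local_param (root_ideal p r) (pemb p)"
proof (rule local_paramI)
  note P = prime_ideal_root_ideal[OF p r]
  show "root_ideal p r \<subseteq> RR" "1 \<notin> root_ideal p r" by (fact P)+
  show "pemb p \<in> root_ideal p r" by (simp add: root_ideal_pemb)
  show "pemb p \<noteq> 0" using p by auto
  have ub: "yb - pemb r \<in> RR - root_ideal p r"
  proof -
    have "yb - pemb r = pemb (- hp - r) + pemb (- 1) * yy" by (simp add: yb_def)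
    moreover have "(- hp - r) + (- 1) * r = - (2 * r + hp)" by simp
    ultimately show ?thesis using u root_ideal_iff[of "- hp - r" "- 1" p r] by (metis DiffI RR_I dvd_minus_iff)
  qed
  fix g assume g: "g \<in> root_ideal p r"
  then obtain A B where AB: "g = pemb A + pemb B * yy" using P(1) RR_E by blast
  then obtain s where s: "A + B * r = p * s" using g root_ideal_iff by (metis dvdE)
  obtain k where k: "root_norm r = p * k" using r by auto
  have "g = pemb (A + B * r) + pemb B * (yy - pemb r)" unfolding AB by (simp add: algebra_simps)
  hence "(yb - pemb r) * g = (yb - pemb r) * pemb (A + B * r) + pemb B * ((yy - pemb r) * (yb - pemb r))"
    by (simp add: algebra_simps)
  also have "\<dots> = pemb p * ((yb - pemb r) * pemb s + pemb (B * k))"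
    unfolding norm_root s k by (simp add: algebra_simps)
  finally show "\<exists>u\<in>RR - root_ideal p r. \<exists>w\<in>RR. u * g = pemb p * w" using ub
    by (intro bexI[of _ "yb - pemb r"] bexI[of _ "(yb - pemb r) * pemb s + pemb (B * k)"]) auto
next
  fix N :: "'a poly" assume "N \<noteq> 0"
  then obtain j c where jc: "N = p ^ j * c" "\<not> p dvd c" using poly_split[OF p] by blast
  show "\<exists>e. \<exists>u\<in>RR - root_ideal p r. \<exists>w\<in>RR - root_ideal p r. u * pemb N = pemb p ^ e * w"
    using jc prime_ideal_root_ideal(2)[OF p r] by (intro exI[of _ j] bexI[of _ 1] bexI[of _ "pemb c"]) (auto simp: root_ideal_pemb)
qed (use prime_ideal_root_ideal[OF p r] in blast)+

text \<open>At a double root the norm of y - r is p times a polynomial prime to p, by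
  \<open>norm_root_simple\<close>. So p is locally a multiple of y - r, which therefore generates; p
  itself is a unit times (y - r)^2.\<close>

lemma local_param_ramified:
  assumes p: "irreducible p" and r: "p dvd root_norm r" and u: "p dvd 2 * r + hp"
  shows "local_param (root_ideal p r) (yy - pemb r)"
    and "\<exists>u\<in>RR - root_ideal p r. \<exists>w\<in>RR - root_ideal p r. u * pemb p = (yy - pemb r) ^ 2 * w"
proof -
  note P = prime_ideal_root_ideal[OF p r]
  obtain n' where n': "root_norm r = p * n'" using r by auto
  obtain s where s: "2 * r + hp = p * s" using u by auto
  have pn: "\<not> p dvd n'"
  proof
    assume "p dvd n'"
    hence "p * p dvd root_norm r" unfolding n' by (rule mult_dvd_mono[OF dvd_refl])
    thus False using norm_root_simple[OF p u] by simp
  qed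
  define t where "t = yy - pemb r"
  have te: "t = pemb (- r) + pemb 1 * yy" by (simp add: t_def)
  have tJ: "t \<in> root_ideal p r" unfolding te root_ideal_iff by simp
  have tR: "t \<in> RR" using tJ P(1) by blast
  have t0: "t \<noteq> 0" using independent[of "- r" 1] by (auto simp: te)
  \<comment> \<open>With the conjugate of t equal to - t - p s, the norm equation p n' = t (- t - p
    s) rearranges to u0 p = - t^2.\<close>
  define u0 where "u0 = pemb n' + t * pemb s"
  have e2: "u0 * pemb p = t ^ 2 * (- 1)"
  proof -
    have "yb - pemb r = - t - pemb (2 * r + hp)" unfolding t_def yb_def by (simp add: algebra_simps)
    hence "pemb (p * n') = t * (- t - pemb (p * s))" using norm_root[of r] unfolding n' s t_def by metis
    thus ?thesis unfolding u0_def by (simp add: algebra_simps power2_eq_square)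
  qed
  have u0: "u0 \<in> RR - root_ideal p r"
  proof -
    have "u0 \<in> RR" unfolding u0_def using tR by auto
    moreover have "u0 \<notin> root_ideal p r"
    proof
      assume "u0 \<in> root_ideal p r"
      moreover have "t * pemb (- s) \<in> root_ideal p r" by (rule P(4)[OF tJ]) simp
      ultimately have "u0 + t * pemb (- s) \<in> root_ideal p r" by (rule P(3))
      thus False using pn by (simp add: u0_def root_ideal_pemb)
    qed
    ultimately show ?thesis by simp
  qed
  have m1: "- 1 \<in> RR - root_ideal p r" using root_ideal_pemb[of "- 1" p r] p RR_pemb[of "- 1"] by (simp add: irreducible_def)
  have mm: "x * y \<in> RR - root_ideal p r" if "x \<in> RR - root_ideal p r" "y \<in> RR - root_ideal p r" for x y using that P(5) by auto
  have mp: "x ^ n \<in> RR - root_ideal p r" if "x \<in> RR - root_ideal p r" for x n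
    by (induction n) (use that P(2) mm in auto)
  have "local_param (root_ideal p r) t"
  proof (rule local_paramI)
    show "root_ideal p r \<subseteq> RR" "1 \<notin> root_ideal p r" "t \<in> root_ideal p r" "t \<noteq> 0" by (fact P tJ t0)+
    fix g assume g: "g \<in> root_ideal p r"
    then obtain A B where AB: "g = pemb A + pemb B * yy" using P(1) RR_E by blast
    then obtain k where k: "A + B * r = p * k" using g root_ideal_iff by (metis dvdE)
    have "g = pemb (A + B * r) + pemb B * t" unfolding AB t_def by (simp add: algebra_simps)
    hence "pemb n' * g = pemb (p * n') * pemb k + pemb n' * pemb B * t" unfolding k by (simp add: algebra_simps)
    also have "pemb (p * n') = t * (yb - pemb r)" using norm_root[of r] n' by (simp add: t_def)
    finally have "pemb n' * g = t * ((yb - pemb r) * pemb k + pemb n' * pemb B)" by (simp add: algebra_simps)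
    thus "\<exists>u\<in>RR - root_ideal p r. \<exists>w\<in>RR. u * g = t * w" using pn
      by (intro bexI[of _ "pemb n'"] bexI[of _ "(yb - pemb r) * pemb k + pemb n' * pemb B"]) (auto simp: root_ideal_pemb)
  next
    fix N :: "'a poly" assume "N \<noteq> 0"
    then obtain j c where jc: "N = p ^ j * c" "\<not> p dvd c" using poly_split[OF p] by blast
    have "u0 ^ j * pemb N = (u0 * pemb p) ^ j * pemb c" unfolding jc by (simp add: power_mult_distrib mult_ac)
    also have "\<dots> = t ^ (2 * j) * ((- 1) ^ j * pemb c)" unfolding e2 power_mult_distrib
      by (simp only: power_mult[symmetric] mult.assoc)
    finally have e: "u0 ^ j * pemb N = t ^ (2 * j) * ((- 1) ^ j * pemb c)" .
    have c: "pemb c \<in> RR - root_ideal p r" using jc by (simp add: root_ideal_pemb)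
    show "\<exists>e. \<exists>u\<in>RR - root_ideal p r. \<exists>w\<in>RR - root_ideal p r. u * pemb N = t ^ e * w"
      by (intro exI[of _ "2 * j"] bexI[OF _ mp[OF u0]] bexI[OF _ mm[OF mp[OF m1] c]]) (rule e)
  qed (use P in blast)+
  thus "local_param (root_ideal p r) (yy - pemb r)" by (simp add: t_def)
  show "\<exists>u\<in>RR - root_ideal p r. \<exists>w\<in>RR - root_ideal p r. u * pemb p = (yy - pemb r) ^ 2 * w"
    using e2 u0 m1 unfolding t_def by blast
qed

text \<open>If p did not divide B, the norm would be B^2 times \<open>root_norm\<close> of - A / B
  modulo p, and - A / B would be a root. Thus membership is read off from the norm, whose
  multiplicativity later shows that the ideal is prime.\<close>

lemma inert_ideal_iff_norm:
  assumes p: "irreducible p" and nor: "\<And>r. \<not> p dvd root_norm r"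
  shows "pemb A + pemb B * yy \<in> inert_ideal p \<longleftrightarrow> p dvd A * A - A * B * hp - B * B * gp"
proof
  have pr: "prime_elem p" using p by (rule field_poly_irreducible_imp_prime)
  assume d: "p dvd A * A - A * B * hp - B * B * gp"
  have "p dvd B"
  proof (rule ccontr)
    assume "\<not> p dvd B"
    then obtain u v where uv: "u * p + v * B = 1" using irreducible_bezout[OF p] by blast
    define r where "r = - (v * A)"
    have "A + B * r = (u * p + v * B) * A + B * r" unfolding uv by simp
    hence Ar: "A + B * r = p * (u * A)" unfolding r_def by (simp add: algebra_simps)
    have "B * B * root_norm r = (A * A - A * B * hp - B * B * gp) + (A + B * r) * (B * hp - A + B * r)"
      unfolding root_norm_def by (simp add: algebra_simps)
    hence "p dvd B * B * root_norm r" using d unfolding Ar by (simp add: dvd_add)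
    thus False using pr nor[of r] \<open>\<not> p dvd B\<close> by (simp add: prime_elem_dvd_mult_iff)
  qed
  moreover from this have "p dvd (A * A - A * B * hp - B * B * gp) + B * (A * hp + B * gp)"
    using d by (intro dvd_add) auto
  hence "p dvd A * A" by (simp add: algebra_simps)
  hence "p dvd A" using pr by (simp add: prime_elem_dvd_mult_iff)
  ultimately show "pemb A + pemb B * yy \<in> inert_ideal p" by (simp add: inert_ideal_iff)
next
  assume "pemb A + pemb B * yy \<in> inert_ideal p"
  hence "p dvd A" "p dvd B" by (simp_all add: inert_ideal_iff)
  thus "p dvd A * A - A * B * hp - B * B * gp" by (intro dvd_diff) (auto simp: mult.assoc)
qed

lemma inert_ideal_norm:
  assumes p: "irreducible p" and nor: "\<And>r. \<not> p dvd root_norm r" and x: "x \<in> RR" "x * sg x = pemb N"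
  shows "x \<in> inert_ideal p \<longleftrightarrow> p dvd N"
proof -
  obtain A B where AB: "x = pemb A + pemb B * yy" using x RR_E by blast
  have "pemb N = pemb (A * A - A * B * hp - B * B * gp)" using x(2) norm_RR[of A B] AB by simp
  hence "N = A * A - A * B * hp - B * B * gp" by (simp only: pemb_eq_iff)
  thus ?thesis using inert_ideal_iff_norm[OF p nor, of A B] AB by simp
qed

lemma prime_ideal_inert_ideal:
  assumes p: "irreducible p" and nor: "\<And>r. \<not> p dvd root_norm r"
  shows "inert_ideal p \<subseteq> RR" "1 \<notin> inert_ideal p" "\<And>x y. x \<in> inert_ideal p \<Longrightarrow> y \<in> inert_ideal p \<Longrightarrow> x + y \<in> inert_ideal p"
    "\<And>x y. x \<in> inert_ideal p \<Longrightarrow> y \<in> RR \<Longrightarrow> x * y \<in> inert_ideal p"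
    "\<And>x y. x \<in> RR \<Longrightarrow> y \<in> RR \<Longrightarrow> x * y \<in> inert_ideal p \<Longrightarrow> x \<in> inert_ideal p \<or> y \<in> inert_ideal p"
proof -
  have pr: "prime_elem p" using p by (rule field_poly_irreducible_imp_prime)
  show sub: "inert_ideal p \<subseteq> RR" by (auto simp: inert_ideal_def RR_def)
  show "1 \<notin> inert_ideal p" using inert_ideal_pemb[of 1 p] p by (simp add: irreducible_def)
  show "x + y \<in> inert_ideal p" if x: "x \<in> inert_ideal p" and y: "y \<in> inert_ideal p" for x y
  proof -
    obtain A B where 1: "x = pemb A + pemb B * yy" using x sub RR_E by blast
    obtain C D where 2: "y = pemb C + pemb D * yy" using y sub RR_E by blast
    show ?thesis using x y unfolding 1 2 RR_sum inert_ideal_iff by auto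
  qed
  show "x * y \<in> inert_ideal p" if x: "x \<in> inert_ideal p" and y: "y \<in> RR" for x y
  proof -
    obtain A B where 1: "x = pemb A + pemb B * yy" using x sub RR_E by blast
    obtain C D where 2: "y = pemb C + pemb D * yy" using y RR_E by blast
    show ?thesis using x unfolding 1 2 RR_product inert_ideal_iff by (auto simp: mult.assoc intro!: dvd_add dvd_diff)
  qed
  show "x \<in> inert_ideal p \<or> y \<in> inert_ideal p" if x: "x \<in> RR" and y: "y \<in> RR" and xy: "x * y \<in> inert_ideal p" for x y
  proof (rule ccontr)
    assume c: "\<not> (x \<in> inert_ideal p \<or> y \<in> inert_ideal p)"
    have z: "0 \<in> inert_ideal p" using inert_ideal_pemb[of 0 p] by simp
    obtain N where N: "x * sg x = pemb N" using RR_norm[OF x] c z by metis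
    obtain M where M: "y * sg y = pemb M" using RR_norm[OF y] c z by metis
    have "(x * y) * sg (x * y) = (x * sg x) * (y * sg y)" using x y by (simp add: sg_mult mult_ac)
    hence "(x * y) * sg (x * y) = pemb (N * M)" unfolding N M by simp
    hence "p dvd N * M" using inert_ideal_norm[OF p nor, of "x * y" "N * M"] x y xy by simp
    hence "p dvd N \<or> p dvd M" using pr by (simp add: prime_elem_dvd_mult_iff)
    thus False using c inert_ideal_norm[OF p nor x N] inert_ideal_norm[OF p nor y M] by blast
  qed
qed

lemma local_param_inert:
  assumes p: "irreducible p" and nor: "\<And>r. \<not> p dvd root_norm r"
  shows "local_param (inert_ideal p) (pemb p)"
proof (rule local_paramI)
  note P = prime_ideal_inert_ideal[OF p nor]
  show "inert_ideal p \<subseteq> RR" "1 \<notin> inert_ideal p" by (fact P)+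
  show "pemb p \<in> inert_ideal p" by (simp add: inert_ideal_pemb)
  show "pemb p \<noteq> 0" using p by auto
  fix g assume g: "g \<in> inert_ideal p"
  then obtain A B where AB: "g = pemb A + pemb B * yy" using P(1) RR_E by blast
  then obtain k l where "A = p * k" "B = p * l" using g by (auto simp: inert_ideal_iff elim!: dvdE)
  hence "1 * g = pemb p * (pemb k + pemb l * yy)" unfolding AB by (simp add: algebra_simps)
  thus "\<exists>u\<in>RR - inert_ideal p. \<exists>w\<in>RR. u * g = pemb p * w" using P(2) RR_I[of k l]
    by (intro bexI[of _ 1] bexI[of _ "pemb k + pemb l * yy"]) auto
next
  fix N :: "'a poly" assume "N \<noteq> 0"
  then obtain j c where jc: "N = p ^ j * c" "\<not> p dvd c" using poly_split[OF p] by blast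
  show "\<exists>e. \<exists>u\<in>RR - inert_ideal p. \<exists>w\<in>RR - inert_ideal p. u * pemb N = pemb p ^ e * w"
    using jc prime_ideal_inert_ideal(2)[OF p nor] by (intro exI[of _ j] bexI[of _ 1] bexI[of _ "pemb c"]) (auto simp: inert_ideal_pemb)
qed (use prime_ideal_inert_ideal[OF p nor] in blast)+

end

text \<open>A condition on coefficients rather than on the degree: for n = 0 it leaves only the zero
  polynomial, and there are q^n elements for every n. With n = deg p this is a system of residues
  modulo p.\<close>

definition polys_below :: "nat \<Rightarrow> 'a::zero poly set" where
  "polys_below n = {p. \<forall>i\<ge>n. coeff p i = 0}"

lemma polys_below_Suc: "polys_below (Suc n) = (\<lambda>(a, p). pCons a p) ` (UNIV \<times> polys_below n)"
proof (intro equalityI subsetI)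
  fix p :: "'a poly" assume p: "p \<in> polys_below (Suc n)"
  obtain a r where ar: "p = pCons a r" by (cases p) auto
  have "coeff r i = 0" if "i \<ge> n" for i
    using p that unfolding polys_below_def ar by (auto dest: spec[of _ "Suc i"])
  thus "p \<in> (\<lambda>(a, p). pCons a p) ` (UNIV \<times> polys_below n)"
    unfolding ar polys_below_def by auto
next
  fix p :: "'a poly" assume "p \<in> (\<lambda>(a, p). pCons a p) ` (UNIV \<times> polys_below n)"
  then obtain a r where ar: "p = pCons a r" "r \<in> polys_below n" by auto
  show "p \<in> polys_below (Suc n)" unfolding polys_below_def
  proof (intro CollectI allI impI)
    fix i assume "Suc n \<le> i"
    then obtain j where "i = Suc j" "n \<le> j" by (cases i) auto
    thus "coeff p i = 0" using ar by (simp add: polys_below_def)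
  qed
qed

lemma card_polys_below:
  "finite (polys_below n :: 'a::{finite,zero} poly set) \<and> card (polys_below n :: 'a poly set) = card (UNIV :: 'a set) ^ n"
proof (induction n)
  case 0
  have "polys_below 0 = {0 :: 'a poly}" by (auto simp: polys_below_def poly_eq_iff)
  thus ?case by simp
next
  case (Suc n)
  have inj: "inj_on (\<lambda>(a :: 'a, p). pCons a p) (UNIV \<times> polys_below n)" by (auto simp: inj_on_def)
  show ?case unfolding polys_below_Suc card_image[OF inj] using Suc by (simp add: card_cartesian_product)
qed

lemma polys_below_diff: "p \<in> polys_below n \<Longrightarrow> r \<in> polys_below n \<Longrightarrow> p - r \<in> polys_below n"
  for p :: "'a::ab_group_add poly"
  by (auto simp: polys_below_def)

lemma polys_below_dvd:
  fixes p :: "'a::field poly"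
  assumes "p dvd r" "r \<in> polys_below (degree p)" shows "r = 0"
proof (rule ccontr)
  assume "r \<noteq> 0"
  hence "degree p \<le> degree r" using assms by (simp add: dvd_imp_degree_le)
  hence "coeff r (degree r) = 0" using assms by (simp add: polys_below_def)
  thus False using \<open>r \<noteq> 0\<close> by simp
qed

lemma polys_below_mod:
  fixes p :: "'a::field poly"
  assumes "p \<noteq> 0" shows "r mod p \<in> polys_below (degree p)" "p dvd r - r mod p"
proof -
  have "coeff (r mod p) i = 0" if "degree p \<le> i" for i
    using degree_mod_less[OF assms, of r] that by (auto intro: coeff_eq_0)
  thus "r mod p \<in> polys_below (degree p)" by (simp add: polys_below_def)
  show "p dvd r - r mod p" by (simp add: minus_mod_eq_mult_div)
qed

section \<open>Centres of valuations on the coordinate ring\<close>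

context weierstrass
begin

abbreviation "xx \<equiv> pemb [:0, 1 :: 'a:]"

lemma pemb_pCons: "pemb (pCons a p) = pemb [:a:] + xx * pemb p"
proof -
  have "pCons a p = [:a:] + [:0, 1:] * p" by simp
  thus ?thesis by (simp only: pemb_hom)
qed

text \<open>Being nonnegative at x entails being nonnegative on all of \<open>RR\<close>, because y
  is integral over K[x].\<close>

definition fin :: "('a poly fract alg_closure \<Rightarrow> int) \<Rightarrow> bool" where "fin \<nu> \<longleftrightarrow> \<nu> xx \<ge> 0"

definition center :: "('a poly fract alg_closure \<Rightarrow> int) \<Rightarrow> 'a poly fract alg_closure set" where
  "center \<nu> = {g \<in> RR. ge \<nu> 1 g}"

context
  fixes \<nu> assumes \<nu>: "is_val \<nu>" and f: "fin \<nu>"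
begin

lemma ge0_pemb: "ge \<nu> 0 (pemb p)"
proof (induction p)
  case (pCons a p)
  have "ge \<nu> (0 + 0) (xx * pemb p)" by (rule ge_mult[OF \<nu>]) (use pCons f in \<open>auto simp: ge_def fin_def\<close>)
  hence "ge \<nu> 0 (pemb [:a:] + xx * pemb p)" by (intro ge_add[OF \<nu>] ge_const[OF \<nu>]) auto
  thus ?case by (simp only: pemb_pCons[of a p, symmetric])
qed (simp add: ge_def)

lemma ge0_yy: "ge \<nu> 0 yy"
proof (rule ccontr)
  assume "\<not> ge \<nu> 0 yy"
  hence n: "yy \<noteq> 0" "\<nu> yy < 0" by (auto simp: ge_def)
  have "\<nu> (yy * yy) = 2 * \<nu> yy" using v_mult[OF \<nu>, of yy yy] n by simp
  moreover have "ge \<nu> (\<nu> yy) (yy * yy)"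
  proof -
    have "ge \<nu> (0 + \<nu> yy) (pemb hp * yy)" by (rule ge_mult[OF \<nu>]) (use ge0_pemb in \<open>auto simp: ge_def\<close>)
    moreover have "ge \<nu> (\<nu> yy) (pemb gp)" using ge_mono[OF \<nu> ge0_pemb] n by simp
    ultimately show ?thesis unfolding yy_sq by (intro ge_diff[OF \<nu>]) auto
  qed
  ultimately show False using n by (simp add: ge_def)
qed

lemma ge0_RR: assumes "g \<in> RR" shows "ge \<nu> 0 g"
proof -
  obtain A B where "g = pemb A + pemb B * yy" using assms by (rule RR_E)
  moreover have "ge \<nu> (0 + 0) (pemb B * yy)" by (rule ge_mult[OF \<nu>]) (use ge0_pemb ge0_yy in auto)
  ultimately show ?thesis using ge_add[OF \<nu>, of "pemb A" "pemb B * yy" 0] ge0_pemb by simp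
qed

text \<open>Otherwise the valuation would vanish on all nonzero polynomials. Some g in
  \<open>RR\<close> would then have value 1, while g and its conjugate, both of nonnegative value,
  multiply to the polynomial norm of value 0.\<close>

lemma exists_prime: "\<exists>p. irreducible p \<and> ge \<nu> 1 (pemb p)"
proof (rule ccontr)
  assume c: "\<not> ?thesis"
  have z: "\<nu> (pemb p) = 0" if "irreducible p" for p
    using c that ge0_pemb[of p] by (auto simp: ge_def)
  have zN: "\<nu> (pemb N) = 0" if "N \<noteq> 0" for N
    using that
  proof (induction "degree N" arbitrary: N rule: less_induct)
    case less
    show ?case
    proof (cases "degree N = 0")
      case True
      then obtain a where "N = [:a:]" by (rule degree_eq_zeroE)
      thus ?thesis using v_const[OF \<nu>, of a] less.prems by simp
    next
      case False
      then obtain r M where r: "irreducible r" "N = r * M"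
        using exists_irreducible_divisor[of N] unfolding dvd_def by blast
      have nz: "r \<noteq> 0" "M \<noteq> 0" using r less.prems by auto
      have "degree M < degree N" using r nz irreducible_poly_degree_pos[OF r(1)] by (simp add: degree_mult_eq)
      hence "\<nu> (pemb M) = 0" using less.hyps nz by blast
      thus ?thesis using v_mult[OF \<nu>, of "pemb r" "pemb M"] nz z[OF r(1)] r(2) by simp
    qed
  qed
  obtain s where s: "s \<in> LF" "s \<noteq> 0" "\<nu> s = 1" using \<nu> unfolding is_val_def by blast
  obtain g C where g: "g \<in> RR" "C \<noteq> 0" "s = g / pemb C" using s(1) by (rule LF_E)
  have g0: "g \<noteq> 0" using s g by auto
  have "\<nu> s = \<nu> g - \<nu> (pemb C)" unfolding g(3) by (rule v_divide[OF \<nu>]) (use g g0 in auto)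
  hence "\<nu> g = 1" using s zN[OF g(2)] by simp
  obtain N where N: "g * sg g = pemb N" "N \<noteq> 0" using RR_norm[OF g(1) g0] .
  have "\<nu> g + \<nu> (sg g) = 0" using v_mult[OF \<nu>, of g "sg g"] N g g0 zN by simp
  moreover have "\<nu> (sg g) \<ge> 0" using ge0_RR[of "sg g"] g g0 by (simp add: ge_def)
  ultimately show False using \<open>\<nu> g = 1\<close> by simp
qed

lemma ge1_iff_dvd:
  assumes p: "irreducible p" "ge \<nu> 1 (pemb p)"
  shows "ge \<nu> 1 (pemb N) \<longleftrightarrow> p dvd N"
proof
  assume "p dvd N"
  then obtain M where "N = p * M" by auto
  thus "ge \<nu> 1 (pemb N)" using ge_mult[OF \<nu>, of "pemb p" "pemb M" 1 0] p ge0_pemb by simp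
next
  assume N: "ge \<nu> 1 (pemb N)"
  show "p dvd N"
  proof (rule ccontr)
    assume "\<not> p dvd N"
    then obtain u v where uv: "u * p + v * N = 1" using irreducible_bezout[OF p(1)] by blast
    have "ge \<nu> (0 + 1) (pemb u * pemb p)" "ge \<nu> (0 + 1) (pemb v * pemb N)"
      by (intro ge_mult[OF \<nu>] ge0_pemb p N RR_LF RR_pemb)+
    hence "ge \<nu> 1 (pemb u * pemb p + pemb v * pemb N)" by (intro ge_add[OF \<nu>]) auto
    hence "ge \<nu> 1 (pemb 1)" unfolding uv[symmetric] by simp
    thus False using v_1[OF \<nu>] by (simp add: ge_def)
  qed
qed

lemma center_inert:
  assumes p: "irreducible p" "ge \<nu> 1 (pemb p)" and nor: "\<And>r. \<not> p dvd root_norm r"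
  shows "center \<nu> = inert_ideal p"
proof (intro equalityI subsetI)
  fix g assume "g \<in> center \<nu>"
  hence g: "g \<in> RR" "ge \<nu> 1 g" by (auto simp: center_def)
  show "g \<in> inert_ideal p"
  proof (cases "g = 0")
    case True thus ?thesis using inert_ideal_pemb[of 0 p] by simp
  next
    case False
    obtain N where N: "g * sg g = pemb N" "N \<noteq> 0" using RR_norm[OF g(1) False] .
    have "ge \<nu> (1 + 0) (g * sg g)" by (intro ge_mult[OF \<nu>] g ge0_RR) (use g in auto)
    hence "p dvd N" unfolding N using ge1_iff_dvd[OF p] by simp
    thus ?thesis using inert_ideal_norm[OF p(1) nor g(1) N(1)] by simp
  qed
next
  fix g assume "g \<in> inert_ideal p"
  then obtain A B where g: "g = pemb A + pemb B * yy" "p dvd A" "p dvd B" by (auto simp: inert_ideal_def)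
  have "ge \<nu> (1 + 0) (pemb B * yy)" by (intro ge_mult[OF \<nu>] ge0_yy) (use g ge1_iff_dvd[OF p] in auto)
  moreover have "ge \<nu> 1 (pemb A)" using g ge1_iff_dvd[OF p] by simp
  ultimately have "ge \<nu> 1 g" unfolding g(1) by (intro ge_add[OF \<nu>]) auto
  thus "g \<in> center \<nu>" unfolding center_def using g RR_I by auto
qed

lemma center_root_ideal_I:
  assumes p: "irreducible p" "ge \<nu> 1 (pemb p)" and r: "ge \<nu> 1 (yy - pemb r)"
  shows "center \<nu> = root_ideal p r"
proof -
  have "ge \<nu> 1 (pemb A + pemb B * yy) \<longleftrightarrow> p dvd A + B * r" for A B
  proof -
    have e: "pemb A + pemb B * yy = pemb (A + B * r) + pemb B * (yy - pemb r)" by (simp add: algebra_simps)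
    have b: "ge \<nu> (0 + 1) (pemb B * (yy - pemb r))" by (intro ge_mult[OF \<nu>] ge0_pemb r) auto
    have "ge \<nu> 1 (pemb (A + B * r) + pemb B * (yy - pemb r)) \<longleftrightarrow> ge \<nu> 1 (pemb (A + B * r))"
    proof
      assume "ge \<nu> 1 (pemb (A + B * r) + pemb B * (yy - pemb r))"
      hence "ge \<nu> 1 (pemb (A + B * r) + pemb B * (yy - pemb r) - pemb B * (yy - pemb r))"
        using b by (intro ge_diff[OF \<nu>]) (auto simp del: pemb_hom)
      thus "ge \<nu> 1 (pemb (A + B * r))" by (simp del: pemb_hom)
    next
      assume "ge \<nu> 1 (pemb (A + B * r))"
      thus "ge \<nu> 1 (pemb (A + B * r) + pemb B * (yy - pemb r))"
        using b by (intro ge_add[OF \<nu>]) (auto simp del: pemb_hom)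
    qed
    thus ?thesis unfolding e ge1_iff_dvd[OF p] .
  qed
  thus ?thesis unfolding center_def root_ideal_def by (auto elim!: RR_E intro: RR_I)
qed

text \<open>The product of y - r and its conjugate is \<open>root_norm r\<close>, so one of them has
  positive value. The conjugate is, up to sign, y minus the other root - h - r.\<close>

lemma center_root:
  assumes p: "irreducible p" "ge \<nu> 1 (pemb p)" and r: "p dvd root_norm r"
  shows "center \<nu> = root_ideal p r \<or> center \<nu> = root_ideal p (- hp - r)"
proof -
  have "ge \<nu> 1 (pemb (root_norm r))" using ge1_iff_dvd[OF p] r by simp
  hence m: "ge \<nu> 1 ((yy - pemb r) * (yb - pemb r))" by (simp only: norm_root)
  have nz: "yy - pemb r \<noteq> 0" using independent[of "- r" 1] by auto
  have "ge \<nu> 1 (yy - pemb r) \<or> ge \<nu> 1 (yb - pemb r)"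
  proof (rule ccontr)
    assume c: "\<not> ?thesis"
    have "\<nu> ((yy - pemb r) * (yb - pemb r)) = \<nu> (yy - pemb r) + \<nu> (yb - pemb r)"
      by (rule v_mult[OF \<nu>]) (use c in \<open>auto simp: ge_def\<close>)
    thus False using c m by (auto simp: ge_def)
  qed
  moreover have e: "yy - pemb (- hp - r) = - (yb - pemb r)" by (simp add: yb_def)
  have "ge \<nu> 1 (yb - pemb r) \<Longrightarrow> ge \<nu> 1 (yy - pemb (- hp - r))"
    unfolding e by (intro ge_uminus[OF \<nu>]) auto
  ultimately show ?thesis using center_root_ideal_I[OF p] by blast
qed

end

lemma root_norm_conj: "root_norm (- hp - r) = root_norm r" unfolding root_norm_def by (simp add: algebra_simps)

text \<open>With a pole at x, the leading term has strictly the smallest value.\<close>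

lemma not_fin_pemb:
  assumes \<nu>: "is_val \<nu>" and f: "\<not> fin \<nu>" and "p \<noteq> 0"
  shows "\<nu> (pemb p) = int (degree p) * \<nu> xx"
  using assms(3)
proof (induction p)
  case (pCons a p)
  show ?case
  proof (cases "p = 0")
    case True thus ?thesis using pCons v_const[OF \<nu>, of a] by simp
  next
    case False
    have m: "\<nu> (xx * pemb p) = int (degree (pCons a p)) * \<nu> xx"
      using v_mult[OF \<nu>, of xx "pemb p"] pCons.IH False by (simp add: algebra_simps)
    have neg: "\<nu> xx < 0" using f by (simp add: fin_def)
    have "int (degree (pCons a p)) * \<nu> xx < 0" using neg False by (simp add: mult_less_0_iff)
    hence "ge \<nu> (\<nu> (xx * pemb p) + 1) (pemb [:a:])" unfolding m
      by (intro ge_mono[OF \<nu> ge_const[OF \<nu>]]) simp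
    hence "\<nu> (pemb [:a:] + xx * pemb p) = \<nu> (xx * pemb p)" using False by (intro v_add_eq(2)[OF \<nu>]) auto
    thus ?thesis unfolding m by (simp only: pemb_pCons[of a p, symmetric])
  qed
qed simp

lemma fin_of_ge1: assumes \<nu>: "is_val \<nu>" and "ge \<nu> 1 (pemb p)" "p \<noteq> 0" shows "fin \<nu>"
proof (rule ccontr)
  assume f: "\<not> fin \<nu>"
  have "\<nu> (pemb p) \<le> 0" unfolding not_fin_pemb[OF \<nu> f assms(3)] using f
    by (simp add: fin_def mult_le_0_iff)
  thus False using assms by (simp add: ge_def)
qed

section \<open>Finite places\<close>

lemma local_param_place:
  assumes L: "local_param Q t"
  obtains v where "is_place cc v" "fin (val v)" "center (val v) = Q" "\<And>z. z \<in> LF \<Longrightarrow> z \<noteq> 0 \<Longrightarrow> val v z = local_val Q t z"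
proof -
  obtain v where v: "is_place cc v" "\<And>z. z \<in> LF \<Longrightarrow> z \<noteq> 0 \<Longrightarrow> val v z = local_val Q t z"
    using place_of_is_val[OF local_val_is_val[OF L]] by metis
  have 0: "0 \<in> Q" by (rule Q_0[OF L])
  have g: "val v g \<ge> 0" "val v g \<ge> 1 \<longleftrightarrow> g \<in> Q" if "g \<in> RR" "g \<noteq> 0" for g
    using local_val_RR[OF L that] v(2)[of g] that by auto
  have "fin (val v)" unfolding fin_def by (rule g) auto
  moreover have "center (val v) = Q" unfolding center_def ge_def using g(2) 0 Q_RR[OF L] by auto
  ultimately show ?thesis using that v by blast
qed

lemma place_is_val: "is_place cc v \<Longrightarrow> is_val (val v)" by (simp add: is_place_iff)

lemma local_param_val:
  assumes L: "local_param Q t" and v: "is_place cc v" "fin (val v)" "center (val v) = Q" and z: "z \<in> LF" "z \<noteq> 0"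
  shows "val v z = local_val Q t z"
  by (rule local_val_unique[OF L place_is_val[OF v(1)] _ _ z])
    (use ge0_RR[OF place_is_val[OF v(1)] v(2)] v(3) in \<open>auto simp: center_def\<close>)

lemma local_param_place_unique:
  assumes L: "local_param Q t" and v: "is_place cc v" "fin (val v)" "center (val v) = Q"
    and w: "is_place cc w" "fin (val w)" "center (val w) = Q"
  shows "v = w"
  by (rule place_eqI[OF v(1) w(1)]) (simp add: local_param_val[OF L v] local_param_val[OF L w])

text \<open>Links the quotient in \<open>place_deg\<close> to explicit counting: S is a complete
  system of pairwise incongruent representatives, taken in the closure where they can be
  subtracted.\<close>

lemma card_residues:
  assumes v: "is_place cc v"
    and S: "S \<subseteq> LF" "\<And>s. s \<in> S \<Longrightarrow> ge (val v) 0 s"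
      "\<And>s s'. s \<in> S \<Longrightarrow> s' \<in> S \<Longrightarrow> ge (val v) 1 (s - s') \<Longrightarrow> s = s'"
      "\<And>z. z \<in> LF \<Longrightarrow> ge (val v) 0 z \<Longrightarrow> \<exists>s\<in>S. ge (val v) 1 (z - s)"
  shows "card (val_ring v // res_rel v) = card S"
proof -
  note \<nu> = place_is_val[OF v]
  have vr: "f \<in> val_ring v \<longleftrightarrow> ge (val v) 0 (emb f)" for f
    by (auto simp: val_ring_def ge_def)
  have rr: "(f, g) \<in> res_rel v \<longleftrightarrow> ge (val v) 0 (emb f) \<and> ge (val v) 0 (emb g) \<and> ge (val v) 1 (emb f - emb g)" for f g
  proof -
    have "f = g \<or> v (fsub f g) > 0 \<longleftrightarrow> ge (val v) 1 (emb (fsub f g))"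
    proof (cases "f = g")
      case True thus ?thesis by (simp add: ge_def emb_sub del: emb_eq_0_iff)
    next
      case False
      hence "emb (fsub f g) \<noteq> 0" by (simp add: emb_sub del: emb_eq_0_iff)
      thus ?thesis using False by (auto simp: ge_def)
    qed
    thus ?thesis unfolding res_rel_def by (auto simp: vr emb_sub)
  qed
  define h where "h s = res_rel v `` {iemb s}" for s
  have eS: "emb (iemb s) = s" if "s \<in> S" for s using that S(1) by auto
  have "bij_betw h S (val_ring v // res_rel v)"
    unfolding bij_betw_def
  proof
    show "inj_on h S"
    proof (rule inj_onI)
      fix s s' assume s: "s \<in> S" "s' \<in> S" "h s = h s'"
      have "iemb s' \<in> h s'" unfolding h_def
        using rr[of "iemb s'" "iemb s'"] eS[OF s(2)] S(2)[OF s(2)] ge_0[OF \<nu>] by simp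
      hence "iemb s' \<in> h s" using s by simp
      hence "ge (val v) 1 (s - s')" unfolding h_def
        using rr[of "iemb s" "iemb s'"] eS[OF s(1)] eS[OF s(2)] by simp
      thus "s = s'" using S(3) s by blast
    qed
    show "h ` S = val_ring v // res_rel v"
    proof (intro equalityI subsetI)
      fix c assume "c \<in> h ` S"
      then obtain s where s: "s \<in> S" "c = res_rel v `` {iemb s}" unfolding h_def by blast
      have "iemb s \<in> val_ring v" using vr[of "iemb s"] eS[OF s(1)] S(2)[OF s(1)] by simp
      thus "c \<in> val_ring v // res_rel v" unfolding s(2) by (rule quotientI)
    next
      fix c assume "c \<in> val_ring v // res_rel v"
      then obtain f where f: "f \<in> val_ring v" "c = res_rel v `` {f}" by (rule quotientE)
      have f0: "ge (val v) 0 (emb f)" using f vr[of f] by simp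
      obtain s where s: "s \<in> S" "ge (val v) 1 (emb f - s)" using S(4)[OF _ f0] emb_LF[of f] by blast
      have sL: "s \<in> LF" using s S by auto
      have s': "ge (val v) 1 (s - emb f)" using ge_uminus[OF \<nu>, of "emb f - s" 1] s sL by simp
      have "c = h s"
      proof (intro equalityI subsetI)
        fix g assume "g \<in> c"
        hence g: "ge (val v) 0 (emb g)" "ge (val v) 1 (emb f - emb g)" using f rr[of f g] by simp_all
        have "ge (val v) 1 ((s - emb f) + (emb f - emb g))" by (rule ge_add[OF \<nu>]) (use s' g sL in auto)
        thus "g \<in> h s" unfolding h_def using rr[of "iemb s" g] eS[OF s(1)] g S(2)[OF s(1)] by simp
      next
        fix g assume "g \<in> h s"
        hence g: "ge (val v) 0 (emb g)" "ge (val v) 1 (s - emb g)"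
          unfolding h_def using rr[of "iemb s" g] eS[OF s(1)] by simp_all
        have "ge (val v) 1 ((emb f - s) + (s - emb g))" by (rule ge_add[OF \<nu>]) (use s g sL in auto)
        thus "g \<in> c" using f rr[of f g] g f0 by simp
      qed
      thus "c \<in> h ` S" using s by blast
    qed
  qed
  thus ?thesis by (simp add: bij_betw_same_card)
qed

lemma q_gt_1: "q > 1"
proof -
  have "card {0, 1 :: 'a} \<le> q" unfolding q_def by (rule card_mono) auto
  thus ?thesis by simp
qed

lemma place_degI:
  fixes v :: "'a ff \<Rightarrow> int"
  assumes "card (val_ring v // res_rel v) = q ^ d" shows "place_deg v = d"
  unfolding place_deg_def
proof (rule the_equality)
  show "card (val_ring v // res_rel v) = card (UNIV :: 'a set) ^ d" using assms q_def by simp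
  fix e assume "card (val_ring v // res_rel v) = card (UNIV :: 'a set) ^ e"
  hence "q ^ e = q ^ d" using assms q_def by simp
  thus "e = d" using q_gt_1 by simp
qed

text \<open>A z of nonnegative value satisfies a z = g with g in \<open>RR\<close> and a outside Q;
  an inverse of a modulo Q then replaces the division by a.\<close>

lemma residue_in_RR:
  assumes L: "local_param Q t" and v: "is_place cc v" "fin (val v)" "center (val v) = Q"
    and inv: "\<And>u. u \<in> RR - Q \<Longrightarrow> \<exists>u'\<in>RR. 1 - u * u' \<in> Q"
    and z: "z \<in> LF" "ge (val v) 0 z"
  shows "\<exists>g\<in>RR. ge (val v) 1 (z - g)"
proof (cases "z = 0")
  case True thus ?thesis by (intro bexI[of _ 0]) (auto simp: ge_def)
next
  case False
  note \<nu> = place_is_val[OF v(1)]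
  obtain a b where ab: "a \<in> RR - Q" "b \<in> RR - Q" "a * z = t powi (local_val Q t z) * b" using local_val_rep[OF L z(1) False] .
  have "local_val Q t z \<ge> 0" using z False local_param_val[OF L v z(1) False] by (simp add: ge_def)
  then obtain m where "local_val Q t z = int m" by (metis nonneg_int_cases)
  hence az: "a * z = t ^ m * b" using ab by (simp add: power_int_of_nat)
  obtain a' where a': "a' \<in> RR" "1 - a * a' \<in> Q" using inv[OF ab(1)] by blast
  have "z - a' * (t ^ m * b) = z * (1 - a * a')" unfolding az[symmetric] by (simp add: algebra_simps)
  moreover have "ge (val v) (0 + 1) (z * (1 - a * a'))"
    by (rule ge_mult[OF \<nu> z(1) _ z(2)]) (use a' ab v(3) in \<open>auto simp: center_def\<close>)
  moreover have "a' * (t ^ m * b) \<in> RR" using a' ab t_RR[OF L] by auto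
  ultimately show ?thesis by (intro bexI[of _ "a' * (t ^ m * b)"]) auto
qed

text \<open>Since y is congruent to r, the residue field is K[x]/p, represented by the polynomials
  of degree below deg p.\<close>

lemma deg_root_ideal:
  assumes p: "irreducible p" and r: "p dvd root_norm r" and L: "local_param (root_ideal p r) t"
    and v: "is_place cc v" "fin (val v)" "center (val v) = root_ideal p r"
  shows "card (val_ring v // res_rel v) = q ^ degree p" "place_deg v = degree p"
proof -
  note \<nu> = place_is_val[OF v(1)]
  have p0: "p \<noteq> 0" using p by auto
  have J1: "ge (val v) 1 g \<longleftrightarrow> g \<in> root_ideal p r" if "g \<in> RR" for g using v(3) that by (auto simp: center_def)
  let ?S = "pemb ` (polys_below (degree p) :: 'a poly set)"
  have inv: "\<exists>u'\<in>RR. 1 - u * u' \<in> root_ideal p r" if u: "u \<in> RR - root_ideal p r" for u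
  proof -
    obtain A B where AB: "u = pemb A + pemb B * yy" using u by (auto elim: RR_E)
    have "\<not> p dvd A + B * r" using u AB root_ideal_iff by blast
    then obtain k l where kl: "k * p + l * (A + B * r) = 1" using irreducible_bezout[OF p] by blast
    have e: "1 - u * pemb l = pemb (1 - A * l) + pemb (- B * l) * yy" unfolding AB by (simp add: algebra_simps)
    have "1 - A * l + (- B * l) * r = k * p" using kl by (simp add: algebra_simps)
    hence "1 - u * pemb l \<in> root_ideal p r" unfolding e root_ideal_iff by simp
    thus ?thesis by (intro bexI[of _ "pemb l"]) auto
  qed
  have "card (val_ring v // res_rel v) = card ?S"
  proof (rule card_residues[OF v(1)])
    show "?S \<subseteq> LF" by auto
    show "ge (val v) 0 s" if "s \<in> ?S" for s using that ge0_pemb[OF \<nu> v(2)] by auto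
    show "s = s'" if s: "s \<in> ?S" "s' \<in> ?S" "ge (val v) 1 (s - s')" for s s'
    proof -
      obtain a b where ab: "s = pemb a" "s' = pemb b" "a \<in> polys_below (degree p)" "b \<in> polys_below (degree p)" using s by auto
      have "s - s' = pemb (a - b)" by (simp add: ab)
      hence "p dvd a - b" using s(3) J1[of "pemb (a - b)"] root_ideal_pemb[of "a - b"] by (simp del: pemb_hom)
      hence "a - b = 0" using polys_below_dvd polys_below_diff ab by blast
      thus ?thesis by (simp add: ab)
    qed
    show "\<exists>s\<in>?S. ge (val v) 1 (z - s)" if z: "z \<in> LF" "ge (val v) 0 z" for z
    proof -
      obtain g where g: "g \<in> RR" "ge (val v) 1 (z - g)" using residue_in_RR[OF L v inv z] by blast
      obtain A B where AB: "g = pemb A + pemb B * yy" using g by (auto elim: RR_E)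
      let ?s = "(A + B * r) mod p"
      have e: "g - pemb ?s = pemb (A - ?s) + pemb B * yy" unfolding AB by simp
      have "p dvd (A + B * r) - ?s" by (rule polys_below_mod[OF p0])
      hence "g - pemb ?s \<in> root_ideal p r" unfolding e root_ideal_iff by (simp add: algebra_simps)
      hence "ge (val v) 1 (g - pemb ?s)" using J1 g by simp
      hence "ge (val v) 1 ((z - g) + (g - pemb ?s))" using g z by (intro ge_add[OF \<nu>]) auto
      thus ?thesis using polys_below_mod(1)[OF p0, of "A + B * r"] by (intro bexI[of _ "pemb ?s"]) auto
    qed
  qed
  also have "card ?S = card (polys_below (degree p) :: 'a poly set)" by (rule card_image) (auto simp: inj_on_def)
  also have "\<dots> = q ^ degree p" using card_polys_below[where 'a='a] by (simp add: q_def)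
  finally show "card (val_ring v // res_rel v) = q ^ degree p" .
  thus "place_deg v = degree p" by (rule place_degI)
qed

text \<open>Here y is not congruent to a polynomial: A and B are reduced modulo p independently,
  which doubles the degree.\<close>

lemma deg_inert_ideal:
  assumes p: "irreducible p" and nor: "\<And>r. \<not> p dvd root_norm r"
    and v: "is_place cc v" "fin (val v)" "center (val v) = inert_ideal p"
  shows "card (val_ring v // res_rel v) = q ^ (2 * degree p)" "place_deg v = 2 * degree p"
proof -
  note \<nu> = place_is_val[OF v(1)]
  note L = local_param_inert[OF p nor]
  have p0: "p \<noteq> 0" using p by auto
  have J1: "ge (val v) 1 g \<longleftrightarrow> g \<in> inert_ideal p" if "g \<in> RR" for g using v(3) that by (auto simp: center_def)
  let ?P = "polys_below (degree p) :: 'a poly set"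
  let ?f = "\<lambda>(A, B). pemb A + pemb B * yy"
  let ?S = "?f ` (?P \<times> ?P)"
  have inv: "\<exists>u'\<in>RR. 1 - u * u' \<in> inert_ideal p" if u: "u \<in> RR - inert_ideal p" for u
  proof -
    have "u \<noteq> 0" using u inert_ideal_pemb[of 0 p] by auto
    then obtain N where N: "u * sg u = pemb N" using RR_norm[of u] u by auto
    have "\<not> p dvd N" using u inert_ideal_norm[OF p nor _ N] by auto
    then obtain k l where kl: "k * p + l * N = 1" using irreducible_bezout[OF p] by blast
    have "1 - u * (sg u * pemb l) = pemb 1 - pemb N * pemb l" unfolding N[symmetric] by (simp add: mult_ac)
    also have "\<dots> = pemb (1 - N * l)" by simp
    also have "1 - N * l = k * p" using kl by (simp add: algebra_simps)
    finally have "1 - u * (sg u * pemb l) \<in> inert_ideal p" by (simp only: inert_ideal_pemb dvd_triv_right)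
    thus ?thesis using u by (intro bexI[of _ "sg u * pemb l"]) auto
  qed
  have "card (val_ring v // res_rel v) = card ?S"
  proof (rule card_residues[OF v(1)])
    show "?S \<subseteq> LF" by auto
    show "ge (val v) 0 s" if "s \<in> ?S" for s using that ge0_RR[OF \<nu> v(2)] by (auto simp: RR_I)
    show "s = s'" if s: "s \<in> ?S" "s' \<in> ?S" "ge (val v) 1 (s - s')" for s s'
    proof -
      obtain a b where ab: "s = pemb a + pemb b * yy" "a \<in> ?P" "b \<in> ?P" using s(1) by auto
      obtain a' b' where ab': "s' = pemb a' + pemb b' * yy" "a' \<in> ?P" "b' \<in> ?P" using s(2) by auto
      have e: "s - s' = pemb (a - a') + pemb (b - b') * yy" by (simp add: ab ab' algebra_simps)
      have "p dvd a - a' \<and> p dvd b - b'" using s(3) J1[of "s - s'"] unfolding e inert_ideal_iff by (simp add: RR_I del: pemb_hom)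
      hence "a - a' = 0 \<and> b - b' = 0" using polys_below_dvd polys_below_diff ab ab' by blast
      thus ?thesis by (simp add: ab ab')
    qed
    show "\<exists>s\<in>?S. ge (val v) 1 (z - s)" if z: "z \<in> LF" "ge (val v) 0 z" for z
    proof -
      obtain g where g: "g \<in> RR" "ge (val v) 1 (z - g)" using residue_in_RR[OF L v inv z] by blast
      obtain A B where AB: "g = pemb A + pemb B * yy" using g by (auto elim: RR_E)
      let ?s = "pemb (A mod p) + pemb (B mod p) * yy"
      have e: "g - ?s = pemb (A - A mod p) + pemb (B - B mod p) * yy" unfolding AB by (simp add: algebra_simps)
      have "g - ?s \<in> inert_ideal p" unfolding e inert_ideal_iff using polys_below_mod(2)[OF p0] by blast
      hence "ge (val v) 1 (g - ?s)" using J1[of "g - ?s"] g by simp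
      hence "ge (val v) 1 ((z - g) + (g - ?s))" using g z by (intro ge_add[OF \<nu>]) auto
      moreover have "(z - g) + (g - ?s) = z - ?s" by simp
      ultimately have "ge (val v) 1 (z - ?s)" by (simp only:)
      thus ?thesis using polys_below_mod(1)[OF p0] by (intro bexI[of _ ?s]) auto
    qed
  qed
  also have "card ?S = card (?P \<times> ?P)" by (rule card_image) (auto simp: inj_on_def independent_eq)
  also have "\<dots> = q ^ (2 * degree p)" using card_polys_below[where 'a='a]
    by (simp add: q_def card_cartesian_product mult_2 power_add)
  finally show "card (val_ring v // res_rel v) = q ^ (2 * degree p)" .
  thus "place_deg v = 2 * degree p" by (rule place_degI)
qed

definition places_above :: "'a poly \<Rightarrow> ('a ff \<Rightarrow> int) set" where
  "places_above p = {v. is_place cc v \<and> ge (val v) 1 (pemb p)}"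

text \<open>One inert place of degree 2 deg p, one ramified place where p has value 2, or two
  conjugate places: in each case the multiplicities and degrees add up to 2 deg p, as expected for
  an extension of degree 2. The final claim lets \<open>integral_RR\<close> cancel denominators one
  prime at a time.\<close>

theorem places_over:
  assumes p: "irreducible p"
  shows "finite (places_above p)" "(\<Sum>v\<in>places_above p. val v (pemb p) * int (place_deg v)) = 2 * int (degree p)"
    and "\<And>v. v \<in> places_above p \<Longrightarrow> card (val_ring v // res_rel v) = q ^ place_deg v \<and>
      (place_deg v = degree p \<and> (\<exists>r. p dvd root_norm r \<and> center (val v) = root_ideal p r) \<or> place_deg v = 2 * degree p)"
    and "\<And>g. g \<in> RR \<Longrightarrow> (\<And>v. v \<in> places_above p \<Longrightarrow> ge (val v) (val v (pemb p)) g) \<Longrightarrow> \<exists>g'\<in>RR. g = pemb p * g'"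
proof -
  have p0: "p \<noteq> 0" using p by auto
  have P: "is_place cc v \<and> fin (val v) \<and> ge (val v) 1 (pemb p)" if "v \<in> places_above p" for v
    using that p0 fin_of_ge1[OF place_is_val, of v p] by (auto simp: places_above_def)
  have PI: "v \<in> places_above p" if "is_place cc v" "center (val v) = Q" "pemb p \<in> Q" for v Q
    using that by (auto simp: places_above_def center_def)
  have divI: "\<exists>g'\<in>RR. g = pemb p * g'" if gI: "g \<in> inert_ideal p" for g
  proof -
    obtain A B where AB: "g = pemb A + pemb B * yy" "p dvd A" "p dvd B" using gI by (auto simp: inert_ideal_def)
    obtain k where k: "A = p * k" using AB(2) by (rule dvdE)
    obtain l where l: "B = p * l" using AB(3) by (rule dvdE)
    have "g = pemb p * (pemb k + pemb l * yy)" unfolding AB k l by (simp add: algebra_simps)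
    thus ?thesis using RR_I by blast
  qed
  have *: "finite (places_above p) \<and> (\<Sum>v\<in>places_above p. val v (pemb p) * int (place_deg v)) = 2 * int (degree p) \<and>
    (\<forall>v\<in>places_above p. card (val_ring v // res_rel v) = q ^ place_deg v \<and>
      (place_deg v = degree p \<and> (\<exists>r. p dvd root_norm r \<and> center (val v) = root_ideal p r) \<or> place_deg v = 2 * degree p)) \<and>
    (\<forall>g\<in>RR. (\<forall>v\<in>places_above p. ge (val v) (val v (pemb p)) g) \<longrightarrow> g \<in> inert_ideal p)"
  proof (cases "\<exists>r. p dvd root_norm r")
    case False
    hence nor: "\<And>r. \<not> p dvd root_norm r" by blast
    note L = local_param_inert[OF p nor]
    obtain v where v: "is_place cc v" "fin (val v)" "center (val v) = inert_ideal p" "\<And>z. z \<in> LF \<Longrightarrow> z \<noteq> 0 \<Longrightarrow> val v z = local_val (inert_ideal p) (pemb p) z"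
      by (rule local_param_place[OF L], rule that)
    have vP: "v \<in> places_above p" by (rule PI[OF v(1,3)]) (simp add: inert_ideal_pemb)
    have "w = v" if "w \<in> places_above p" for w
    proof -
      have w: "is_place cc w" "fin (val w)" "ge (val w) 1 (pemb p)" using P[OF that] by auto
      show ?thesis by (rule local_param_place_unique[OF L w(1,2) center_inert[OF place_is_val[OF w(1)] w(2) p w(3) nor] v(1-3)])
    qed
    hence "places_above p = {v}" using vP by blast
    moreover have "val v (pemb p) = 1" using v(4)[of "pemb p"] p0 local_val_t[OF L] by simp
    ultimately show ?thesis using deg_inert_ideal[OF p nor v(1-3)] v(3) by (auto simp: center_def)
  next
    case True
    then obtain r where r: "p dvd root_norm r" by blast
    have r': "p dvd root_norm (- hp - r)" using r by (simp add: root_norm_conj)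
    show ?thesis
    proof (cases "p dvd 2 * r + hp")
      case True
      note L = local_param_ramified(1)[OF p r True]
      have same: "root_ideal p (- hp - r) = root_ideal p r"
      proof -
        have "p dvd A + B * (- hp - r) \<longleftrightarrow> p dvd A + B * r" for A B
        proof -
          have e: "A + B * r = (A + B * (- hp - r)) + B * (2 * r + hp)" by (simp add: algebra_simps)
          have d: "p dvd B * (2 * r + hp)" using True by (rule dvd_mult)
          show ?thesis by (subst e) (rule dvd_add_left_iff[OF d, symmetric])
        qed
        thus ?thesis unfolding root_ideal_def by simp
      qed
      obtain v where v: "is_place cc v" "fin (val v)" "center (val v) = root_ideal p r" "\<And>z. z \<in> LF \<Longrightarrow> z \<noteq> 0 \<Longrightarrow> val v z = local_val (root_ideal p r) (yy - pemb r) z"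
        by (rule local_param_place[OF L], rule that)
      have vP: "v \<in> places_above p" by (rule PI[OF v(1,3)]) (simp add: root_ideal_pemb)
      have "w = v" if "w \<in> places_above p" for w
      proof -
        have w: "is_place cc w" "fin (val w)" "ge (val w) 1 (pemb p)" using P[OF that] by auto
        have "center (val w) = root_ideal p r" using center_root[OF place_is_val[OF w(1)] w(2) p w(3) r] same by simp
        from local_param_place_unique[OF L w(1,2) this v(1-3)] show ?thesis .
      qed
      hence "places_above p = {v}" using vP by blast
      moreover have "val v (pemb p) = 2"
      proof -
        obtain u w where uw: "u \<in> RR - root_ideal p r" "w \<in> RR - root_ideal p r" "u * pemb p = (yy - pemb r) ^ 2 * w"
          using local_param_ramified(2)[OF p r True] by blast
        have "local_val (root_ideal p r) (yy - pemb r) (pemb p) = 2" by (rule local_val_eqI[OF L uw(1,2)]) (use uw(3) in simp)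
        thus ?thesis using v(4)[of "pemb p"] p0 by simp
      qed
      moreover have "g \<in> inert_ideal p" if g: "g \<in> RR" "ge (val v) 2 g" for g
      proof -
        note \<nu> = place_is_val[OF v(1)]
        obtain A B where AB: "g = pemb A + pemb B * yy" using g by (auto elim: RR_E)
        have "ge (val v) 1 g" using g ge_mono[OF \<nu>, of 2 g 1] by simp
        hence "g \<in> root_ideal p r" using v(3) g by (auto simp: center_def)
        hence d: "p dvd A + B * r" unfolding AB root_ideal_iff .
        then obtain k where k: "A + B * r = p * k" by (rule dvdE)
        \<comment> \<open>p has value 2, so subtracting the multiple A + B r of p leaves B (y - r)
          with value at least 2. The factor y - r contributes only 1, hence p divides B.\<close>
        have "ge (val v) (2 + 0) (pemb p * pemb k)"
          by (intro ge_mult[OF \<nu>] ge0_pemb[OF \<nu> v(2)]) (use \<open>val v (pemb p) = 2\<close> in \<open>auto simp: ge_def\<close>)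
        hence "ge (val v) 2 (pemb (A + B * r))" unfolding k by simp
        hence "ge (val v) 2 (g - pemb (A + B * r))" using g by (intro ge_diff[OF \<nu>]) auto
        moreover have "g - pemb (A + B * r) = pemb B * (yy - pemb r)" unfolding AB by (simp add: algebra_simps)
        ultimately have b: "ge (val v) 2 (pemb B * (yy - pemb r))" by (simp only:)
        have t0: "yy - pemb r \<noteq> 0" using t_nz[OF L] .
        have t1: "val v (yy - pemb r) = 1" using v(4)[OF _ t0] local_val_t[OF L] by simp
        have "p dvd B"
        proof (cases "B = 0")
          case False
          hence "val v (pemb B) = val v (pemb B * (yy - pemb r)) - 1"
            using v_mult[OF \<nu>, of "pemb B" "yy - pemb r"] t0 t1 by simp
          hence "ge (val v) 1 (pemb B)" using b False t0 by (auto simp: ge_def)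
          hence "pemb B \<in> root_ideal p r" using v(3) by (auto simp: center_def)
          thus ?thesis by (simp add: root_ideal_pemb)
        qed simp
        moreover from this have "p dvd A" using d by (simp add: dvd_add_left_iff)
        ultimately show ?thesis unfolding AB inert_ideal_iff by simp
      qed
      ultimately show ?thesis using deg_root_ideal[OF p r L v(1-3)] v(3) r by auto
    next
      case False
      have "2 * (- hp - r) + hp = - (2 * r + hp)" by simp
      hence F': "\<not> p dvd 2 * (- hp - r) + hp" using False by (simp only: dvd_minus_iff not_False_eq_True)
      note L = local_param_split[OF p r False] note L' = local_param_split[OF p r' F']
      obtain v where v: "is_place cc v" "fin (val v)" "center (val v) = root_ideal p r" "\<And>z. z \<in> LF \<Longrightarrow> z \<noteq> 0 \<Longrightarrow> val v z = local_val (root_ideal p r) (pemb p) z"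
        by (rule local_param_place[OF L], rule that)
      obtain v' where v': "is_place cc v'" "fin (val v')" "center (val v') = root_ideal p (- hp - r)" "\<And>z. z \<in> LF \<Longrightarrow> z \<noteq> 0 \<Longrightarrow> val v' z = local_val (root_ideal p (- hp - r)) (pemb p) z"
        by (rule local_param_place[OF L'], rule that)
      have "v \<noteq> v'"
      proof
        assume "v = v'"
        hence e: "root_ideal p r = root_ideal p (- hp - r)" using v(3) v'(3) by (simp only:)
        have "pemb (- r) + pemb 1 * yy \<in> root_ideal p r" unfolding root_ideal_iff by simp
        hence "p dvd - r + 1 * (- hp - r)" unfolding e root_ideal_iff .
        hence "p dvd - (2 * r + hp)" by (simp add: algebra_simps)
        thus False using False by (simp only: dvd_minus_iff)
      qed
      moreover have "places_above p = {v, v'}"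
      proof -
        have vP: "v \<in> places_above p" by (rule PI[OF v(1,3)]) (simp add: root_ideal_pemb)
        have vP': "v' \<in> places_above p" by (rule PI[OF v'(1,3)]) (simp add: root_ideal_pemb)
        have "w = v \<or> w = v'" if "w \<in> places_above p" for w
        proof -
          have w: "is_place cc w" "fin (val w)" "ge (val w) 1 (pemb p)" using P[OF that] by auto
          from center_root[OF place_is_val[OF w(1)] w(2) p w(3) r] show ?thesis
          proof
            assume "center (val w) = root_ideal p r"
            from local_param_place_unique[OF L w(1,2) this v(1-3)] show ?thesis by blast
          next
            assume "center (val w) = root_ideal p (- hp - r)"
            from local_param_place_unique[OF L' w(1,2) this v'(1-3)] show ?thesis by blast
          qed
        qed
        thus ?thesis using vP vP' by blast
      qed
      moreover have "val v (pemb p) = 1" using v(4)[of "pemb p"] p0 local_val_t[OF L] by simp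
      moreover have "val v' (pemb p) = 1" using v'(4)[of "pemb p"] p0 local_val_t[OF L'] by simp
      moreover have "g \<in> inert_ideal p" if g: "g \<in> RR" "ge (val v) 1 g" "ge (val v') 1 g" for g
      proof -
        obtain A B where AB: "g = pemb A + pemb B * yy" using g by (auto elim: RR_E)
        have "g \<in> root_ideal p r" "g \<in> root_ideal p (- hp - r)" using v(3) v'(3) g by (auto simp: center_def)
        hence d: "p dvd A + B * r" "p dvd A + B * (- hp - r)" unfolding AB root_ideal_iff by simp_all
        \<comment> \<open>The two congruences differ by B (2 r + h), and 2 r + h is prime to p
          because the roots are distinct.\<close>
        have "p dvd (A + B * r) - (A + B * (- hp - r))" using d by (rule dvd_diff)
        also have "(A + B * r) - (A + B * (- hp - r)) = B * (2 * r + hp)" by (simp add: algebra_simps)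
        finally have "p dvd B" using False field_poly_irreducible_imp_prime[OF p] by (simp add: prime_elem_dvd_mult_iff)
        moreover from this have "p dvd A" using d(1) by (simp add: dvd_add_left_iff)
        ultimately show ?thesis unfolding AB inert_ideal_iff by simp
      qed
      ultimately show ?thesis using deg_root_ideal[OF p r L v(1-3)] deg_root_ideal[OF p r' L' v'(1-3)] v(3) v'(3) r r' by auto
    qed
  qed
  thus "finite (places_above p)" "(\<Sum>v\<in>places_above p. val v (pemb p) * int (place_deg v)) = 2 * int (degree p)" by auto
  show "card (val_ring v // res_rel v) = q ^ place_deg v \<and>
      (place_deg v = degree p \<and> (\<exists>r. p dvd root_norm r \<and> center (val v) = root_ideal p r) \<or> place_deg v = 2 * degree p)"
    if "v \<in> places_above p" for v using * that by blast
  show "\<exists>g'\<in>RR. g = pemb p * g'" if "g \<in> RR" "\<And>v. v \<in> places_above p \<Longrightarrow> ge (val v) (val v (pemb p)) g" for g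
    using * divI that by blast
qed

section \<open>The place at infinity\<close>

text \<open>For nonzero g in \<open>RR\<close> this is the pole order at infinity: conjugation fixes
  that place and x has a double pole there, so half the pole order of the norm is its
  degree.\<close>

definition norm_deg :: "'a poly fract alg_closure \<Rightarrow> nat" where
  "norm_deg g = degree (THE N. g * sg g = pemb N)"

lemma norm_deg_eq: "g * sg g = pemb N \<Longrightarrow> norm_deg g = degree N"
  unfolding norm_deg_def by simp

lemma norm_deg_formula:
  assumes "A \<noteq> 0 \<or> B \<noteq> 0"
  shows "int (norm_deg (pemb A + pemb B * yy)) =
    max (if A = 0 then 0 else 2 * int (degree A)) (if B = 0 then 0 else 2 * int (degree B) + 3)"
  using norm_degree(2)[OF assms] norm_deg_eq[OF norm_RR] by simp

lemma norm_deg_mult: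
  assumes "g \<in> RR" "g' \<in> RR" "g \<noteq> 0" "g' \<noteq> 0"
  shows "norm_deg (g * g') = norm_deg g + norm_deg g'"
proof -
  obtain N where N: "g * sg g = pemb N" "N \<noteq> 0" using RR_norm[OF assms(1,3)] .
  obtain M where M: "g' * sg g' = pemb M" "M \<noteq> 0" using RR_norm[OF assms(2,4)] .
  have "(g * g') * sg (g * g') = (g * sg g) * (g' * sg g')" using assms by (simp add: sg_mult mult_ac)
  hence "(g * g') * sg (g * g') = pemb (N * M)" unfolding N M by simp
  hence "norm_deg (g * g') = degree (N * M)" by (rule norm_deg_eq)
  thus ?thesis using norm_deg_eq[OF N(1)] norm_deg_eq[OF M(1)] N M by (simp add: degree_mult_eq)
qed

lemma norm_deg_pemb: "norm_deg (pemb C) = 2 * degree C"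
proof (cases "C = 0")
  case True thus ?thesis using norm_deg_eq[of "pemb C" 0] by simp
next
  case False
  have "norm_deg (pemb C) = degree (C * C)" by (rule norm_deg_eq) simp
  thus ?thesis using False by (simp add: degree_mult_eq)
qed

lemma degree_add_weighted:
  fixes p r :: "'b::comm_monoid_add poly" and c :: int
  assumes "0 \<le> c"
  shows "(if p + r = 0 then 0 else 2 * int (degree (p + r)) + c) \<le>
    max (if p = 0 then 0 else 2 * int (degree p) + c) (if r = 0 then 0 else 2 * int (degree r) + c)"
proof (cases "p = 0 \<or> r = 0")
  case True thus ?thesis using assms by auto
next
  case False
  have "degree (p + r) \<le> max (degree p) (degree r)" by (rule degree_add_le_max)
  thus ?thesis using False assms by (auto simp: max_def split: if_splits)
qed

lemma norm_deg_add:
  assumes "g \<in> RR" "g' \<in> RR" "g \<noteq> 0" "g' \<noteq> 0" "g + g' \<noteq> 0"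
  shows "norm_deg (g + g') \<le> max (norm_deg g) (norm_deg g')"
proof -
  obtain A B where 1: "g = pemb A + pemb B * yy" using assms RR_E by metis
  obtain C D where 2: "g' = pemb C + pemb D * yy" using assms RR_E by metis
  have 3: "g + g' = pemb (A + C) + pemb (B + D) * yy" unfolding 1 2 by (simp add: algebra_simps)
  have nz: "A \<noteq> 0 \<or> B \<noteq> 0" "C \<noteq> 0 \<or> D \<noteq> 0" "A + C \<noteq> 0 \<or> B + D \<noteq> 0"
    using assms(3-5) unfolding 3 unfolding 1 2 by (auto simp del: pemb_hom(3))
  have "int (norm_deg (g + g')) \<le> max (int (norm_deg g)) (int (norm_deg g'))"
    unfolding 3 unfolding 1 2 norm_deg_formula[OF nz(1)] norm_deg_formula[OF nz(2)] norm_deg_formula[OF nz(3)]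
    using degree_add_weighted[of 0 A C] degree_add_weighted[of 3 B D] unfolding add_0_right by linarith
  thus ?thesis by linarith
qed

text \<open>The choice runs over all ways of writing z as g / C; \<open>inf_val_eq\<close> shows
  that they agree, by multiplicativity of \<open>norm_deg\<close>.\<close>

definition inf_val :: "'a poly fract alg_closure \<Rightarrow> int" where
  "inf_val z = (SOME m. \<exists>g\<in>RR. \<exists>C. C \<noteq> 0 \<and> z = g / pemb C \<and> m = 2 * int (degree C) - int (norm_deg g))"

lemma inf_val_eq:
  assumes "g \<in> RR" "g \<noteq> 0" "C \<noteq> 0"
  shows "inf_val (g / pemb C) = 2 * int (degree C) - int (norm_deg g)"
proof -
  let ?z = "g / pemb C"
  have "\<exists>m. \<exists>g\<in>RR. \<exists>C. C \<noteq> 0 \<and> ?z = g / pemb C \<and> m = 2 * int (degree C) - int (norm_deg g)" using assms by blast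
  hence "\<exists>g\<in>RR. \<exists>C. C \<noteq> 0 \<and> ?z = g / pemb C \<and> inf_val ?z = 2 * int (degree C) - int (norm_deg g)"
    unfolding inf_val_def by (rule someI_ex)
  then obtain g' C' where 1: "g' \<in> RR" "C' \<noteq> 0" "?z = g' / pemb C'" "inf_val ?z = 2 * int (degree C') - int (norm_deg g')" by blast
  have nz: "g' \<noteq> 0" using 1 assms by auto
  have "g * pemb C' = g' * pemb C" using 1(3) assms 1(2) by (simp add: field_simps)
  hence "norm_deg (g * pemb C') = norm_deg (g' * pemb C)" by simp
  hence "norm_deg g + 2 * degree C' = norm_deg g' + 2 * degree C"
    using norm_deg_mult[of g "pemb C'"] norm_deg_mult[of g' "pemb C"] assms 1 nz by (simp add: norm_deg_pemb)
  thus ?thesis using 1(4) by linarith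
qed

lemma inf_val_RR: "g \<in> RR \<Longrightarrow> g \<noteq> 0 \<Longrightarrow> inf_val g = - int (norm_deg g)"
  using inf_val_eq[of g 1] by simp

lemma norm_deg_yy: "norm_deg yy = 3" using norm_deg_formula[of 0 1] by simp

lemma inf_val_mult:
  assumes xy: "x \<in> LF" "y \<in> LF" "x \<noteq> 0" "y \<noteq> 0"
  shows "inf_val (x * y) = inf_val x + inf_val y"
proof -
  obtain g C where g: "g \<in> RR" "C \<noteq> 0" "x = g / pemb C" using xy(1) by (rule LF_E)
  obtain g' C' where g': "g' \<in> RR" "C' \<noteq> 0" "y = g' / pemb C'" using xy(2) by (rule LF_E)
  have nz: "g \<noteq> 0" "g' \<noteq> 0" using xy g g' by auto
  have e: "x * y = (g * g') / pemb (C * C')" unfolding g g' by simp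
  show ?thesis
    unfolding e unfolding g(3) g'(3) using inf_val_eq[of "g * g'" "C * C'"] inf_val_eq[of g C] inf_val_eq[of g' C'] nz g g'
    by (simp add: norm_deg_mult degree_mult_eq del: pemb_hom)
qed

lemma is_val_inf_val: "is_val inf_val"
  unfolding is_val_def
proof (intro conjI ballI allI impI)
  fix x y assume xy: "x \<in> LF" "y \<in> LF" "x \<noteq> 0" "y \<noteq> 0"
  obtain g C where g: "g \<in> RR" "C \<noteq> 0" "x = g / pemb C" using xy(1) by (rule LF_E)
  obtain g' C' where g': "g' \<in> RR" "C' \<noteq> 0" "y = g' / pemb C'" using xy(2) by (rule LF_E)
  have nz: "g \<noteq> 0" "g' \<noteq> 0" using xy g g' by auto
  show "inf_val (x * y) = inf_val x + inf_val y" by (rule inf_val_mult[OF xy])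
  assume s: "x + y \<noteq> 0"
  define G where "G = g * pemb C'" define G' where "G' = g' * pemb C"
  define CC where "CC = C * C'"
  have CC: "CC \<noteq> 0" using g g' by (simp add: CC_def)
  have G: "G \<in> RR" "G' \<in> RR" "G \<noteq> 0" "G' \<noteq> 0" unfolding G_def G'_def using g g' nz by auto
  have ex: "x = G / pemb CC" "y = G' / pemb CC" unfolding G_def G'_def CC_def g(3) g'(3) using g g' by auto
  have es: "x + y = (G + G') / pemb CC" unfolding ex by (simp add: add_divide_distrib)
  have Gs: "G + G' \<noteq> 0" using s es by auto
  show "min (inf_val x) (inf_val y) \<le> inf_val (x + y)"
    unfolding es unfolding ex using inf_val_eq[OF G(1,3) CC] inf_val_eq[OF G(2,4) CC] inf_val_eq[OF RR_add[OF G(1,2)] Gs CC]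
      norm_deg_add[OF G Gs] by linarith
next
  fix a :: 'a assume "a \<noteq> 0"
  thus "inf_val (pemb [:a:]) = 0" using inf_val_RR[of "pemb [:a:]"] by (simp add: norm_deg_pemb)
next
  have yy0: "yy \<noteq> 0" using independent[of 0 1] by auto
  \<comment> \<open>Pole orders 2 and 3 make x / y an element of value 1.\<close>
  have v: "inf_val xx = - 2" "inf_val yy = - 3" using inf_val_RR[of xx] inf_val_RR[of yy] yy0 by (simp_all add: norm_deg_pemb norm_deg_yy)
  have "inf_val yy + inf_val (xx / yy) = inf_val xx" using inf_val_mult[of yy "xx / yy"] yy0 by simp
  thus "\<exists>t\<in>LF. t \<noteq> 0 \<and> inf_val t = 1" using v yy0 by (intro bexI[of _ "xx / yy"]) auto
qed

text \<open>A pole of x forces 2 \<nu>(y) = 3 \<nu>(x) by the Weierstrass equation, so \<nu>(x) = -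
  2 k and \<nu>(y) = - 3 k. The terms A and B y then have distinct values, of different parity as
  multiples of k, which determines \<nu> up to the factor k; normalisation gives k = 1.\<close>

lemma infinite_unique:
  assumes \<nu>: "is_val \<nu>" and nf: "\<not> fin \<nu>" and z: "z \<in> LF" "z \<noteq> 0"
  shows "\<nu> z = inf_val z"
proof -
  define \<tau> where "\<tau> = \<nu> xx"
  have neg: "\<tau> < 0" using nf by (simp add: fin_def \<tau>_def)
  have yy0: "yy \<noteq> 0" using independent[of 0 1] by auto
  have gp0: "gp \<noteq> 0" by (simp add: gp_def)
  have vg: "\<nu> (pemb gp) = 3 * \<tau>" using not_fin_pemb[OF \<nu> nf gp0] by (simp add: \<tau>_def)
  have vh: "ge \<nu> \<tau> (pemb hp)"
  proof (cases "hp = 0")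
    case False
    have "degree hp = 0 \<or> degree hp = 1" using deg_hp by linarith
    hence "int (degree hp) * \<tau> \<ge> \<tau>" using neg by auto
    thus ?thesis using not_fin_pemb[OF \<nu> nf False] by (simp add: ge_def \<tau>_def)
  qed (simp add: ge_def)
  have hy: "ge \<nu> (\<tau> + \<nu> yy) (pemb hp * yy)" by (rule ge_mult[OF \<nu>]) (use vh in \<open>auto simp: ge_def\<close>)
  have yv: "\<nu> (yy * yy) = 2 * \<nu> yy" using v_mult[OF \<nu>, of yy yy] yy0 by simp
  have gpe: "pemb gp = pemb hp * yy + yy * yy" using yy_sq by (simp add: algebra_simps)
  have lt: "\<nu> yy < \<tau>"
  proof (rule ccontr)
    assume "\<not> \<nu> yy < \<tau>"
    hence "ge \<nu> (2 * \<tau>) (pemb hp * yy)" "ge \<nu> (2 * \<tau>) (yy * yy)"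
      using ge_mono[OF \<nu> hy, of "2 * \<tau>"] yv by (auto simp: ge_def)
    hence "ge \<nu> (2 * \<tau>) (pemb gp)" unfolding gpe by (intro ge_add[OF \<nu>]) auto
    thus False using vg neg gp0 by (simp add: ge_def)
  qed
  have "ge \<nu> (\<nu> (yy * yy) + 1) (pemb hp * yy)" using ge_mono[OF \<nu> hy] lt yv by simp
  hence "\<nu> (pemb gp) = 2 * \<nu> yy" unfolding gpe using v_add_eq(2)[OF \<nu>, of "pemb hp * yy" "yy * yy"] yy0 yv by simp
  hence ty: "2 * \<nu> yy = 3 * \<tau>" using vg by simp
  hence "even (3 * \<tau>)" by (metis dvd_triv_left)
  hence "even \<tau>" by simp
  then obtain j where "\<tau> = 2 * j" by (rule evenE)
  define k where "k = - j"
  have k: "\<tau> = - 2 * k" "\<nu> yy = - 3 * k" using ty \<open>\<tau> = 2 * j\<close> by (simp_all add: k_def)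
  have kpos: "k > 0" using neg k by simp
  have gR: "\<nu> g = - k * int (norm_deg g)" if g: "g \<in> RR" "g \<noteq> 0" for g
  proof -
    obtain A B where AB: "g = pemb A + pemb B * yy" using g RR_E by metis
    have nz: "A \<noteq> 0 \<or> B \<noteq> 0" using g AB by auto
    have vA: "\<nu> (pemb A) = - k * (2 * int (degree A))" if "A \<noteq> 0"
      using not_fin_pemb[OF \<nu> nf that] k by (simp add: \<tau>_def[symmetric])
    have vB: "\<nu> (pemb B * yy) = - k * (2 * int (degree B) + 3)" if "B \<noteq> 0"
      using not_fin_pemb[OF \<nu> nf that] v_mult[OF \<nu>, of "pemb B" yy] yy0 that k
      by (simp add: \<tau>_def[symmetric] algebra_simps)
    show ?thesis
    proof (cases "A = 0 \<or> B = 0")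
      case True
      thus ?thesis using nz vA vB norm_deg_formula[OF nz] AB by auto
    next
      case False
      hence A0: "A \<noteq> 0" and B0: "B \<noteq> 0" by auto
      have ndv: "int (norm_deg g) = max (2 * int (degree A)) (2 * int (degree B) + 3)"
        using norm_deg_formula[OF nz] AB A0 B0 by simp
      have "2 * int (degree A) \<noteq> 2 * int (degree B) + 3" by presburger
      then consider "2 * int (degree A) < 2 * int (degree B) + 3" | "2 * int (degree B) + 3 < 2 * int (degree A)" by linarith
      thus ?thesis
      proof cases
        case 1
        hence "k * (2 * int (degree A)) < k * (2 * int (degree B) + 3)" using kpos by simp
        hence "ge \<nu> (\<nu> (pemb B * yy) + 1) (pemb A)" using vA[OF A0] vB[OF B0] by (simp add: ge_def)
        thus ?thesis unfolding AB using v_add_eq(2)[OF \<nu>, of "pemb A" "pemb B * yy"] vB[OF B0] yy0 B0 ndv[unfolded AB] 1 by simp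
      next
        case 2
        hence "k * (2 * int (degree B) + 3) < k * (2 * int (degree A))" using kpos by simp
        hence "ge \<nu> (\<nu> (pemb A) + 1) (pemb B * yy)" using vA[OF A0] vB[OF B0] by (simp add: ge_def)
        hence "\<nu> (pemb B * yy + pemb A) = \<nu> (pemb A)" using v_add_eq(2)[OF \<nu>, of "pemb B * yy" "pemb A"] A0 by simp
        thus ?thesis unfolding AB using vA[OF A0] ndv[unfolded AB] 2 by (simp add: add.commute)
      qed
    qed
  qed
  have L: "\<nu> z = k * inf_val z" if zz: "z \<in> LF" "z \<noteq> 0" for z
  proof -
    obtain g C where g: "g \<in> RR" "C \<noteq> 0" "z = g / pemb C" using zz(1) by (rule LF_E)
    have g0: "g \<noteq> 0" using g zz by auto
    have "\<nu> z = \<nu> g - \<nu> (pemb C)" unfolding g(3) by (rule v_divide[OF \<nu>]) (use g g0 in auto)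
    also have "\<dots> = k * inf_val z" unfolding g(3) inf_val_eq[OF g(1) g0 g(2)] using gR[OF g(1) g0] gR[of "pemb C"] g(2)
      by (simp add: norm_deg_pemb algebra_simps)
    finally show ?thesis .
  qed
  obtain s where s: "s \<in> LF" "s \<noteq> 0" "\<nu> s = 1" using \<nu> unfolding is_val_def by blast
  have "k * inf_val s = 1" using L[OF s(1,2)] s(3) by simp
  hence "k = 1" using kpos by (simp add: zmult_eq_1_iff)
  thus ?thesis using L[OF z] by simp
qed

definition inf_place :: "'a ff \<Rightarrow> int" where
  "inf_place = (SOME v. is_place cc v \<and> (\<forall>z\<in>LF. z \<noteq> 0 \<longrightarrow> val v z = inf_val z))"

lemma inf_place: "is_place cc inf_place" "z \<in> LF \<Longrightarrow> z \<noteq> 0 \<Longrightarrow> val inf_place z = inf_val z"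
proof -
  have "\<exists>v. is_place cc v \<and> (\<forall>z\<in>LF. z \<noteq> 0 \<longrightarrow> val v z = inf_val z)"
    using place_of_is_val[OF is_val_inf_val] by metis
  hence *: "is_place cc inf_place \<and> (\<forall>z\<in>LF. z \<noteq> 0 \<longrightarrow> val inf_place z = inf_val z)"
    unfolding inf_place_def by (rule someI_ex)
  thus "is_place cc inf_place" "z \<in> LF \<Longrightarrow> z \<noteq> 0 \<Longrightarrow> val inf_place z = inf_val z" by blast+
qed

lemma inf_place_xx: "val inf_place xx = - 2" using inf_place(2)[of xx] inf_val_RR[of xx] by (simp add: norm_deg_pemb)

lemma inf_place_not_fin: "\<not> fin (val inf_place)" using inf_place_xx by (simp add: fin_def)

lemma inf_place_unique: assumes "is_place cc v" "\<not> fin (val v)" shows "v = inf_place"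
  by (rule place_eqI[OF assms(1) inf_place(1)])
    (use infinite_unique[OF place_is_val[OF assms(1)] assms(2)] inf_place(2) in simp)

lemma place_cases:
  assumes "is_place cc v"
  obtains "v = inf_place" | p where "irreducible p" "v \<in> places_above p" "fin (val v)"
proof (cases "fin (val v)")
  case True
  obtain p where "irreducible p" "ge (val v) 1 (pemb p)" using exists_prime[OF place_is_val[OF assms] True] by blast
  thus ?thesis using that(2) True assms by (auto simp: places_above_def)
next
  case False thus ?thesis using inf_place_unique assms that(1) by blast
qed

text \<open>In an element (A + B y) / C of value 0 the term B y has odd pole order and cannot lead.
  So A and C have equal degree, and subtracting the quotient of their leading coefficients makes the
  value positive: the residue field is K.\<close>

lemma card_quot_inf_place: "card (val_ring inf_place // res_rel inf_place) = q ^ 1" "place_deg inf_place = 1"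
proof -
  note \<nu> = place_is_val[OF inf_place(1)]
  let ?S = "pemb ` (polys_below 1 :: 'a poly set)"
  have p1: "p \<in> polys_below 1 \<longleftrightarrow> (\<exists>a. p = [:a:])" for p :: "'a poly"
  proof
    assume "p \<in> polys_below 1"
    hence "degree p = 0" unfolding polys_below_def by (metis (mono_tags, lifting) leading_coeff_0_iff mem_Collect_eq degree_0 less_one linorder_not_less)
    thus "\<exists>a. p = [:a:]" by (metis degree_eq_zeroE)
  next
    assume "\<exists>a. p = [:a:]" thus "p \<in> polys_below 1" by (auto simp: polys_below_def coeff_pCons split: nat.splits)
  qed
  have "card (val_ring inf_place // res_rel inf_place) = card ?S"
  proof (rule card_residues[OF inf_place(1)])
    show "?S \<subseteq> LF" by auto
    show "ge (val inf_place) 0 s" if "s \<in> ?S" for s using that p1 ge_const[OF \<nu>] by auto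
    show "s = s'" if s: "s \<in> ?S" "s' \<in> ?S" "ge (val inf_place) 1 (s - s')" for s s'
    proof -
      obtain a b where ab: "s = pemb [:a:]" "s' = pemb [:b:]" using s p1 by auto
      have "s - s' = pemb [:a - b:]" unfolding ab by (simp flip: pemb_hom)
      hence "ge (val inf_place) 1 (pemb [:a - b:])" using s(3) by (simp only:)
      hence "a = b" using v_const[OF \<nu>, of "a - b"] by (cases "a = b") (simp_all add: ge_def)
      thus ?thesis by (simp add: ab)
    qed
    show "\<exists>s\<in>?S. ge (val inf_place) 1 (z - s)" if z: "z \<in> LF" "ge (val inf_place) 0 z" for z
    proof (cases "ge (val inf_place) 1 z")
      case True
      have "(0 :: 'a poly) \<in> polys_below 1" by (simp add: polys_below_def)
      thus ?thesis using True by (intro bexI[of _ "pemb 0"]) auto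
    next
      case False
      hence z0: "z \<noteq> 0" "val inf_place z = 0" using z by (auto simp: ge_def)
      obtain g C where g: "g \<in> RR" "C \<noteq> 0" "z = g / pemb C" using z(1) by (rule LF_E)
      have g0: "g \<noteq> 0" using g z0 by auto
      have ndg: "norm_deg g = 2 * degree C" using z0 inf_place(2)[OF z(1) z0(1)] inf_val_eq[OF g(1) g0 g(2)] g(3) by simp
      obtain A B where AB: "g = pemb A + pemb B * yy" using g RR_E by metis
      have nz: "A \<noteq> 0 \<or> B \<noteq> 0" using g0 AB by auto
      have f: "2 * int (degree C) = max (if A = 0 then 0 else 2 * int (degree A)) (if B = 0 then 0 else 2 * int (degree B) + 3)"
        using norm_deg_formula[OF nz] ndg AB by simp
      have Bl: "B = 0 \<or> 2 * int (degree B) + 3 < 2 * int (degree C)"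
      proof (cases "B = 0")
        case False
        hence "2 * int (degree B) + 3 \<le> 2 * int (degree C)" using f by simp
        moreover have "2 * int (degree B) + 3 \<noteq> 2 * int (degree C)" by presburger
        ultimately show ?thesis by simp
      qed simp
      have A: "A \<noteq> 0" "degree A = degree C"
      proof -
        show "A \<noteq> 0"
        proof
          assume "A = 0"
          thus False using f nz Bl by auto
        qed
        thus "degree A = degree C" using f Bl by (auto split: if_splits simp: max_def)
      qed
      define a where "a = lead_coeff A / lead_coeff C"
      define A' where "A' = A - smult a C"
      have A': "A' = 0 \<or> degree A' < degree C"
      proof (cases "degree C = 0")
        case True
        then obtain x y where "A = [:x:]" "C = [:y:]" using A by (metis degree_eq_zeroE)
        thus ?thesis using g(2) unfolding A'_def a_def by simp
      next
        case False
        have "coeff A' (degree C) = 0" unfolding A'_def a_def using g(2) by (simp add: A(2))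
        moreover have "degree A' \<le> degree C" unfolding A'_def using A
          by (intro degree_diff_le) (auto intro: degree_smult_le)
        ultimately show ?thesis using False by (metis leading_coeff_0_iff le_neq_implies_less)
      qed
      have e: "z - pemb [:a:] = (pemb A' + pemb B * yy) / pemb C"
      proof -
        have "pemb (smult a C) = pemb [:a:] * pemb C" by (simp flip: pemb_hom)
        thus ?thesis unfolding g(3) AB A'_def using g(2) by (simp add: diff_divide_distrib add_divide_distrib)
      qed
      have "ge (val inf_place) 1 (z - pemb [:a:])"
      proof (cases "z - pemb [:a:] = 0")
        case False
        hence nn: "pemb A' + pemb B * yy \<noteq> 0" using e by auto
        hence nz': "A' \<noteq> 0 \<or> B \<noteq> 0" by auto
        have "int (norm_deg (pemb A' + pemb B * yy)) < 2 * int (degree C)"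
          unfolding norm_deg_formula[OF nz'] using A' Bl nz' by auto
        hence "inf_val (z - pemb [:a:]) \<ge> 1" unfolding e using inf_val_eq[OF RR_I nn g(2)] by simp
        thus ?thesis using inf_place(2)[of "z - pemb [:a:]"] False z(1) by (simp add: ge_def)
      qed (simp add: ge_def)
      thus ?thesis using p1 by (intro bexI[of _ "pemb [:a:]"]) auto
    qed
  qed
  also have "card ?S = card (polys_below 1 :: 'a poly set)" by (rule card_image) (auto simp: inj_on_def)
  also have "\<dots> = q ^ 1" using card_polys_below[of 1, where 'a='a] by (simp add: q_def)
  finally show "card (val_ring inf_place // res_rel inf_place) = q ^ 1" .
  thus "place_deg inf_place = 1" by (rule place_degI)
qed

lemma card_quot: assumes "is_place cc v" shows "card (val_ring v // res_rel v) = q ^ place_deg v"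
  using assms
proof (rule place_cases)
  assume "v = inf_place" thus ?thesis using card_quot_inf_place by simp
next
  fix p assume "irreducible p" "v \<in> places_above p" thus ?thesis using places_over(3) by blast
qed

lemma place_deg_pos: assumes "is_place cc v" shows "place_deg v > 0"
  using assms
proof (rule place_cases)
  assume "v = inf_place" thus ?thesis using card_quot_inf_place by simp
next
  fix p assume "irreducible p" "v \<in> places_above p" thus ?thesis using places_over(3)[of p v] irreducible_poly_degree_pos[of p] by auto
qed

section \<open>Principal divisors have degree zero\<close>

definition supp :: "'a poly fract alg_closure \<Rightarrow> ('a ff \<Rightarrow> int) set" where
  "supp z = {v. is_place cc v \<and> val v z \<noteq> 0}"

definition principal_deg :: "'a poly fract alg_closure \<Rightarrow> int" where
  "principal_deg z = (\<Sum>v\<in>supp z. val v z * int (place_deg v))"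

lemma principal_deg_superset:
  assumes "finite U" "supp z \<subseteq> U" "\<And>v. v \<in> U \<Longrightarrow> is_place cc v"
  shows "principal_deg z = (\<Sum>v\<in>U. val v z * int (place_deg v))"
  unfolding principal_deg_def by (rule sum.mono_neutral_left) (use assms in \<open>auto simp: supp_def\<close>)

lemma supp_mult: "z \<in> LF \<Longrightarrow> w \<in> LF \<Longrightarrow> z \<noteq> 0 \<Longrightarrow> w \<noteq> 0 \<Longrightarrow> supp (z * w) \<subseteq> supp z \<union> supp w"
  unfolding supp_def using v_mult[OF place_is_val] by auto

lemma principal_deg_mult:
  assumes "z \<in> LF" "w \<in> LF" "z \<noteq> 0" "w \<noteq> 0" "finite (supp z)" "finite (supp w)"
  shows "principal_deg (z * w) = principal_deg z + principal_deg w"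
proof -
  let ?U = "supp z \<union> supp w"
  have U: "finite ?U" "\<And>v. v \<in> ?U \<Longrightarrow> is_place cc v" using assms by (auto simp: supp_def)
  have "principal_deg (z * w) = (\<Sum>v\<in>?U. val v (z * w) * int (place_deg v))"
    by (rule principal_deg_superset) (use U supp_mult assms in auto)
  also have "\<dots> = (\<Sum>v\<in>?U. val v z * int (place_deg v) + val v w * int (place_deg v))"
    by (rule sum.cong) (use U v_mult[OF place_is_val] assms in \<open>auto simp: algebra_simps\<close>)
  also have "\<dots> = principal_deg z + principal_deg w"
    using principal_deg_superset[of ?U z] principal_deg_superset[of ?U w] U by (simp add: sum.distrib)
  finally show ?thesis .
qed

text \<open>For an irreducible r the zeros contribute 2 deg r by \<open>places_over\<close>, and the
  only pole, at infinity, has order 2 deg r. The rest is multiplicativity.\<close>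

lemma principal_deg_poly:
  assumes "p \<noteq> 0" shows "finite (supp (pemb p))" "principal_deg (pemb p) = 0"
proof -
  have "finite (supp (pemb p)) \<and> principal_deg (pemb p) = 0"
    using assms
  proof (induction "degree p" arbitrary: p rule: less_induct)
    case less
    show ?case
    proof (cases "degree p = 0")
      case True
      then obtain a where a: "p = [:a:]" by (rule degree_eq_zeroE)
      hence "supp (pemb p) = {}" unfolding supp_def using v_const[OF place_is_val] less.prems by auto
      thus ?thesis by (simp add: principal_deg_def)
    next
      case False
      then obtain r M where r: "irreducible r" "p = r * M"
        using exists_irreducible_divisor[of p] unfolding dvd_def by blast
      have nz: "r \<noteq> 0" "M \<noteq> 0" using r less.prems by auto
      have "degree M < degree p" using r nz irreducible_poly_degree_pos[OF r(1)] by (simp add: degree_mult_eq)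
      hence M: "finite (supp (pemb M))" "principal_deg (pemb M) = 0" using less.hyps nz by blast+
      have npinf: "inf_place \<notin> places_above r" using fin_of_ge1[OF place_is_val[OF inf_place(1)], of r] nz inf_place_not_fin by (auto simp: places_above_def)
      have sub: "supp (pemb r) \<subseteq> insert inf_place (places_above r)"
      proof
        fix v assume "v \<in> supp (pemb r)"
        hence v: "is_place cc v" "val v (pemb r) \<noteq> 0" by (auto simp: supp_def)
        show "v \<in> insert inf_place (places_above r)"
        proof (cases "fin (val v)")
          case True
          thus ?thesis using ge0_pemb[OF place_is_val[OF v(1)] True, of r] v nz by (auto simp: places_above_def ge_def)
        next
          case False thus ?thesis using inf_place_unique v by blast
        qed
      qed
      have fr: "finite (supp (pemb r))" using sub places_over(1)[OF r(1)] finite_subset by blast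
      have vp: "val inf_place (pemb r) = - 2 * int (degree r)"
        using not_fin_pemb[OF place_is_val[OF inf_place(1)] inf_place_not_fin nz(1)] inf_place_xx by simp
      have "principal_deg (pemb r) = (\<Sum>v\<in>insert inf_place (places_above r). val v (pemb r) * int (place_deg v))"
        by (rule principal_deg_superset) (use sub places_over(1)[OF r(1)] inf_place(1) in \<open>auto simp: places_above_def\<close>)
      also have "\<dots> = 0" using npinf places_over(1,2)[OF r(1)] vp card_quot_inf_place by simp
      finally have "principal_deg (pemb r) = 0" .
      moreover have "supp (pemb p) \<subseteq> supp (pemb r) \<union> supp (pemb M)" unfolding r(2) pemb_hom
        by (rule supp_mult) (use nz in auto)
      ultimately show ?thesis using fr M principal_deg_mult[of "pemb r" "pemb M"] nz finite_subset unfolding r(2) pemb_hom by auto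
    qed
  qed
  thus "finite (supp (pemb p))" "principal_deg (pemb p) = 0" by auto
qed

text \<open>The action of conjugation on places; it serves to show that a function and its conjugate
  have divisors of the same degree.\<close>

definition conj_place :: "('a ff \<Rightarrow> int) \<Rightarrow> 'a ff \<Rightarrow> int" where
  "conj_place v = (\<lambda>f. v (iemb (sg (emb f))))"

lemma val_conj_place: "z \<in> LF \<Longrightarrow> val (conj_place v) z = val v (sg z)"
  by (simp add: conj_place_def val_def)

lemma conj_place_involutive: "conj_place (conj_place v) = v"
proof
  fix f show "conj_place (conj_place v) f = v f" by (simp add: conj_place_def)
qed

lemma is_place_conj_place: assumes "is_place cc v" shows "is_place cc (conj_place v)"
proof -
  note \<nu> = place_is_val[OF assms]
  have z: "v fzero = 0" using assms by (simp add: is_place_iff)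
  have i0: "iemb 0 = fzero" using iemb_emb[of fzero] by simp
  have "is_val (val (conj_place v))"
    unfolding is_val_def
  proof (intro conjI ballI allI impI)
    fix x y assume xy: "x \<in> LF" "y \<in> LF" "x \<noteq> 0" "y \<noteq> 0"
    show "val (conj_place v) (x * y) = val (conj_place v) x + val (conj_place v) y"
      using v_mult[OF \<nu>, of "sg x" "sg y"] xy by (simp add: val_conj_place sg_mult)
    assume s: "x + y \<noteq> 0"
    have "sg x + sg y \<noteq> 0" using s xy sg_eq_0_iff[of "x + y"] by (simp add: sg_add)
    thus "min (val (conj_place v) x) (val (conj_place v) y) \<le> val (conj_place v) (x + y)"
      using \<nu> xy unfolding is_val_def by (simp add: val_conj_place sg_add)
  next
    fix a :: 'a assume "a \<noteq> 0"
    thus "val (conj_place v) (pemb [:a:]) = 0" using v_const[OF \<nu>] by (simp add: val_conj_place)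
  next
    obtain s where "s \<in> LF" "s \<noteq> 0" "val v s = 1" using \<nu> unfolding is_val_def by blast
    thus "\<exists>t\<in>LF. t \<noteq> 0 \<and> val (conj_place v) t = 1" by (intro bexI[of _ "sg s"]) (auto simp: val_conj_place)
  qed
  moreover have "conj_place v fzero = 0" by (simp add: conj_place_def i0 z)
  ultimately show ?thesis by (simp add: is_place_iff)
qed

text \<open>Conjugation maps the residue classes of one place bijectively to those of the
  other.\<close>

lemma place_deg_conj_place: assumes v: "is_place cc v" shows "place_deg (conj_place v) = place_deg v"
proof -
  note \<nu> = place_is_val[OF v]
  note \<mu> = place_is_val[OF is_place_conj_place[OF v]]
  have vr: "f \<in> val_ring w \<longleftrightarrow> ge (val w) 0 (emb f)" for w and f :: "'a ff"
    by (auto simp: val_ring_def ge_def)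
  have rr: "(f, g) \<in> res_rel w \<longleftrightarrow> f \<in> val_ring w \<and> g \<in> val_ring w \<and> ge (val w) 1 (emb f - emb g)" for w and f g :: "'a ff"
  proof -
    have "f = g \<or> w (fsub f g) > 0 \<longleftrightarrow> ge (val w) 1 (emb (fsub f g))"
    proof (cases "f = g")
      case True thus ?thesis by (simp add: ge_def emb_sub del: emb_eq_0_iff)
    next
      case False
      hence "emb (fsub f g) \<noteq> 0" by (simp add: emb_sub del: emb_eq_0_iff)
      thus ?thesis using False by (auto simp: ge_def)
    qed
    thus ?thesis unfolding res_rel_def by (auto simp: emb_sub)
  qed
  define c where "c f = iemb (sg (emb f))" for f
  have ec: "emb (c f) = sg (emb f)" for f by (simp add: c_def)
  have cc': "c (c f) = f" for f by (simp add: c_def)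
  have gec: "ge (val (conj_place w)) n z \<longleftrightarrow> ge (val w) n (sg z)" if "z \<in> LF" for w n z
    using that by (simp add: ge_def val_conj_place)
  have vrc: "f \<in> val_ring (conj_place v) \<longleftrightarrow> c f \<in> val_ring v" for f by (simp add: vr gec ec)
  have sgd: "sg (emb f - emb g) = sg (emb f) - sg (emb g)" for f g
  proof -
    have "sg (emb f) = sg (emb f - emb g) + sg (emb g)" using sg_add[of "emb f - emb g" "emb g"] by simp
    thus ?thesis by simp
  qed
  have rrc: "(f, g) \<in> res_rel (conj_place v) \<longleftrightarrow> (c f, c g) \<in> res_rel v" for f g
    unfolding rr vrc by (simp add: gec ec sgd)
  have im: "res_rel v `` {c f} = c ` (res_rel (conj_place v) `` {f})" for f
  proof (intro equalityI subsetI)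
    fix g assume "g \<in> res_rel v `` {c f}"
    hence "(c f, c (c g)) \<in> res_rel v" by (simp add: cc')
    hence "c g \<in> res_rel (conj_place v) `` {f}" using rrc[of f "c g"] by simp
    hence "c (c g) \<in> c ` (res_rel (conj_place v) `` {f})" by (rule imageI)
    thus "g \<in> c ` (res_rel (conj_place v) `` {f})" by (simp add: cc')
  next
    fix g assume "g \<in> c ` (res_rel (conj_place v) `` {f})"
    thus "g \<in> res_rel v `` {c f}" using rrc by blast
  qed
  have "bij_betw (\<lambda>Z. c ` Z) (val_ring (conj_place v) // res_rel (conj_place v)) (val_ring v // res_rel v)"
    unfolding bij_betw_def
  proof
    have "inj c" using cc' by (metis injI)
    thus "inj_on (\<lambda>Z. c ` Z) (val_ring (conj_place v) // res_rel (conj_place v))" by (simp add: inj_on_def inj_image_eq_iff)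
    show "(\<lambda>Z. c ` Z) ` (val_ring (conj_place v) // res_rel (conj_place v)) = val_ring v // res_rel v"
    proof (intro equalityI subsetI)
      fix Y assume "Y \<in> (\<lambda>Z. c ` Z) ` (val_ring (conj_place v) // res_rel (conj_place v))"
      then obtain Z where Z: "Z \<in> val_ring (conj_place v) // res_rel (conj_place v)" "Y = c ` Z" by blast
      obtain f where f: "f \<in> val_ring (conj_place v)" "Z = res_rel (conj_place v) `` {f}" using Z(1) by (rule quotientE)
      have "Y = res_rel v `` {c f}" unfolding Z(2) f(2) im ..
      moreover have "c f \<in> val_ring v" using f(1) vrc[of f] by simp
      ultimately show "Y \<in> val_ring v // res_rel v" using quotientI by metis
    next
      fix Y assume "Y \<in> val_ring v // res_rel v"
      then obtain f where f: "f \<in> val_ring v" "Y = res_rel v `` {f}" by (rule quotientE)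
      have Y: "Y = c ` (res_rel (conj_place v) `` {c f})" using im[of "c f"] f(2) by (simp add: cc')
      have "c f \<in> val_ring (conj_place v)" using f(1) vrc[of "c f"] by (simp add: cc')
      hence "res_rel (conj_place v) `` {c f} \<in> val_ring (conj_place v) // res_rel (conj_place v)" by (rule quotientI)
      with Y show "Y \<in> (\<lambda>Z. c ` Z) ` (val_ring (conj_place v) // res_rel (conj_place v))" by (rule image_eqI)
    qed
  qed
  hence "card (val_ring (conj_place v) // res_rel (conj_place v)) = q ^ place_deg v"
    unfolding card_quot[OF v, symmetric] by (rule bij_betw_same_card)
  thus ?thesis by (rule place_degI)
qed

lemma supp_sg: assumes "z \<in> LF" shows "supp (sg z) = conj_place ` supp z"
proof (intro equalityI subsetI)
  fix v assume "v \<in> supp (sg z)"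
  hence "conj_place v \<in> supp z" using assms is_place_conj_place by (auto simp: supp_def val_conj_place)
  hence "conj_place (conj_place v) \<in> conj_place ` supp z" by (rule imageI)
  thus "v \<in> conj_place ` supp z" by (simp only: conj_place_involutive)
next
  fix v assume "v \<in> conj_place ` supp z"
  then obtain w where "w \<in> supp z" "v = conj_place w" by blast
  thus "v \<in> supp (sg z)" using assms is_place_conj_place by (auto simp: supp_def val_conj_place)
qed

lemma principal_deg_sg: assumes "z \<in> LF" shows "principal_deg (sg z) = principal_deg z"
proof -
  have inj: "inj_on conj_place (supp z)" using conj_place_involutive by (metis inj_on_def)
  have "principal_deg (sg z) = (\<Sum>v\<in>supp z. val (conj_place v) (sg z) * int (place_deg (conj_place v)))"
    unfolding principal_deg_def supp_sg[OF assms] by (simp add: sum.reindex[OF inj])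
  also have "\<dots> = principal_deg z" unfolding principal_deg_def
    by (rule sum.cong) (use assms in \<open>auto simp: supp_def val_conj_place place_deg_conj_place\<close>)
  finally show ?thesis .
qed

text \<open>For g in \<open>RR\<close> twice the degree of its divisor is the degree of the divisor
  of its norm, a polynomial. At a finite place g and its conjugate have nonnegative values, so the
  support of g lies in that of the norm, apart from infinity.\<close>

theorem degree_zero:
  assumes z: "z \<in> LF" "z \<noteq> 0" shows "finite (supp z)" "principal_deg z = 0"
proof -
  have RRc: "finite (supp g) \<and> principal_deg g = 0" if g: "g \<in> RR" "g \<noteq> 0" for g
  proof -
    obtain N where N: "g * sg g = pemb N" "N \<noteq> 0" using RR_norm[OF g] .
    have sub: "supp g \<subseteq> insert inf_place (supp (pemb N))"
    proof
      fix v assume "v \<in> supp g"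
      hence v: "is_place cc v" "val v g \<noteq> 0" by (auto simp: supp_def)
      show "v \<in> insert inf_place (supp (pemb N))"
      proof (cases "fin (val v)")
        case True
        note G = ge0_RR[OF place_is_val[OF v(1)] True]
        have "val v g \<ge> 0" "val v (sg g) \<ge> 0" using G[of g] G[of "sg g"] g by (auto simp: ge_def)
        moreover have "val v (pemb N) = val v g + val v (sg g)"
          unfolding N(1)[symmetric] by (rule v_mult[OF place_is_val[OF v(1)]]) (use g in auto)
        ultimately show ?thesis using v by (auto simp: supp_def)
      next
        case False thus ?thesis using inf_place_unique v by blast
      qed
    qed
    have f: "finite (supp g)" using finite_subset[OF sub] principal_deg_poly(1)[OF N(2)] by simp
    hence f': "finite (supp (sg g))" using g by (simp add: supp_sg)
    have "principal_deg (pemb N) = principal_deg g + principal_deg (sg g)" unfolding N(1)[symmetric]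
      by (rule principal_deg_mult) (use g f f' in auto)
    thus ?thesis using principal_deg_sg[of g] principal_deg_poly(2)[OF N(2)] g f by simp
  qed
  obtain g C where g: "g \<in> RR" "C \<noteq> 0" "z = g / pemb C" using z(1) by (rule LF_E)
  have g0: "g \<noteq> 0" using g z by auto
  have "supp z \<subseteq> supp g \<union> supp (pemb C)"
  proof
    fix v assume "v \<in> supp z"
    hence v: "is_place cc v" "val v z \<noteq> 0" by (auto simp: supp_def)
    have "val v z = val v g - val v (pemb C)" unfolding g(3) by (rule v_divide[OF place_is_val[OF v(1)]]) (use g g0 in auto)
    thus "v \<in> supp g \<union> supp (pemb C)" using v by (auto simp: supp_def)
  qed
  thus f: "finite (supp z)" using RRc[OF g(1) g0] principal_deg_poly(1)[OF g(2)] finite_subset by blast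
  have "principal_deg (z * pemb C) = principal_deg z + principal_deg (pemb C)" by (rule principal_deg_mult) (use z g f principal_deg_poly in auto)
  moreover have "z * pemb C = g" using g by simp
  ultimately show "principal_deg z = 0" using RRc[OF g(1) g0] principal_deg_poly(2)[OF g(2)] by simp
qed

section \<open>The Riemann inequality\<close>

definition residue_class :: "('a ff \<Rightarrow> int) \<Rightarrow> 'a poly fract alg_closure \<Rightarrow> 'a ff set" where
  "residue_class v z = res_rel v `` {iemb z}"

lemma residue_class:
  assumes v: "is_place cc v" and z: "z \<in> LF" "ge (val v) 0 z"
  shows "residue_class v z \<in> val_ring v // res_rel v"
    and "w \<in> LF \<Longrightarrow> ge (val v) 0 w \<Longrightarrow> residue_class v z = residue_class v w \<Longrightarrow> ge (val v) 1 (w - z)"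
proof -
  note \<nu> = place_is_val[OF v]
  have vr: "iemb w \<in> val_ring v" if "w \<in> LF" "ge (val v) 0 w" for w
  proof (cases "w = 0")
    case True thus ?thesis using iemb_emb[of fzero] by (simp add: val_ring_def)
  next
    case False
    hence "0 \<le> val v w" using that by (simp add: ge_def)
    thus ?thesis by (simp add: val_ring_def val_def)
  qed
  show "residue_class v z \<in> val_ring v // res_rel v"
    unfolding residue_class_def by (rule quotientI) (rule vr[OF z])
  assume w: "w \<in> LF" "ge (val v) 0 w" and e: "residue_class v z = residue_class v w"
  have "(iemb z, iemb z) \<in> res_rel v" using vr[OF z] by (simp add: res_rel_def)
  hence "iemb z \<in> residue_class v z" by (simp add: residue_class_def)
  hence "iemb z \<in> residue_class v w" using e by simp
  hence "(iemb w, iemb z) \<in> res_rel v" by (simp add: residue_class_def)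
  hence "iemb w = iemb z \<or> v (fsub (iemb w) (iemb z)) > 0" by (simp add: res_rel_def)
  thus "ge (val v) 1 (w - z)"
  proof
    assume "iemb w = iemb z"
    hence "w = z" using w z by (metis emb_iemb)
    thus ?thesis by (simp add: ge_def)
  next
    assume p: "v (fsub (iemb w) (iemb z)) > 0"
    have "val v (emb (fsub (iemb w) (iemb z))) = v (fsub (iemb w) (iemb z))" by simp
    moreover have "emb (fsub (iemb w) (iemb z)) = w - z" using w z by (simp add: emb_sub)
    ultimately show ?thesis using p by (simp add: ge_def)
  qed
qed

lemma finite_quot: "is_place cc v \<Longrightarrow> finite (val_ring v // res_rel v)"
  using card_quot[of v] q_gt_1 by (metis card.infinite power_not_zero not_one_less_zero)

text \<open>After scaling by a power of a uniformiser, M maps to the residue classes of v. Elements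
  with the same image differ by an element of the next vanishing stage, and there are q^(deg v)
  classes: the index of that stage is bounded by counting.\<close>

lemma card_vanishing_step:
  assumes v: "is_place cc v" and M: "finite M" "M \<subseteq> LF" "\<And>x y. x \<in> M \<Longrightarrow> y \<in> M \<Longrightarrow> x - y \<in> M"
    and n: "\<And>x. x \<in> M \<Longrightarrow> ge (val v) n x"
  shows "card M \<le> card {x \<in> M. ge (val v) (n + 1) x} * q ^ place_deg v"
proof -
  note \<nu> = place_is_val[OF v]
  obtain t where t: "t \<in> LF" "t \<noteq> 0" "val v t = 1" using \<nu> unfolding is_val_def by blast
  define s where "s = t powi (- n)"
  have s: "s \<in> LF" "s \<noteq> 0" "val v s = - n" unfolding s_def using t v_powi[OF \<nu>, of t "- n"] by (auto simp: power_int_eq_0_iff)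
  define \<phi> where "\<phi> x = residue_class v (x * s)" for x
  have g0: "ge (val v) 0 (x * s)" if "x \<in> M" for x
    using ge_mult[OF \<nu>, of x s n "- n"] n[OF that] s M(2) that by (auto simp: ge_def)
  define M' where "M' = {x \<in> M. ge (val v) (n + 1) x}"
  have fib: "card {x \<in> M. \<phi> x = c} \<le> card M'" for c
  proof (cases "{x \<in> M. \<phi> x = c} = {}")
    case True thus ?thesis by (simp only: card.empty)
  next
    case False
    then obtain x0 where x0: "x0 \<in> M" "\<phi> x0 = c" by blast
    show ?thesis
    proof (rule card_inj_on_le[of "\<lambda>x. x - x0"])
      show "inj_on (\<lambda>x. x - x0) {x \<in> M. \<phi> x = c}" by (auto simp: inj_on_def)
      show "finite M'" using M(1) by (simp add: M'_def)
      show "(\<lambda>x. x - x0) ` {x \<in> M. \<phi> x = c} \<subseteq> M'"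
      proof (rule image_subsetI)
        fix x assume "x \<in> {x \<in> M. \<phi> x = c}"
        hence x: "x \<in> M" "\<phi> x = c" by auto
        have xL: "x \<in> LF" "x0 \<in> LF" using M(2) x x0 by blast+
        hence L: "x * s \<in> LF" "x0 * s \<in> LF" "x - x0 \<in> LF" using s(1) by simp_all
        have "ge (val v) 1 (x * s - x0 * s)"
          by (rule residue_class(2)[OF v L(2) g0[OF x0(1)] L(1) g0[OF x(1)]])
            (use x x0 in \<open>simp add: \<phi>_def\<close>)
        hence *: "ge (val v) 1 ((x - x0) * s)" by (simp add: algebra_simps)
        have "ge (val v) (n + 1) (x - x0)"
        proof (cases "x - x0 = 0")
          case False
          hence "val v ((x - x0) * s) = val v (x - x0) - n" using v_mult[OF \<nu> L(3) s(1)] s by simp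
          thus ?thesis using * False s by (simp add: ge_def)
        qed (simp add: ge_def)
        thus "x - x0 \<in> M'" unfolding M'_def using M(3) x x0 by simp
      qed
    qed
  qed
  have "card M = card (\<Union>c\<in>\<phi> ` M. {x \<in> M. \<phi> x = c})" by (rule arg_cong[of _ _ card]) auto
  also have "\<dots> \<le> (\<Sum>c\<in>\<phi> ` M. card {x \<in> M. \<phi> x = c})" by (rule card_UN_le) (use M(1) in simp)
  also have "\<dots> \<le> (\<Sum>c\<in>\<phi> ` M. card M')" by (rule sum_mono) (rule fib)
  also have "\<dots> = card (\<phi> ` M) * card M'" by simp
  also have "card (\<phi> ` M) \<le> card (val_ring v // res_rel v)"
  proof (rule card_mono)
    show "finite (val_ring v // res_rel v)" by (rule finite_quot[OF v])
    show "\<phi> ` M \<subseteq> val_ring v // res_rel v"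
      unfolding \<phi>_def using residue_class(1)[OF v _ g0] M(2) s by auto
  qed
  hence "card (\<phi> ` M) * card M' \<le> q ^ place_deg v * card M'" unfolding card_quot[OF v] by (rule mult_right_mono) simp
  finally show ?thesis unfolding M'_def by (simp add: mult.commute)
qed

lemma subgroup_vanishing:
  assumes v: "is_place cc v" and "M \<subseteq> LF" and "\<And>x y. x \<in> M \<Longrightarrow> y \<in> M \<Longrightarrow> x - y \<in> M"
    and "x \<in> {x \<in> M. ge (val v) n x}" "y \<in> {x \<in> M. ge (val v) n x}"
  shows "x - y \<in> {x \<in> M. ge (val v) n x}"
  using assms ge_diff[OF place_is_val[OF v], of x y n] by auto

lemma card_vanishing:
  assumes v: "is_place cc v" and M: "finite M" "M \<subseteq> LF" "\<And>x y. x \<in> M \<Longrightarrow> y \<in> M \<Longrightarrow> x - y \<in> M"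
    and n: "\<And>x. x \<in> M \<Longrightarrow> ge (val v) 0 x"
  shows "card M \<le> card {x \<in> M. ge (val v) (int n) x} * q ^ (n * place_deg v)"
proof (induction n)
  case 0
  have "{x \<in> M. ge (val v) 0 x} = M" using n by auto
  thus ?case by simp
next
  case (Suc n)
  let ?N = "{x \<in> M. ge (val v) (int n) x}"
  have "card ?N \<le> card {x \<in> ?N. ge (val v) (int n + 1) x} * q ^ place_deg v"
  proof (rule card_vanishing_step[OF v])
    show "finite ?N" "?N \<subseteq> LF" using M by auto
    show "x - y \<in> ?N" if "x \<in> ?N" "y \<in> ?N" for x y by (rule subgroup_vanishing[OF v M(2,3) that])
  qed simp
  also have "{x \<in> ?N. ge (val v) (int n + 1) x} = {x \<in> M. ge (val v) (int (Suc n)) x}"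
    by (auto simp: ge_def)
  finally have "card ?N * q ^ (n * place_deg v) \<le> card {x \<in> M. ge (val v) (int (Suc n)) x} * q ^ place_deg v * q ^ (n * place_deg v)"
    by (rule mult_right_mono) simp
  from order_trans[OF Suc this] show ?case by (simp add: power_add mult_ac)
qed

lemma card_vanishing_set:
  assumes M: "finite M" "M \<subseteq> LF" "\<And>x y. x \<in> M \<Longrightarrow> y \<in> M \<Longrightarrow> x - y \<in> M"
    and S: "finite S" "\<And>v. v \<in> S \<Longrightarrow> is_place cc v" "\<And>v x. v \<in> S \<Longrightarrow> x \<in> M \<Longrightarrow> ge (val v) 0 x"
  shows "card M \<le> card {x \<in> M. \<forall>v\<in>S. ge (val v) (int (e v)) x} * q ^ (\<Sum>v\<in>S. e v * place_deg v)"
  using S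
proof (induction S rule: finite_induct)
  case empty thus ?case by simp
next
  case (insert v S)
  let ?N = "{x \<in> M. \<forall>v\<in>S. ge (val v) (int (e v)) x}"
  have v: "is_place cc v" using insert by simp
  have "card ?N \<le> card {x \<in> ?N. ge (val v) (int (e v)) x} * q ^ (e v * place_deg v)"
  proof (rule card_vanishing[OF v])
    show "finite ?N" "?N \<subseteq> LF" using M by auto
    show "x - y \<in> ?N" if xy: "x \<in> ?N" "y \<in> ?N" for x y
    proof -
      have L: "x \<in> LF" "y \<in> LF" using xy M(2) by auto
      have "ge (val w) (int (e w)) (x - y)" if w: "w \<in> S" for w
        by (rule ge_diff[OF place_is_val L]) (use w xy insert.prems(1) in auto)
      thus ?thesis using xy M(3) by simp
    qed
  qed (use insert.prems in auto)
  also have "{x \<in> ?N. ge (val v) (int (e v)) x} = {x \<in> M. \<forall>v\<in>insert v S. ge (val v) (int (e v)) x}" by auto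
  finally have "card ?N * q ^ (\<Sum>v\<in>S. e v * place_deg v) \<le>
    card {x \<in> M. \<forall>v\<in>insert v S. ge (val v) (int (e v)) x} * q ^ (e v * place_deg v) * q ^ (\<Sum>v\<in>S. e v * place_deg v)"
    by (rule mult_right_mono) simp
  moreover have "card M \<le> card ?N * q ^ (\<Sum>v\<in>S. e v * place_deg v)" using insert by auto
  ultimately have "card M \<le> card {x \<in> M. \<forall>v\<in>insert v S. ge (val v) (int (e v)) x} * q ^ (e v * place_deg v) * q ^ (\<Sum>v\<in>S. e v * place_deg v)"
    by (rule order_trans[rotated])
  moreover have "(\<Sum>v\<in>insert v S. e v * place_deg v) = e v * place_deg v + (\<Sum>v\<in>S. e v * place_deg v)"
    using insert.hyps by simp
  ultimately show ?case by (simp only: power_add mult.assoc)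
qed

text \<open>The functions with no pole except one of order at most m at infinity: x and y have pole
  orders 2 and 3, which gives deg A \<le> m / 2 and deg B \<le> (m - 3) / 2. No function has pole
  order 1, hence q^m elements and not q^(m+1).\<close>

definition poles_inf :: "nat \<Rightarrow> 'a poly fract alg_closure set" where
  "poles_inf m = (\<lambda>(A, B). pemb A + pemb B * yy) ` (polys_below (m div 2 + 1) \<times> polys_below ((m - 1) div 2))"

lemma poles_inf:
  assumes "1 \<le> m"
  shows "finite (poles_inf m)" "card (poles_inf m) = q ^ m" "poles_inf m \<subseteq> RR"
    "\<And>x y. x \<in> poles_inf m \<Longrightarrow> y \<in> poles_inf m \<Longrightarrow> x - y \<in> poles_inf m"
    "\<And>x. x \<in> poles_inf m \<Longrightarrow> ge (val inf_place) (- int m) x"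
proof -
  let ?P = "polys_below (m div 2 + 1) \<times> polys_below ((m - 1) div 2) :: ('a poly \<times> 'a poly) set"
  show "finite (poles_inf m)" unfolding poles_inf_def using card_polys_below[where 'a='a] by auto
  have "card (poles_inf m) = card ?P" unfolding poles_inf_def
    by (rule card_image) (auto simp: inj_on_def independent_eq)
  also have "\<dots> = q ^ (m div 2 + 1 + (m - 1) div 2)"
    using card_polys_below[where 'a='a] by (simp add: q_def card_cartesian_product power_add)
  also have "m div 2 + 1 + (m - 1) div 2 = m" using assms by presburger
  finally show "card (poles_inf m) = q ^ m" .
  show "poles_inf m \<subseteq> RR" unfolding poles_inf_def using RR_I by auto
  show "x - y \<in> poles_inf m" if xy: "x \<in> poles_inf m" "y \<in> poles_inf m" for x y
  proof -
    obtain A B where 1: "x = pemb A + pemb B * yy" "(A, B) \<in> ?P" using xy(1) unfolding poles_inf_def by auto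
    obtain C D where 2: "y = pemb C + pemb D * yy" "(C, D) \<in> ?P" using xy(2) unfolding poles_inf_def by auto
    have "x - y = pemb (A - C) + pemb (B - D) * yy" unfolding 1 2 by (simp add: algebra_simps)
    moreover have "(A - C, B - D) \<in> ?P" using 1 2 by (auto intro: polys_below_diff)
    ultimately show ?thesis unfolding poles_inf_def by (intro image_eqI[of _ _ "(A - C, B - D)"]) auto
  qed
  show "ge (val inf_place) (- int m) x" if x: "x \<in> poles_inf m" for x
  proof (cases "x = 0")
    case False
    obtain A B where 1: "x = pemb A + pemb B * yy" "A \<in> polys_below (m div 2 + 1)" "B \<in> polys_below ((m - 1) div 2)"
      using x unfolding poles_inf_def by auto
    have nz: "A \<noteq> 0 \<or> B \<noteq> 0" using False 1 by auto
    have A: "degree A < m div 2 + 1" if "A \<noteq> 0"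
    proof (rule ccontr)
      assume "\<not> degree A < m div 2 + 1"
      hence "coeff A (degree A) = 0" using 1(2) unfolding polys_below_def by simp
      thus False using that by simp
    qed
    have B: "degree B < (m - 1) div 2" if "B \<noteq> 0"
    proof (rule ccontr)
      assume "\<not> degree B < (m - 1) div 2"
      hence "coeff B (degree B) = 0" using 1(3) unfolding polys_below_def by simp
      thus False using that by simp
    qed
    have "A \<noteq> 0 \<Longrightarrow> 2 * int (degree A) \<le> int m" using A by linarith
    moreover have "B \<noteq> 0 \<Longrightarrow> 2 * int (degree B) + 3 \<le> int m" using B by linarith
    ultimately have "int (norm_deg x) \<le> int m" unfolding 1(1) norm_deg_formula[OF nz] by auto
    thus ?thesis using inf_place(2)[of x] inf_val_RR[of x] RR_I 1 False by (simp add: ge_def)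
  qed (simp add: ge_def)
qed

definition weighted_sum :: "(('a ff \<Rightarrow> int) \<Rightarrow> int) \<Rightarrow> ('a ff \<Rightarrow> int) set \<Rightarrow> int" where
  "weighted_sum V S = (\<Sum>v\<in>S. V v * int (place_deg v))"

lemma div_deg_superset:
  assumes "finite S" "{v. V v \<noteq> 0} \<subseteq> S" shows "div_deg V = weighted_sum V S"
  unfolding div_deg_def weighted_sum_def by (rule sum.mono_neutral_left) (use assms in auto)

text \<open>A polynomial h with value at least V at every finite place of V serves as common
  denominator. What is left is to find g in \<open>RR\<close> with pole order at most m at infinity
  and prescribed zeros of total degree s at finite places, where div_deg V = m - s. The q^m
  candidates fall into at most q^s classes, so m > s leaves a nonzero g, and g / h is the
  function.\<close>

theorem riemann:
  assumes V: "is_divisor cc V" and d: "div_deg V \<ge> 1"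
  obtains z where "z \<in> LF" "z \<noteq> 0" "\<And>v. is_place cc v \<Longrightarrow> val v z \<ge> - V v"
proof -
  define F where "F = {v. V v \<noteq> 0 \<and> fin (val v)}"
  have FV: "finite {v. V v \<noteq> 0}" "\<And>v. V v \<noteq> 0 \<Longrightarrow> is_place cc v" using V by (auto simp: is_divisor_def)
  have finF: "finite F" unfolding F_def by (rule finite_subset[OF _ FV(1)]) auto
  have "\<exists>p. irreducible p \<and> ge (val v) 1 (pemb p)" if "v \<in> F" for v
    using exists_prime[OF place_is_val] that FV by (auto simp: F_def)
  then obtain pr where pr: "\<And>v. v \<in> F \<Longrightarrow> irreducible (pr v) \<and> ge (val v) 1 (pemb (pr v))" by metis
  define h where "h = (\<Prod>v\<in>F. pr v ^ nat (V v))"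
  have pr0: "pr v \<noteq> 0" if "v \<in> F" for v using pr[OF that] by auto
  have h0: "h \<noteq> 0" unfolding h_def using finF pr0 by simp
  have vh: "val v (pemb h) \<ge> V v" if v: "v \<in> F" for v
  proof -
    have pv: "is_place cc v" "fin (val v)" using v FV by (auto simp: F_def)
    note \<nu> = place_is_val[OF pv(1)]
    define h' where "h' = (\<Prod>w\<in>F - {v}. pr w ^ nat (V w))"
    have hh: "h = pr v ^ nat (V v) * h'" unfolding h_def h'_def by (rule prod.remove[OF finF v])
    have h'0: "h' \<noteq> 0" using h0 hh by auto
    have "val v (pemb h) = int (nat (V v)) * val v (pemb (pr v)) + val v (pemb h')"
      unfolding hh pemb_hom using v_mult[OF \<nu>, of "pemb (pr v) ^ nat (V v)" "pemb h'"] v_power[OF \<nu>, of "pemb (pr v)"] pr0[OF v] h'0 by simp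
    moreover have "val v (pemb h') \<ge> 0" using ge0_pemb[OF \<nu> pv(2), of h'] h'0 by (simp add: ge_def)
    moreover have "val v (pemb (pr v)) \<ge> 1" using pr[OF v] pr0[OF v] by (simp add: ge_def)
    hence "int (nat (V v)) * val v (pemb (pr v)) \<ge> int (nat (V v)) * 1" by (intro mult_left_mono) auto
    ultimately show ?thesis by linarith
  qed
  have vh0: "val v (pemb h) \<ge> 0" if "is_place cc v" "fin (val v)" for v
    using ge0_pemb[OF place_is_val[OF that(1)] that(2), of h] h0 by (simp add: ge_def)
  define S where "S = {v. V v \<noteq> 0} \<union> supp (pemb h) \<union> {inf_place}"
  have S: "finite S" "\<And>v. v \<in> S \<Longrightarrow> is_place cc v"
    unfolding S_def using FV degree_zero(1)[of "pemb h"] h0 inf_place(1) by (auto simp: supp_def)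
  define e where "e v = nat (val v (pemb h) - V v)" for v
  define T where "T = S - {inf_place}"
  have T: "finite T" "\<And>v. v \<in> T \<Longrightarrow> is_place cc v \<and> fin (val v)"
    unfolding T_def using S inf_place_unique by auto
  have eT: "int (e v) = val v (pemb h) - V v" if "v \<in> T" for v
  proof (cases "V v = 0")
    case True thus ?thesis unfolding e_def using vh0 T(2)[OF that] by simp
  next
    case False
    hence "v \<in> F" using T(2)[OF that] by (simp add: F_def)
    thus ?thesis unfolding e_def using vh by simp
  qed
  define m where "m = V inf_place - val inf_place (pemb h)"
  have dV: "div_deg V = (\<Sum>v\<in>S. V v * int (place_deg v))"
    using div_deg_superset[OF S(1), of V] unfolding weighted_sum_def S_def by auto
  have dh: "0 = (\<Sum>v\<in>S. val v (pemb h) * int (place_deg v))"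
  proof -
    have "principal_deg (pemb h) = (\<Sum>v\<in>S. val v (pemb h) * int (place_deg v))"
      by (rule principal_deg_superset) (use S in \<open>auto simp: S_def\<close>)
    thus ?thesis using principal_deg_poly(2)[OF h0] by simp
  qed
  have "div_deg V = (\<Sum>v\<in>S. (V v - val v (pemb h)) * int (place_deg v))"
    using dV dh by (simp add: left_diff_distrib sum_subtractf)
  also have "\<dots> = m + (\<Sum>v\<in>T. (V v - val v (pemb h)) * int (place_deg v))"
  proof -
    have pS: "inf_place \<in> S" by (simp add: S_def)
    show ?thesis unfolding T_def m_def by (subst sum.remove[OF S(1) pS]) (simp add: card_quot_inf_place(2))
  qed
  also have "(\<Sum>v\<in>T. (V v - val v (pemb h)) * int (place_deg v)) = (\<Sum>v\<in>T. - int (e v * place_deg v))"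
    by (rule sum.cong) (simp_all add: eT algebra_simps)
  also have "\<dots> = - int (\<Sum>v\<in>T. e v * place_deg v)" by (simp add: sum_negf)
  finally have key: "int (\<Sum>v\<in>T. e v * place_deg v) + 1 \<le> m" using d by simp
  hence m1: "1 \<le> nat m" by linarith
  note P = poles_inf[OF m1]
  let ?M = "poles_inf (nat m)" let ?s = "\<Sum>v\<in>T. e v * place_deg v"
  define N where "N = {x \<in> ?M. \<forall>v\<in>T. ge (val v) (int (e v)) x}"
  have "card ?M \<le> card N * q ^ ?s" unfolding N_def
  proof (rule card_vanishing_set[OF P(1) _ P(4) T(1)])
    show "?M \<subseteq> LF" using P(3) by auto
    show "ge (val v) 0 x" if "v \<in> T" "x \<in> ?M" for v x
      using ge0_RR[OF place_is_val, of v x] T(2)[OF that(1)] P(3) that(2) by blast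
  qed (use T(2) in auto)
  hence le: "q ^ nat m \<le> card N * q ^ ?s" using P(2) by simp
  have "card N > 1"
  proof (rule ccontr)
    assume "\<not> card N > 1"
    hence "card N * q ^ ?s \<le> 1 * q ^ ?s" by (intro mult_right_mono) auto
    with le have "q ^ nat m \<le> 1 * q ^ ?s" by (rule order_trans)
    hence "nat m \<le> ?s" using q_gt_1 power_le_imp_le_exp[of q "nat m" ?s] by simp
    thus False using key by linarith
  qed
  hence "\<not> N \<subseteq> {0}" using card_mono[of "{0}" N] by auto
  then obtain g where g: "g \<in> N" "g \<noteq> 0" by blast
  have gR: "g \<in> RR" using g P(3) by (auto simp: N_def)
  have "val v (g / pemb h) \<ge> - V v" if v: "is_place cc v" for v
  proof -
    have vd: "val v (g / pemb h) = val v g - val v (pemb h)"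
      by (rule v_divide[OF place_is_val[OF v]]) (use gR g h0 in auto)
    consider "v = inf_place" | "v \<in> T" | "v \<notin> S" "v \<noteq> inf_place" by (auto simp: T_def)
    thus ?thesis
    proof cases
      case 1
      have "ge (val inf_place) (- int (nat m)) g" using g P(5) by (auto simp: N_def)
      moreover have "int (nat m) = m" using m1 by simp
      ultimately have "val inf_place g \<ge> - m" using g by (simp add: ge_def)
      thus ?thesis using vd 1 m_def by simp
    next
      case 2
      hence "ge (val v) (int (e v)) g" using g by (simp add: N_def)
      thus ?thesis using vd eT[OF 2] g by (simp add: ge_def)
    next
      case 3
      hence z: "V v = 0" "val v (pemb h) = 0" using v by (auto simp: S_def supp_def)
      have "fin (val v)" using inf_place_unique v 3 by blast
      hence "ge (val v) 0 g" using ge0_RR[OF place_is_val[OF v]] gR by blast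
      thus ?thesis using vd z g by (simp add: ge_def)
    qed
  qed
  thus ?thesis using that[of "g / pemb h"] gR g h0 by simp
qed

section \<open>Functions with a single pole\<close>

text \<open>Each irreducible factor of the denominator divides the numerator in \<open>RR\<close>,
  by the last claim of \<open>places_over\<close>, and can be cancelled.\<close>

lemma integral_RR:
  assumes z: "z \<in> LF" and i: "\<And>v. is_place cc v \<Longrightarrow> fin (val v) \<Longrightarrow> ge (val v) 0 z"
  shows "z \<in> RR"
proof -
  have "\<exists>g\<in>RR. \<exists>C. C \<noteq> 0 \<and> z = g / pemb C" using z LF_iff by simp
  then obtain g C where "g \<in> RR" "C \<noteq> 0" "z = g / pemb C" by blast
  thus ?thesis
  proof (induction "degree C" arbitrary: g C rule: less_induct)
    case less
    show ?case
    proof (cases "degree C = 0")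
      case True
      then obtain a where a: "C = [:a:]" by (rule degree_eq_zeroE)
      hence a0: "a \<noteq> 0" using less.prems by simp
      have i1: "pemb [:a:] * pemb [:inverse a:] = 1" using a0 by (simp flip: pemb_hom one_pCons)
      have "z * pemb C = g" using less.prems by simp
      hence "z * (pemb [:a:] * pemb [:inverse a:]) = g * pemb [:inverse a:]" unfolding a by (simp add: mult.assoc[symmetric])
      hence "z = g * pemb [:inverse a:]" unfolding i1 by simp
      thus ?thesis using less.prems by simp
    next
      case False
      then obtain p M where p: "irreducible p" "C = p * M"
        using exists_irreducible_divisor[of C] unfolding dvd_def by blast
      have nz: "p \<noteq> 0" "M \<noteq> 0" using p less.prems by auto
      have zC: "g = z * (pemb p * pemb M)" using less.prems p by simp
      have "ge (val v) (val v (pemb p)) g" if v: "v \<in> places_above p" for v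
      proof -
        have pv: "is_place cc v" "fin (val v)" using v fin_of_ge1[OF place_is_val, of v p] nz by (auto simp: places_above_def)
        note \<nu> = place_is_val[OF pv(1)]
        have "ge (val v) (val v (pemb p) + 0) (pemb p * pemb M)"
          by (rule ge_mult[OF \<nu> _ _ _ ge0_pemb[OF \<nu> pv(2)]]) (auto simp: ge_def)
        hence "ge (val v) (0 + (val v (pemb p) + 0)) (z * (pemb p * pemb M))"
          by (intro ge_mult[OF \<nu> z _ i[OF pv]]) (simp_all del: pemb_hom add: pemb_hom(5)[symmetric])
        thus ?thesis unfolding zC by simp
      qed
      then obtain g' where g': "g' \<in> RR" "g = pemb p * g'" using places_over(4)[OF p(1) less.prems(1)] by blast
      have "z = g' / pemb M" using less.prems(3) nz unfolding p(2) g'(2) by simp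
      moreover have "degree M < degree C" using p nz irreducible_poly_degree_pos[OF p(1)] by (simp add: degree_mult_eq)
      ultimately show ?thesis using less.hyps[of M g'] g' nz by blast
    qed
  qed
qed

text \<open>At infinity a simple pole is excluded because \<open>norm_deg\<close> takes only the
  values 0, 2, 3 and above. For a finite w above a linear p, the function z p has pole order at most
  2 at infinity, so z = A / p with deg A \<le> 1 and p not dividing A. Then z has a pole at every
  place above p, so w is the only one; p has value 2 there and the pole is double.\<close>

theorem no_degree_one_function:
  assumes z: "z \<in> LF" "z \<noteq> 0" and w: "is_place cc w" "place_deg w = 1"
    and pole: "\<And>v. is_place cc v \<Longrightarrow> val v z \<ge> (if v = w then - 1 else 0)"
    and vw: "val w z = - 1"
  shows False
  using w(1)
proof (rule place_cases)
  assume w: "w = inf_place"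
  have "ge (val v) 0 z" if "is_place cc v" "fin (val v)" for v
    using pole[OF that(1)] that(2) w inf_place_not_fin by (auto simp: ge_def split: if_splits)
  hence zR: "z \<in> RR" using integral_RR[OF z(1)] by blast
  then obtain A B where AB: "z = pemb A + pemb B * yy" by (rule RR_E)
  have nz: "A \<noteq> 0 \<or> B \<noteq> 0" using z AB by auto
  have "int (norm_deg z) = 1" using vw w inf_place(2)[OF z] inf_val_RR[OF zR z(2)] by simp
  hence "max (if A = 0 then 0 else 2 * int (degree A)) (if B = 0 then 0 else 2 * int (degree B) + 3) = 1"
    using norm_deg_formula[OF nz] AB by simp
  thus False by (auto simp: max_def split: if_splits) presburger+
next
  fix p assume p: "irreducible p" "w \<in> places_above p" "fin (val w)"
  have p0: "p \<noteq> 0" using p by auto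
  have dp: "degree p = 1"
    using places_over(3)[OF p(1,2)] w(2) irreducible_poly_degree_pos[OF p(1)] by auto
  have nw: "w \<noteq> inf_place" using p(3) inf_place_not_fin by auto
  define y where "y = z * pemb p"
  have y: "y \<in> LF" "y \<noteq> 0" unfolding y_def using z p0 by auto
  have vy: "val v y = val v z + val v (pemb p)" if "is_place cc v" for v
    unfolding y_def by (rule v_mult[OF place_is_val[OF that]]) (use z p0 in auto)
  have "ge (val v) 0 y" if v: "is_place cc v" "fin (val v)" for v
  proof -
    have vp: "val v (pemb p) \<ge> 0" using ge0_pemb[OF place_is_val[OF v(1)] v(2), of p] p0 by (simp add: ge_def)
    have "val w (pemb p) \<ge> 1" using p(2) p0 by (auto simp: places_above_def ge_def)
    thus ?thesis using pole[OF v(1)] vy[OF v(1)] vp by (auto simp: ge_def split: if_splits)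
  qed
  hence yR: "y \<in> RR" using integral_RR[OF y(1)] by blast
  then obtain A B where AB: "y = pemb A + pemb B * yy" by (rule RR_E)
  have nz: "A \<noteq> 0 \<or> B \<noteq> 0" using y AB by auto
  have "val inf_place z \<ge> 0" using pole[OF inf_place(1)] nw by simp
  moreover have "val inf_place (pemb p) = - 2"
    using not_fin_pemb[OF place_is_val[OF inf_place(1)] inf_place_not_fin p0] inf_place_xx dp by simp
  ultimately have "int (norm_deg y) \<le> 2" using vy[OF inf_place(1)] inf_place(2)[OF y] inf_val_RR[OF yR y(2)] by simp
  hence mx: "max (if A = 0 then 0 else 2 * int (degree A)) (if B = 0 then 0 else 2 * int (degree B) + 3) \<le> 2"
    using norm_deg_formula[OF nz] AB by simp
  have B0: "B = 0" using mx by (cases "B = 0") (auto simp: max_def split: if_splits)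
  hence A0: "A \<noteq> 0" using nz by simp
  have dA: "degree A \<le> 1" using mx A0 B0 by simp
  have yA: "y = pemb A" using AB B0 by simp
  have vA: "val v z = val v (pemb A) - val v (pemb p)" if "is_place cc v" for v using vy[OF that] yA by simp
  have "\<not> p dvd A"
  proof
    assume "p dvd A"
    then obtain c where c: "A = p * c" by auto
    have "degree c = 0" using c A0 dA dp by (auto simp: degree_mult_eq)
    then obtain a where a: "c = [:a:]" by (rule degree_eq_zeroE)
    have a0: "a \<noteq> 0" using a c A0 by auto
    have "val w (pemb A) = val w (pemb p) + val w (pemb [:a:])"
      unfolding c a pemb_hom by (rule v_mult[OF place_is_val[OF w(1)]]) (use p0 a0 in auto)
    hence "val w z = 0" using vA[OF w(1)] v_const[OF place_is_val[OF w(1)] a0] by simp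
    thus False using vw by simp
  qed
  hence A_unit: "val v (pemb A) = 0" if v: "v \<in> places_above p" for v
  proof -
    have pv: "is_place cc v" "ge (val v) 1 (pemb p)" using v by (auto simp: places_above_def)
    note \<nu> = place_is_val[OF pv(1)]
    have f: "fin (val v)" by (rule fin_of_ge1[OF \<nu> pv(2) p0])
    show ?thesis using ge1_iff_dvd[OF \<nu> f p(1) pv(2), of A] ge0_pemb[OF \<nu> f, of A] A0 \<open>\<not> p dvd A\<close> by (auto simp: ge_def)
  qed
  have "places_above p = {w}"
  proof -
    have "v = w" if v: "v \<in> places_above p" for v
    proof (rule ccontr)
      assume "v \<noteq> w"
      have pv: "is_place cc v" "val v (pemb p) \<ge> 1" using v p0 by (auto simp: places_above_def ge_def)
      have "val v z < 0" using vA[OF pv(1)] A_unit[OF v] pv(2) by simp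
      thus False using pole[OF pv(1)] \<open>v \<noteq> w\<close> by simp
    qed
    thus ?thesis using p(2) by blast
  qed
  hence "val w (pemb p) * int (place_deg w) = 2" using places_over(2)[OF p(1)] dp by simp
  hence "val w (pemb p) = 2" using w(2) by simp
  thus False using vA[OF w(1)] A_unit[OF p(2)] vw by simp
qed

end

section \<open>Counting points\<close>

lemma finite_field_power_card:
  fixes x :: "'a::{finite,field}"
  shows "x ^ card (UNIV :: 'a set) = x"
proof (cases "x = 0")
  case False
  have "x * (\<Prod>y\<in>UNIV-{0}. x * y) = x * x ^ (card (UNIV :: 'a set) - 1) * \<Prod>(UNIV-{0})"
    by (simp add: prod.distrib mult_ac)
  also have "x * x ^ (card (UNIV :: 'a set) - 1) = x ^ Suc (card (UNIV :: 'a set) - 1)"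
    by (subst power_Suc) auto
  also have "Suc (card (UNIV :: 'a set) - 1) = card (UNIV :: 'a set)"
    using finite_UNIV_card_ge_0[where ?'a = 'a] by simp
  also have "(\<Prod>y\<in>UNIV-{0}. x * y) = (\<Prod>y\<in>UNIV-{0}. y)"
    by (rule prod.reindex_bij_witness[of _ "\<lambda>y. y / x" "\<lambda>y. x * y"]) (use False in auto)
  finally show ?thesis by simp
qed (use finite_UNIV_card_ge_0[where ?'a = 'a] in auto)

text \<open>Both x and x + 1 equal their q-th powers, so the binomial expansion without its end
  terms is a polynomial of degree below q that vanishes on all of K. Its coefficients are therefore
  zero, without any appeal to q being a prime power.\<close>

lemma choose_card_eq_0:
  assumes "0 < i" "i < card (UNIV :: 'a::{finite,field} set)"
  shows "of_nat (card (UNIV :: 'a set) choose i) = (0 :: 'a)"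
proof -
  let ?q = "card (UNIV :: 'a set)"
  define P :: "'a poly" where "P = (\<Sum>j\<in>{1..<?q}. monom (of_nat (?q choose j)) j)"
  have q: "?q > 0" using finite_UNIV_card_ge_0[where ?'a = 'a] by simp
  have root: "poly P x = 0" for x
  proof -
    have "x + 1 = (x + 1) ^ ?q" by (simp add: finite_field_power_card)
    also have "\<dots> = (\<Sum>j\<le>?q. of_nat (?q choose j) * x ^ j * 1 ^ (?q - j))" by (rule binomial_ring)
    also have "{..?q} = insert 0 (insert ?q {1..<?q})" using q by auto
    also have "(\<Sum>j\<in>\<dots>. of_nat (?q choose j) * x ^ j * 1 ^ (?q - j)) = 1 + x ^ ?q + poly P x"
      using q by (simp add: P_def poly_sum poly_monom)
    finally show ?thesis by (simp add: finite_field_power_card)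
  qed
  have "P = 0"
  proof (rule ccontr)
    assume "P \<noteq> 0"
    hence "card {x. poly P x = 0} \<le> degree P" by (rule card_poly_roots_bound)
    moreover have "degree P \<le> ?q - 1" unfolding P_def
      by (rule degree_sum_le) (auto intro: order_trans[OF degree_monom_le])
    ultimately show False using root q by simp
  qed
  hence "coeff P i = 0" by simp
  also have "coeff P i = (\<Sum>j\<in>{1..<?q}. if j = i then of_nat (?q choose j) else 0)"
    unfolding P_def by (simp add: coeff_sum)
  also have "\<dots> = of_nat (?q choose i)" by (subst sum.delta) (use assms in auto)
  finally show ?thesis .
qed

lemma frobenius_add:
  fixes u v :: "'a::{finite,field} poly fract alg_closure"
  shows "(u + v) ^ card (UNIV :: 'a set) = u ^ card (UNIV :: 'a set) + v ^ card (UNIV :: 'a set)"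
proof -
  let ?q = "card (UNIV :: 'a set)"
  have q: "?q > 0" using finite_UNIV_card_ge_0[where ?'a = 'a] by simp
  have on: "of_nat n = pemb [:of_nat n :: 'a:]" for n
    by (induction n) (simp_all add: one_pCons flip: pemb_hom(2,3))
  have z: "of_nat (?q choose j) = (0 :: 'a poly fract alg_closure)" if "j \<in> {1..<?q}" for j
    using that on[of "?q choose j"] choose_card_eq_0[where 'a='a, of j] by auto
  have "(u + v) ^ ?q = (\<Sum>j\<le>?q. of_nat (?q choose j) * u ^ j * v ^ (?q - j))" by (rule binomial_ring)
  also have "{..?q} = insert 0 (insert ?q {1..<?q})" using q by auto
  also have "(\<Sum>j\<in>\<dots>. of_nat (?q choose j) * u ^ j * v ^ (?q - j)) = v ^ ?q + u ^ ?q"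
    using q z by simp
  finally show ?thesis by simp
qed

lemma frobenius_minus:
  fixes u :: "'a::{finite,field} poly fract alg_closure"
  shows "(- u) ^ card (UNIV :: 'a set) = - (u ^ card (UNIV :: 'a set))"
proof -
  have "card (UNIV :: 'a set) > 0" using finite_UNIV_card_ge_0[where ?'a = 'a] by simp
  hence "u ^ card (UNIV :: 'a set) + (- u) ^ card (UNIV :: 'a set) = 0"
    using frobenius_add[of u "- u"] by (simp add: zero_power del: power_0_left power_eq_0_iff)
  thus ?thesis by (metis add.inverse_unique)
qed

subsection \<open>Heights\<close>

definition coprime_rep :: "'a::field poly fract \<Rightarrow> 'a poly \<Rightarrow> 'a poly \<Rightarrow> bool" where
  "coprime_rep z a b \<longleftrightarrow> b \<noteq> 0 \<and> z = Fract a b \<and> (\<exists>u v. u * a + v * b = 1)"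

text \<open>The degree of z as a rational map; coprime representations differ by a constant factor,
  so the choice is harmless.\<close>

definition height :: "'a::field poly fract \<Rightarrow> nat" where
  "height z = (SOME m. \<exists>a b. coprime_rep z a b \<and> m = max (degree a) (degree b))"

lemma height_rep: "\<exists>a b. coprime_rep z a b \<and> height z = max (degree a) (degree b)"
proof -
  have "\<exists>m a b. coprime_rep z a b \<and> m = max (degree a) (degree b)"
    using fract_lowest_terms[of z] unfolding coprime_rep_def by metis
  thus ?thesis unfolding height_def by (rule someI_ex)
qed

lemma coprime_rep_dvd:
  assumes "coprime_rep z a b" "z = Fract c d" "d \<noteq> 0"
  shows "b dvd d" "a dvd c"
proof -
  obtain u v where uv: "u * a + v * b = 1" using assms unfolding coprime_rep_def by blast
  have "b \<noteq> 0" "Fract a b = Fract c d" using assms unfolding coprime_rep_def by auto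
  hence e: "a * d = c * b" using eq_fract(1)[of b d a c] assms(3) by simp
  have "d = (u * a + v * b) * d" using uv by simp
  also have "\<dots> = u * (a * d) + v * b * d" by (simp only: distrib_right mult.assoc)
  also have "\<dots> = b * (u * c + v * d)" unfolding e by (simp add: algebra_simps)
  finally show "b dvd d" by (rule dvdI)
  have "c = (u * a + v * b) * c" using uv by simp
  also have "\<dots> = u * a * c + v * (c * b)" by (simp add: algebra_simps)
  also have "\<dots> = a * (u * c + v * d)" unfolding e[symmetric] by (simp add: algebra_simps)
  finally show "a dvd c" by (rule dvdI)
qed

lemma height_le: "z = Fract c d \<Longrightarrow> d \<noteq> 0 \<Longrightarrow> c \<noteq> 0 \<Longrightarrow> height z \<le> max (degree c) (degree d)"
  using height_rep[of z] coprime_rep_dvd[of z] by (metis dvd_imp_degree_le max.mono)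

lemma height_whole: "height (Fract p 1) = degree p"
proof -
  obtain a b where ab: "coprime_rep (Fract p 1) a b" "height (Fract p 1) = max (degree a) (degree b)"
    using height_rep by blast
  have "b dvd 1" using coprime_rep_dvd(1)[OF ab(1) refl] by simp
  moreover have "b \<noteq> 0" using ab by (simp add: coprime_rep_def)
  ultimately have b: "degree b = 0" by (simp add: is_unit_iff_degree)
  have "Fract p 1 = Fract a b" using ab by (simp add: coprime_rep_def)
  hence "a = p * b" using eq_fract(1)[of 1 b p a] \<open>b \<noteq> 0\<close> by simp
  hence "degree a = degree p" using b \<open>b \<noteq> 0\<close> by (cases "p = 0") (auto simp: degree_mult_eq)
  thus ?thesis using ab b by simp
qed

text \<open>Gauss's lemma: the form (bf, af + eb, ae) is primitive.\<close>

lemma height_of_roots: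
  fixes a b e f A B C :: "'a::field poly"
  assumes "A \<noteq> 0" "b \<noteq> 0" "f \<noteq> 0" and uv: "u * a + v * b = 1" "u' * e + v' * f = 1"
    and s: "(a * f + e * b) * A = B * (b * f)" and p: "a * e * A = C * (b * f)"
    and m: "degree A \<le> m" "degree B \<le> m" "degree C \<le> m"
  shows "max (degree a) (degree b) + max (degree e) (degree f) \<le> m"
proof -
  define r where "r = (v * u' - u * v')"
  \<comment> \<open>Multiplying the two Bezout identities expresses 1; w collects the part that is a
    combination of the three coefficients of the form, and a multiple of e b is left over.\<close>
  define w where "w = u * u' * (a * e) + u * v' * (a * f + e * b) + v * v' * (b * f)"
  have 1: "1 = w + r * (e * b)"
  proof -
    have "1 = (u * a + v * b) * (u' * e + v' * f)" by (simp add: uv)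
    also have "\<dots> = w + r * (e * b)" unfolding w_def r_def by (simp add: algebra_simps)
    finally show ?thesis .
  qed
  have sA: "b * f dvd A * (a * f + e * b)" using s by (metis dvd_triv_right mult.commute)
  have pA: "b * f dvd A * (a * e)" using p by (metis dvd_triv_right mult.commute)
  have wA: "b * f dvd A * w"
  proof -
    have "A * w = u * u' * (A * (a * e)) + u * v' * (A * (a * f + e * b)) + A * v * v' * (b * f)"
      unfolding w_def by (simp add: algebra_simps)
    thus ?thesis using sA pA by (simp add: dvd_add dvd_mult)
  qed
  \<comment> \<open>The square of e b is again such a combination: (e b)^2 = e b (a f + e b) - (a e)
    (b f).\<close>
  have eb: "b * f dvd A * (e * b) * (e * b)"
  proof -
    have "A * (e * b) * (e * b) = e * b * (A * (a * f + e * b)) - A * (a * e) * (b * f)"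
      by (simp add: algebra_simps)
    thus ?thesis using sA by (simp add: dvd_diff dvd_mult)
  qed
  have "A = A * 1 * 1" by simp
  also have "\<dots> = A * (w + r * (e * b)) * (w + r * (e * b))" by (simp only: 1[symmetric])
  also have "\<dots> = (A * w) * (w + 2 * r * (e * b)) + r * r * (A * (e * b) * (e * b))"
    by (simp add: algebra_simps)
  finally have "b * f dvd A" using wA eb by (metis dvd_add dvd_mult dvd_mult2)
  then obtain k where k: "A = b * f * k" by auto
  have bf: "b * f \<noteq> 0" "k \<noteq> 0" using assms k by auto
  have "b * f * B = b * f * ((a * f + e * b) * k)" using s k by (simp add: algebra_simps)
  hence B: "B = (a * f + e * b) * k" using bf by simp
  have "b * f * C = a * e * A" using p by (simp add: mult_ac)
  also have "\<dots> = b * f * (a * e * k)" unfolding k by (simp add: mult_ac)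
  finally have "b * f * C = b * f * (a * e * k)" .
  hence C: "C = a * e * k" using bf(1) by (metis mult_left_cancel)
  have dm: "degree x \<le> degree (x * k)" for x using bf by (cases "x = 0") (auto simp: degree_mult_eq)
  have d: "degree (b * f) \<le> m" "degree (a * f + e * b) \<le> m" "degree (a * e) \<le> m"
    using dm[of "b * f"] dm[of "a * f + e * b"] dm[of "a * e"] k B C m by auto
  \<comment> \<open>The largest degree among b f, a f + e b and a e is the sum of the heights; the
    middle coefficient attains it when one fraction is dominated by its numerator and the other by
    its denominator.\<close>
  consider "degree a \<le> degree b" "degree e \<le> degree f" | "degree b < degree a" "degree f < degree e"
    | "degree b < degree a" "degree e \<le> degree f" | "degree a \<le> degree b" "degree f < degree e" by linarith
  thus ?thesis
  proof cases
    case 1 thus ?thesis using d(1) assms by (simp add: degree_mult_eq)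
  next
    case 2
    hence "a \<noteq> 0" "e \<noteq> 0" by auto
    thus ?thesis using d(3) 2 by (simp add: degree_mult_eq)
  next
    case 3
    hence "a \<noteq> 0" by auto
    have "degree (e * b) < degree (a * f)"
      using 3 degree_mult_le[of e b] \<open>a \<noteq> 0\<close> assms by (simp add: degree_mult_eq)
    hence "degree (a * f + e * b) = degree (a * f)" by (rule degree_add_eq_left)
    thus ?thesis using d(2) 3 \<open>a \<noteq> 0\<close> assms by (simp add: degree_mult_eq)
  next
    case 4
    hence "e \<noteq> 0" by auto
    have "degree (a * f) < degree (e * b)"
      using 4 degree_mult_le[of a f] \<open>e \<noteq> 0\<close> assms by (simp add: degree_mult_eq)
    hence "degree (a * f + e * b) = degree (e * b)" by (rule degree_add_eq_right)
    thus ?thesis using d(2) 4 \<open>e \<noteq> 0\<close> assms by (simp add: degree_mult_eq)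
  qed
qed

section \<open>The addition law on x-coordinates and the descent\<close>

context weierstrass
begin

abbreviation T :: "'a poly" where "T \<equiv> [:0, 1:]"

lemma q_power [simp]: "(x :: 'a) ^ q = x"
  unfolding q_def by (rule finite_field_power_card)

lemma frob_add: "(u + v) ^ q = u ^ q + (v :: 'a poly fract alg_closure) ^ q"
  and frob_minus: "(- u) ^ q = - (u ^ q)"
  unfolding q_def by (rule frobenius_add frobenius_minus)+

text \<open>Divided by (x - u)^2, \<open>sum_num\<close> and \<open>product_num\<close> are the sum
  and the product of the x-coordinates of P + Q and P - Q, where P and Q have x-coordinates x and
  u.\<close>

definition sum_num :: "'a poly fract \<Rightarrow> 'a poly fract" where
  "sum_num u = 2 * ffX * u * (ffX + u) + ffC b2 * ffX * u + ffC b4 * (ffX + u) + ffC b6"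
definition product_num :: "'a poly fract \<Rightarrow> 'a poly fract" where
  "product_num u = ffX\<^sup>2 * u\<^sup>2 - ffC b4 * ffX * u - ffC b6 * (ffX + u) - ffC b8"

text \<open>The equation \<open>addition_form z u = 0\<close> says that z, u and the coordinate x are the
  x-coordinates of points that add up to zero for some choice of signs. Hence the form is symmetric,
  and its two roots z are the x-coordinates of the sum and the difference of the points above u and x.\<close>

definition addition_form :: "'a poly fract \<Rightarrow> 'a poly fract \<Rightarrow> 'a poly fract" where
  "addition_form z u = (ffX - u)\<^sup>2 * z\<^sup>2 - sum_num u * z + product_num u"

lemma addition_form_sym: "addition_form z u = addition_form u z"
  unfolding addition_form_def sum_num_def product_num_def by (simp add: algebra_simps power2_eq_square)

text \<open>w is the second root of the quadratic equation for z. Clearing the denominator of u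
  leaves three coefficients of degree at most 2 \<open>height u\<close> + 2, and by
  \<open>height_of_roots\<close> this bounds the sum of the heights of the roots.\<close>

lemma height_step:
  assumes F: "addition_form z u = 0" and ut: "u \<noteq> ffX"
  obtains w where "addition_form w u = 0" "height z + height w \<le> 2 * height u + 2"
proof -
  define w where "w = sum_num u / (ffX - u)\<^sup>2 - z"
  have D: "(ffX - u)\<^sup>2 \<noteq> 0" using ut by auto
  have sum: "(z + w) * (ffX - u)\<^sup>2 = sum_num u" using D unfolding w_def by (simp add: field_simps)
  have w2: "(ffX - u)\<^sup>2 * w = sum_num u - (ffX - u)\<^sup>2 * z" using sum by (simp add: algebra_simps)
  have prd: "z * w * (ffX - u)\<^sup>2 = product_num u"
  proof -
    have "z * w * (ffX - u)\<^sup>2 = z * ((ffX - u)\<^sup>2 * w)" by (simp add: mult_ac)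
    also have "\<dots> = sum_num u * z - (ffX - u)\<^sup>2 * z\<^sup>2" unfolding w2 by (simp add: algebra_simps power2_eq_square)
    also have "\<dots> = product_num u" using F unfolding addition_form_def by (simp add: algebra_simps)
    finally show ?thesis .
  qed
  have "addition_form w u = 0"
  proof -
    have "(ffX - u)\<^sup>2 * w\<^sup>2 = w * ((ffX - u)\<^sup>2 * w)" by (simp add: power2_eq_square mult_ac)
    also have "\<dots> = sum_num u * w - z * w * (ffX - u)\<^sup>2" unfolding w2 by (simp add: algebra_simps)
    finally show ?thesis unfolding addition_form_def prd by simp
  qed
  moreover have "height z + height w \<le> 2 * height u + 2"
  proof -
    obtain a b where ab: "coprime_rep z a b" "height z = max (degree a) (degree b)" using height_rep by blast
    obtain e f where ef: "coprime_rep w e f" "height w = max (degree e) (degree f)" using height_rep by blast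
    obtain c d where cd: "coprime_rep u c d" "height u = max (degree c) (degree d)" using height_rep by blast
    have nz: "b \<noteq> 0" "f \<noteq> 0" "d \<noteq> 0" using ab ef cd by (simp_all add: coprime_rep_def)
    let ?F = "\<lambda>p :: 'a poly. Fract p 1"
    have eqs: "z = Fract a b" "w = Fract e f" "u = Fract c d" using ab ef cd by (simp_all add: coprime_rep_def)
    define H where "H = height u"
    define A where "A = (T * d - c) * (T * d - c)"
    define B where "B = 2 * T * c * (T * d + c) + [:b2:] * T * c * d + [:b4:] * (T * d + c) * d + [:b6:] * d * d"
    define C where "C = T * T * c * c - [:b4:] * T * c * d - [:b6:] * (T * d + c) * d - [:b8:] * d * d"
    have two: "(2 :: 'a poly fract) = Fract 2 1"
      by (metis Fract_of_nat_eq of_nat_numeral)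
    have 1: "(ffX - u)\<^sup>2 = Fract A (d * d)"
      unfolding eqs A_def ffX_def power2_eq_square using nz by simp
    have 2: "sum_num u = Fract B (d * d)"
      unfolding eqs sum_num_def B_def ffX_def ffC_def two power2_eq_square using nz by (simp add: eq_fract algebra_simps)
    have 3: "product_num u = Fract C (d * d)"
      unfolding eqs product_num_def C_def ffX_def ffC_def power2_eq_square using nz by (simp add: eq_fract algebra_simps)
    have "A \<noteq> 0" using D 1 nz by (auto simp: Zero_fract_def eq_fract)
    moreover have "(a * f + e * b) * A = B * (b * f)"
      using sum[unfolded 1 2] unfolding eqs using nz by (simp add: eq_fract mult_ac)
    moreover have "a * e * A = C * (b * f)"
      using prd[unfolded 1 3] unfolding eqs using nz by (simp add: eq_fract mult_ac)
    moreover have dc: "degree c \<le> H" "degree d \<le> H" unfolding H_def cd(2) by auto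
    have tdm: "degree (T * p) \<le> n + 1" if "degree p \<le> n" for p n
      using that degree_mult_le[of T p] by simp
    have cdm: "degree ([:k:] * p) \<le> n" if "degree p \<le> n" for p n and k :: 'a
      using that degree_mult_le[of "[:k:]" p] by simp
    have mm: "degree (p * r) \<le> n + n'" if "degree p \<le> n" "degree r \<le> n'" for p r :: "'a poly" and n n'
      using that degree_mult_le[of p r] by simp
    have td: "degree (T * d + c) \<le> H + 1" "degree (T * d - c) \<le> H + 1"
      using tdm[OF dc(2)] dc(1) by (auto intro!: degree_add_le degree_diff_le)
    have "degree A \<le> 2 * H + 2" unfolding A_def using mm[OF td(2) td(2)] by simp
    moreover have "degree B \<le> 2 * H + 2"
    proof -
      have "degree (2 * T * c * (T * d + c)) \<le> 2 * H + 2"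
        using mm[OF tdm[OF dc(1)] td(1)] cdm[of "T * c * (T * d + c)" "2 * H + 2" 2] by (simp add: mult.assoc numeral_poly)
      moreover have "degree ([:b2:] * T * c * d) \<le> 2 * H + 2"
        using mm[OF tdm[OF dc(1)] dc(2)] cdm[of "T * c * d" "2 * H + 2" b2] by (simp add: mult.assoc)
      moreover have "degree ([:b4:] * (T * d + c) * d) \<le> 2 * H + 2"
        using mm[OF td(1) dc(2)] cdm[of "(T * d + c) * d" "2 * H + 2" b4] by (simp add: mult.assoc)
      moreover have "degree ([:b6:] * d * d) \<le> 2 * H + 2"
        using mm[OF dc(2) dc(2)] cdm[of "d * d" "2 * H + 2" b6] by (simp add: mult.assoc)
      ultimately show ?thesis unfolding B_def by (intro degree_add_le)
    qed
    moreover have "degree C \<le> 2 * H + 2"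
    proof -
      have "degree (T * T * c * c) \<le> 2 * H + 2"
        using mm[OF tdm[OF dc(1)] tdm[OF dc(1)]] by (simp add: mult_ac)
      moreover have "degree ([:b4:] * T * c * d) \<le> 2 * H + 2"
        using mm[OF tdm[OF dc(1)] dc(2)] cdm[of "T * c * d" "2 * H + 2" b4] by (simp add: mult.assoc)
      moreover have "degree ([:b6:] * (T * d + c) * d) \<le> 2 * H + 2"
        using mm[OF td(1) dc(2)] cdm[of "(T * d + c) * d" "2 * H + 2" b6] by (simp add: mult.assoc)
      moreover have "degree ([:b8:] * d * d) \<le> 2 * H + 2"
        using mm[OF dc(2) dc(2)] cdm[of "d * d" "2 * H + 2" b8] by (simp add: mult.assoc)
      ultimately show ?thesis unfolding C_def by (intro degree_diff_le)
    qed
    moreover obtain k1 k2 k3 k4 where "k1 * a + k2 * b = 1" "k3 * e + k4 * f = 1"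
      using ab ef unfolding coprime_rep_def by blast
    ultimately show ?thesis unfolding ab(2) ef(2) H_def[symmetric]
      using height_of_roots[of A b f k1 a k2 k3 e k4 B C "2 * H + 2"] nz by blast
  qed
  ultimately show ?thesis using that by blast
qed

text \<open>For u = x the quadratic term vanishes and the form becomes the duplication formula, a
  quotient of polynomials of degree at most 4.\<close>

lemma height_double:
  assumes "addition_form z ffX = 0" shows "height z \<le> 4"
proof -
  define S where "S = 4 * T * T * T + [:b2:] * T * T + 2 * [:b4:] * T + [:b6:]"
  define P where "P = T * T * T * T - [:b4:] * T * T - 2 * [:b6:] * T - [:b8:]"
  have two: "(2 :: 'a poly fract) = Fract 2 1"
    by (metis Fract_of_nat_eq of_nat_numeral)
  have 1: "sum_num ffX = Fract S 1" unfolding sum_num_def S_def ffX_def ffC_def two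
    by (simp add: algebra_simps numeral_poly)
  have 2: "product_num ffX = Fract P 1" unfolding product_num_def P_def ffX_def ffC_def power2_eq_square
    by (simp add: algebra_simps numeral_poly)
  have e: "Fract S 1 * z = Fract P 1" using assms unfolding addition_form_def 1 2 by simp
  have cP: "coeff P 4 = 1" unfolding P_def by (simp add: eval_nat_numeral numeral_poly)
  hence P0: "P \<noteq> 0" by auto
  hence "Fract P 1 \<noteq> 0" by (simp add: Zero_fract_def eq_fract)
  have S0: "S \<noteq> 0"
  proof
    assume "S = 0"
    hence "Fract S 1 = 0" by (simp add: Zero_fract_def)
    thus False using e \<open>Fract P 1 \<noteq> 0\<close> by simp
  qed
  have "Fract S 1 \<noteq> 0" using S0 by (simp add: Zero_fract_def eq_fract)
  hence "z = Fract P 1 / Fract S 1" using e by (metis nonzero_mult_div_cancel_left)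
  hence z: "z = Fract P S" by simp
  have "degree P \<le> 4" "degree S \<le> 4" unfolding P_def S_def
    by (auto simp: numeral_poly)
  thus ?thesis using height_le[OF z S0 P0] by simp
qed

text \<open>The points above \<open>u0\<close>, \<open>u1\<close>, ... are the Frobenius image of the generic point plus successive
  multiples of the generic point, and \<open>height_step\<close> bounds the second differences of their heights
  from above. Four steps suffice for the factor 5/4.\<close>

lemma height_chain:
  assumes F0: "addition_form z (Fract (monom 1 q) 1) = 0" and q: "22 < q"
  shows "4 * height z \<le> 5 * q + 20"
proof -
  define u0 where "u0 = Fract (monom (1::'a) q) 1"
  have h0: "height u0 = q" unfolding u0_def height_whole by (simp add: degree_monom_eq)
  have bk: "height a \<le> 2 * height b + 2" if "addition_form a b = 0" "b \<noteq> ffX" for a b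
    using height_step[OF that] by (metis add_leD1)
  have F0': "addition_form z u0 = 0" using F0 by (simp add: u0_def)
  have n0: "u0 \<noteq> ffX"
  proof
    assume "u0 = ffX"
    hence "height u0 = 1" using height_whole[of T] by (simp add: ffX_def)
    thus False using h0 q by simp
  qed
  obtain u1 where u1: "addition_form u1 u0 = 0" "height z + height u1 \<le> 2 * height u0 + 2" using height_step[OF F0' n0] .
  have F1: "addition_form u0 u1 = 0" using u1 addition_form_sym by metis
  have n1: "u1 \<noteq> ffX" using F1 height_double h0 q by force
  obtain u2 where u2: "addition_form u2 u1 = 0" "height u0 + height u2 \<le> 2 * height u1 + 2" using height_step[OF F1 n1] .
  have F2: "addition_form u1 u2 = 0" using u2 addition_form_sym by metis
  have n2: "u2 \<noteq> ffX"
  proof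
    assume "u2 = ffX"
    hence "height u1 \<le> 4" using height_double F2 by simp
    thus False using bk[OF F1 n1] h0 q by simp
  qed
  obtain u3 where u3: "addition_form u3 u2 = 0" "height u1 + height u3 \<le> 2 * height u2 + 2" using height_step[OF F2 n2] .
  have F3: "addition_form u2 u3 = 0" using u3 addition_form_sym by metis
  \<comment> \<open>Meeting the generic point here would bound the heights going back by 4, then 10,
    then 22; the last bound contradicts 22 < q.\<close>
  have n3: "u3 \<noteq> ffX"
  proof
    assume "u3 = ffX"
    hence "height u2 \<le> 4" using height_double F3 by simp
    hence "height u1 \<le> 10" using bk[OF F2 n2] by simp
    thus False using bk[OF F1 n1] h0 q by simp
  qed
  obtain u4 where u4: "addition_form u4 u3 = 0" "height u2 + height u4 \<le> 2 * height u3 + 2" using height_step[OF F3 n3] .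
  \<comment> \<open>With d = \<open>height u1\<close> - q, second differences at most 2 give
    \<open>height u4\<close> \<le> q + 4 d + 12. This is nonnegative, so d \<ge> - (q + 12) / 4, and
    \<open>height z\<close> \<le> q + 2 - d yields (5 q + 20) / 4.\<close>
  show ?thesis using u1(2) u2(2) u3(2) u4(2) h0 by linarith
qed

text \<open>Reducing z^n to degree one in z uses only the Weierstrass equation, so the same two
  polynomials serve y, its conjugate and the ordinate of every rational point. This lets the
  Frobenius image be evaluated at points.\<close>

lemma yy_power_components:
  "\<exists>\<alpha> \<beta>. (\<forall>z. z * z = pemb gp - pemb hp * z \<longrightarrow> z ^ n = pemb \<alpha> + pemb \<beta> * z) \<and>
     (\<forall>x0 y0. on_aff x0 y0 \<longrightarrow> y0 ^ n = poly \<alpha> x0 + poly \<beta> x0 * y0)"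
proof (induction n)
  case 0
  show ?case by (intro exI[of _ 1] exI[of _ 0]) auto
next
  case (Suc n)
  then obtain \<alpha> \<beta> where IH: "\<And>z. z * z = pemb gp - pemb hp * z \<Longrightarrow> z ^ n = pemb \<alpha> + pemb \<beta> * z"
     "\<And>x0 y0. on_aff x0 y0 \<Longrightarrow> y0 ^ n = poly \<alpha> x0 + poly \<beta> x0 * y0" by blast
  show ?case
  proof (rule exI[of _ "\<beta> * gp"], rule exI[of _ "\<alpha> - \<beta> * hp"], intro conjI allI impI)
    fix z assume z: "z * z = pemb gp - pemb hp * z"
    have "z ^ Suc n = pemb \<alpha> * z + pemb \<beta> * (z * z)" using IH(1)[OF z] by (simp add: algebra_simps)
    thus "z ^ Suc n = pemb (\<beta> * gp) + pemb (\<alpha> - \<beta> * hp) * z" unfolding z by (simp add: algebra_simps)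
  next
    fix x0 y0 assume o: "on_aff x0 y0"
    hence y: "y0 * y0 = poly gp x0 - poly hp x0 * y0" unfolding on_aff_def by (simp add: power2_eq_square algebra_simps)
    have "y0 ^ Suc n = poly \<alpha> x0 * y0 + poly \<beta> x0 * (y0 * y0)" using IH(2)[OF o] by (simp add: algebra_simps)
    thus "y0 ^ Suc n = poly (\<beta> * gp) x0 + poly (\<alpha> - \<beta> * hp) x0 * y0" unfolding y by (simp add: algebra_simps)
  qed
qed

text \<open>Here \<open>\<alpha> + \<beta> y\<close> is the q-th power of y, and the two equations are its trace and its norm.\<close>

lemma frobenius_y:
  obtains \<alpha> \<beta> Xq where
    "Xq = monom (1::'a) q"
    "2 * \<alpha> - \<beta> * hp = - ([:a3:] + [:a1:] * Xq)"
    "\<alpha> * \<alpha> - \<alpha> * \<beta> * hp - \<beta> * \<beta> * gp = - ([:a6:] + [:a4:] * Xq + [:a2:] * Xq * Xq + Xq * Xq * Xq)"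
    "\<And>x0 y0. on_aff x0 y0 \<Longrightarrow> y0 = poly \<alpha> x0 + poly \<beta> x0 * y0"
proof -
  obtain \<alpha> \<beta> where *: "\<And>z. z * z = pemb gp - pemb hp * z \<Longrightarrow> z ^ q = pemb \<alpha> + pemb \<beta> * z"
     "\<And>x0 y0. on_aff x0 y0 \<Longrightarrow> y0 ^ q = poly \<alpha> x0 + poly \<beta> x0 * y0"
    using yy_power_components[of q] by blast
  define Xq where "Xq = monom (1::'a) q"
  define zz where "zz = - pemb hp - yy"
  have sum: "yy + zz = - pemb hp" by (simp add: zz_def)
  have prd: "yy * zz = - pemb gp" unfolding zz_def using yy_sq by (simp add: algebra_simps)
  have zz: "zz * zz = pemb gp - pemb hp * zz"
    unfolding zz_def using yy_sq by (simp add: algebra_simps)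
  have Tq: "pemb T ^ q = pemb Xq" unfolding Xq_def
    by (simp add: monom_altdef flip: pemb_hom(7))
  have c: "pemb [:k:] ^ q = pemb [:k:]" for k :: 'a
    by (simp add: poly_const_pow flip: pemb_hom(7))
  have h: "pemb hp = pemb [:a3:] + pemb [:a1:] * pemb T"
    unfolding hp_def by (simp flip: pemb_hom)
  have g: "pemb gp = pemb [:a6:] + pemb [:a4:] * pemb T + pemb [:a2:] * pemb T * pemb T + pemb T * pemb T * pemb T"
    unfolding gp_def by (simp flip: pemb_hom)
  have hq: "pemb hp ^ q = pemb ([:a3:] + [:a1:] * Xq)"
    unfolding h frob_add power_mult_distrib c Tq by (simp only: pemb_hom)
  have gq: "pemb gp ^ q = pemb ([:a6:] + [:a4:] * Xq + [:a2:] * Xq * Xq + Xq * Xq * Xq)"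
    unfolding g frob_add power_mult_distrib c Tq by (simp only: pemb_hom)
  have "pemb (2 * \<alpha> - \<beta> * hp) = yy ^ q + zz ^ q"
    unfolding *(1)[OF yy_sq] *(1)[OF zz] by (simp add: zz_def algebra_simps)
  also have "\<dots> = pemb (- ([:a3:] + [:a1:] * Xq))"
    unfolding frob_add[symmetric] sum frob_minus hq by (simp only: pemb_hom)
  finally have 1: "2 * \<alpha> - \<beta> * hp = - ([:a3:] + [:a1:] * Xq)" unfolding pemb_eq_iff .
  have "pemb (\<alpha> * \<alpha> - \<alpha> * \<beta> * hp - \<beta> * \<beta> * gp) = yy ^ q * zz ^ q"
  proof -
    have "yy ^ q * zz ^ q = pemb \<alpha> * pemb \<alpha> + pemb \<alpha> * pemb \<beta> * (yy + zz) + pemb \<beta> * pemb \<beta> * (yy * zz)"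
      unfolding *(1)[OF yy_sq] *(1)[OF zz] by (simp add: algebra_simps)
    thus ?thesis unfolding sum prd by (simp add: algebra_simps)
  qed
  also have "\<dots> = pemb (- ([:a6:] + [:a4:] * Xq + [:a2:] * Xq * Xq + Xq * Xq * Xq))"
    unfolding power_mult_distrib[symmetric] prd frob_minus gq by (simp only: pemb_hom)
  finally have 2: "\<alpha> * \<alpha> - \<alpha> * \<beta> * hp - \<beta> * \<beta> * gp = - ([:a6:] + [:a4:] * Xq + [:a2:] * Xq * Xq + Xq * Xq * Xq)"
    unfolding pemb_eq_iff .
  show ?thesis using that[OF Xq_def 1 2] *(2) by (metis q_power)
qed

text \<open>For points with coordinates (t, y) and (Xq, Y), the x-coordinate of their difference has
  numerator W - u over (t - Xq)^2, where - u = 2 y Y + h Y + h' y + h h' gathers the terms with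
  ordinates. The sum of the points belongs to the other root - h h' - u of the equation for
  u.\<close>

lemma translate_identity:
  fixes t Xq h g h' g' u A1 A2 A3 A4 A6 dl B2 B4 B6 B8 W S P :: "'b::comm_ring_1"
  assumes u: "u * u + h * h' * u = g' * (h * h) + 4 * g * g' + g * (h' * h')"
    and "h = A3 + A1 * t" "h' = A3 + A1 * Xq" "g = A6 + A4 * t + A2 * t * t + t * t * t"
    "g' = A6 + A4 * Xq + A2 * Xq * Xq + Xq * Xq * Xq" "dl = t - Xq"
    "B2 = A1 * A1 + 4 * A2" "B4 = 2 * A4 + A1 * A3" "B6 = A3 * A3 + 4 * A6"
    "B8 = A1 * A1 * A6 + 4 * A2 * A6 - A1 * A3 * A4 + A2 * A3 * A3 - A4 * A4"
    and S: "S = 2 * t * Xq * (t + Xq) + B2 * t * Xq + B4 * (t + Xq) + B6"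
    and P: "P = t * t * Xq * Xq - B4 * t * Xq - B6 * (t + Xq) - B8"
    and W: "W = g + g' - (A2 + t + Xq) * dl * dl"
  shows "(W - u) * (W - u) - S * (W - u) + P * dl * dl = 0"
proof -
  have 1: "S = 2 * W + h * h'" unfolding S W assms by (simp add: algebra_simps)
  have 2: "W * W - S * W + P * dl * dl + (g' * (h * h) + 4 * g * g' + g * (h' * h')) = 0"
    unfolding S W P assms(2-10) by (simp add: algebra_simps)
  have "(W - u) * (W - u) - S * (W - u) + P * dl * dl =
    (u * u + (S - 2 * W) * u) + (W * W - S * W + P * dl * dl)" by (simp add: algebra_simps)
  also have "S - 2 * W = h * h'" unfolding 1 by simp
  also note u
  finally show ?thesis using 2 by (simp only: add.commute)
qed

text \<open>The inequality says that the point is not its own negative, so a second rational point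
  has the same abscissa.\<close>

definition two_point_xs :: "'a set" where
  "two_point_xs = {x0. \<exists>y0. on_aff x0 y0 \<and> 2 * y0 + poly hp x0 \<noteq> 0}"

text \<open>The witness z is the x-coordinate of the difference of the Frobenius image of the generic point
  and the generic point itself. It has a double pole at every abscissa in \<open>two_point_xs\<close>.\<close>

lemma height_frobenius:
  obtains z where "addition_form z (Fract (monom 1 q) 1) = 0" "2 * card two_point_xs \<le> height z"
proof (rule frobenius_y)
  fix \<alpha> \<beta> Xq
  assume Xq: "Xq = monom (1::'a) q"
    and E1: "2 * \<alpha> - \<beta> * hp = - ([:a3:] + [:a1:] * Xq)"
    and E2: "\<alpha> * \<alpha> - \<alpha> * \<beta> * hp - \<beta> * \<beta> * gp = - ([:a6:] + [:a4:] * Xq + [:a2:] * Xq * Xq + Xq * Xq * Xq)"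
    and ev: "\<And>x0 y0. on_aff x0 y0 \<Longrightarrow> y0 = poly \<alpha> x0 + poly \<beta> x0 * y0"
  define h' where "h' = [:a3:] + [:a1:] * Xq"
  define g' where "g' = [:a6:] + [:a4:] * Xq + [:a2:] * Xq * Xq + Xq * Xq * Xq"
  \<comment> \<open>This is - (2 y Y + h Y + h' y + h h') for Y = \<alpha> + \<beta> y; by h' =
    \<beta> h - 2 \<alpha> the terms in y cancel, so u is a polynomial.\<close>
  define u where "u = \<alpha> * hp - \<beta> * hp * hp - 2 * \<beta> * gp"
  define dl where "dl = T - Xq"
  define W where "W = gp + g' - ([:a2:] + T + Xq) * dl * dl"
  define M where "M = W - u"
  have u: "u * u + hp * h' * u = g' * (hp * hp) + 4 * gp * g' + gp * (h' * h')"
  proof -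
    have h': "h' = \<beta> * hp - 2 * \<alpha>" using E1 unfolding h'_def by (simp add: algebra_simps)
    have g': "g' = - (\<alpha> * \<alpha> - \<alpha> * \<beta> * hp - \<beta> * \<beta> * gp)" using E2 unfolding g'_def by simp
    show ?thesis unfolding h' g' u_def by (simp add: algebra_simps)
  qed
  have hpe: "hp = [:a3:] + [:a1:] * T" unfolding hp_def by simp
  have gpe: "gp = [:a6:] + [:a4:] * T + [:a2:] * T * T + T * T * T" unfolding gp_def by simp
  define B2 where "B2 = [:a1:] * [:a1:] + 4 * [:a2:]"
  define B4 where "B4 = 2 * [:a4:] + [:a1:] * [:a3:]"
  define B6 where "B6 = [:a3:] * [:a3:] + 4 * [:a6:]"
  define B8 where "B8 = [:a1:] * [:a1:] * [:a6:] + 4 * [:a2:] * [:a6:] - [:a1:] * [:a3:] * [:a4:] + [:a2:] * [:a3:] * [:a3:] - [:a4:] * [:a4:]"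
  define S where "S = 2 * T * Xq * (T + Xq) + B2 * T * Xq + B4 * (T + Xq) + B6"
  define P where "P = T * T * Xq * Xq - B4 * T * Xq - B6 * (T + Xq) - B8"
  have key: "M * M - S * M + P * dl * dl = 0"
    unfolding M_def
    by (rule translate_identity[OF u hpe h'_def gpe g'_def dl_def B2_def B4_def B6_def B8_def S_def P_def W_def])
  have D0: "dl \<noteq> 0"
  proof
    assume "dl = 0"
    hence "T = Xq" unfolding dl_def by simp
    hence "degree T = degree Xq" by simp
    hence "q = 1" unfolding Xq by (simp add: degree_monom_eq)
    moreover have "card {0, 1 :: 'a} \<le> q" unfolding q_def by (rule card_mono) auto
    ultimately show False by simp
  qed
  define z where "z = Fract M (dl * dl)"
  have "addition_form z (Fract Xq 1) = 0"
  proof -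
    have two: "(2 :: 'a poly fract) = Fract 2 1"
      by (metis Fract_of_nat_eq of_nat_numeral)
    have b: "ffC b2 = Fract B2 1" "ffC b4 = Fract B4 1" "ffC b6 = Fract B6 1" "ffC b8 = Fract B8 1"
      unfolding ffC_def B2_def B4_def B6_def B8_def b2_def b4_def b6_def b8_def
      by (simp_all add: numeral_poly power2_eq_square mult_ac)
    have 1: "sum_num (Fract Xq 1) = Fract S 1" "product_num (Fract Xq 1) = Fract P 1" "ffX - Fract Xq 1 = Fract dl 1"
      unfolding sum_num_def product_num_def b S_def P_def dl_def ffX_def two power2_eq_square by (simp_all add: mult_ac)
    have zd: "z = Fract M 1 / (Fract dl 1 * Fract dl 1)" unfolding z_def by simp
    have d1: "Fract dl 1 \<noteq> 0" using D0 by (simp add: Zero_fract_def eq_fract)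
    have dz: "Fract dl 1 * Fract dl 1 * z = Fract M 1" unfolding z_def using D0 by (simp add: eq_fract)
    have "Fract dl 1 * Fract dl 1 * addition_form z (Fract Xq 1) = Fract (M * M - S * M + P * dl * dl) 1"
    proof -
      have "Fract dl 1 * Fract dl 1 * addition_form z (Fract Xq 1) =
        Fract M 1 * Fract M 1 - Fract S 1 * Fract M 1 + Fract P 1 * Fract dl 1 * Fract dl 1"
        unfolding addition_form_def 1 dz[symmetric] by (simp only: power2_eq_square algebra_simps)
      thus ?thesis by simp
    qed
    hence "Fract dl 1 * Fract dl 1 * addition_form z (Fract Xq 1) = 0" unfolding key by (simp only: fract_collapse)
    thus ?thesis using d1 by (metis mult_eq_0_iff)
  qed
  moreover have "2 * card two_point_xs \<le> height z"
  proof -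
    have cop: "poly M x0 \<noteq> 0" "poly dl x0 = 0" if mem: "x0 \<in> two_point_xs" for x0
    proof -
      obtain y0 where y0: "on_aff x0 y0" "2 * y0 + poly hp x0 \<noteq> 0" using mem unfolding two_point_xs_def by blast
      define h where "h = poly hp x0" define g where "g = poly gp x0"
      define y1 where "y1 = - h - y0"
      have gy: "g = y0 * y0 + h * y0" using y0(1) unfolding on_aff_def g_def h_def by (simp add: power2_eq_square)
      hence o1: "on_aff x0 y1" unfolding on_aff_def y1_def g_def h_def by (simp add: power2_eq_square algebra_simps)
      have X0: "poly Xq x0 = x0" unfolding Xq by (simp add: poly_monom)
      thus D: "poly dl x0 = 0" unfolding dl_def by simp
      have G: "poly g' x0 = g" unfolding g'_def g_def gpe using X0 by (simp add: algebra_simps)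
      define a where "a = poly \<alpha> x0" define b where "b = poly \<beta> x0"
      \<comment> \<open>Frobenius fixes both ordinates above x0, and two distinct solutions of y = a
        + b y force a = 0 and b = 1. Thus M takes the value 4 g + h^2 = (2 y0 + h)^2 at x0, which is
        not zero.\<close>
      have e0: "y0 - b * y0 = a" "y1 - b * y1 = a"
        using ev[OF y0(1)] ev[OF o1] unfolding a_def b_def by (metis add_diff_cancel_right')+
      have "b = 1 \<and> a = 0"
      proof -
        have "(1 - b) * (2 * y0 + h) = (y0 - b * y0) - (y1 - b * y1)" unfolding y1_def by (simp add: algebra_simps)
        also have "\<dots> = 0" unfolding e0 by simp
        finally have "b = 1" using y0(2) unfolding h_def by simp
        thus ?thesis using e0(1) by simp
      qed
      hence "poly M x0 = 2 * g + h * h + 2 * g"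
        unfolding M_def W_def u_def using D G by (simp add: a_def b_def g_def h_def algebra_simps)
      also have "\<dots> = (2 * y0 + h) * (2 * y0 + h)" unfolding gy by (simp add: algebra_simps)
      finally show "poly M x0 \<noteq> 0" using y0(2) h_def by simp
    qed
    obtain a b where ab: "coprime_rep z a b" "height z = max (degree a) (degree b)" using height_rep by blast
    have b0: "b \<noteq> 0" using ab by (simp add: coprime_rep_def)
    have "Fract a b = Fract M (dl * dl)" using ab by (simp add: coprime_rep_def z_def)
    hence e: "a * (dl * dl) = M * b" using eq_fract(1)[OF b0, of "dl * dl" a M] D0 by simp
    \<comment> \<open>The factor dl^2 vanishes to order at least 2 at x0 and M does not vanish
      there, so no cancellation lowers the order of the reduced denominator below 2.\<close>
    have ord: "2 \<le> order x0 b" if "x0 \<in> two_point_xs" for x0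
    proof -
      have "a * (dl * dl) \<noteq> 0"
      proof -
        have "M \<noteq> 0" using cop(1)[OF that] by auto
        thus ?thesis unfolding e using b0 by simp
      qed
      hence "order x0 (a * (dl * dl)) = order x0 a + (order x0 dl + order x0 dl)"
        by (simp add: order_mult)
      moreover have "order x0 (M * b) = order x0 M + order x0 b"
        using e \<open>a * (dl * dl) \<noteq> 0\<close> by (metis order_mult)
      moreover have "order x0 M = 0" using cop(1)[OF that] by (simp add: order_0I)
      moreover have "order x0 dl > 0" using cop(2)[OF that] D0 by (simp add: order_root)
      ultimately show ?thesis using e by simp
    qed
    have "2 * card two_point_xs = (\<Sum>x0\<in>two_point_xs. 2)" by simp
    also have "\<dots> \<le> (\<Sum>x0\<in>two_point_xs. order x0 b)" by (rule sum_mono) (use ord in auto)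
    also have "\<dots> \<le> (\<Sum>x0\<in>UNIV. order x0 b)" by (rule sum_mono2) auto
    also have "\<dots> = (\<Sum>x0\<in>{x. poly b x = 0}. order x0 b)"
      by (rule sum.mono_neutral_right) (use b0 in \<open>auto simp: order_root\<close>)
    also have "\<dots> \<le> degree b" by (rule sum_order_le_degree[OF b0])
    finally show ?thesis using ab by simp
  qed
  ultimately show thesis using that Xq by blast
qed

text \<open>A point with 2 y + h = 0 is the only one on its vertical line, and its abscissa is a
  root of 4 g + h^2, a polynomial of degree at most 3. These at most three points and the one at
  infinity make up the 4.\<close>

lemma card_points_two_point_xs: "card {P. on_curve cc P} \<le> 2 * card two_point_xs + 4"
proof -
  define D where "D = [:b6, 2 * b4, b2, 4:]"
  define R where "R = {x. poly D x = 0}"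
  \<comment> \<open>In characteristic 2 the cubic term is lost, but each term of the discriminant
    contains b2, b6 or 8, and these cannot all be zero.\<close>
  have "D \<noteq> 0"
  proof
    assume "D = 0"
    hence z: "(4::'a) = 0" "b2 = 0" "b6 = 0" unfolding D_def by auto
    have "(8 :: 'a) = 2 * 4" by simp
    hence "(8 :: 'a) = 0" using z(1) by (simp only: mult_zero_right)
    thus False using disc_b z by simp
  qed
  moreover have "degree D \<le> 3" unfolding D_def by (simp add: degree_pCons_eq_if)
  ultimately have R3: "card R \<le> 3" unfolding R_def using card_poly_roots_bound[of D] by simp
  have two: "y' = y \<or> y' = - poly hp x - y" if "on_aff x y" "on_aff x y'" for x y y'
  proof -
    have "(y' - y) * (y' + y + poly hp x) = 0"
      using that unfolding on_aff_def by (simp add: algebra_simps power2_eq_square)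
    hence "y' - y = 0 \<or> y' + y + poly hp x = 0" by simp
    thus ?thesis by (metis add.assoc add.commute add_eq_0_iff eq_iff_diff_eq_0 minus_add_distrib diff_conv_add_uminus)
  qed
  have le: "card {y. on_aff x y} \<le> (if x \<in> two_point_xs then 2 else 0) + (if x \<in> R then 1 else 0)" for x
  proof (cases "\<exists>y. on_aff x y")
    case True
    then obtain y where y: "on_aff x y" by blast
    have sub: "{y. on_aff x y} \<subseteq> {y, - poly hp x - y}" using two[OF y] by auto
    show ?thesis
    proof (cases "x \<in> two_point_xs")
      case True
      have "card {y. on_aff x y} \<le> card {y, - poly hp x - y}" using sub by (intro card_mono) auto
      also have "\<dots> \<le> 2" by (simp add: card_insert_if)
      finally show ?thesis using True by simp
    next
      case False
      hence e: "2 * y + poly hp x = 0" using y unfolding two_point_xs_def by blast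
      hence "- poly hp x - y = y" by (simp add: algebra_simps) (metis add.commute add_eq_0_iff mult_2 minus_add_distrib add.assoc add.inverse_inverse diff_conv_add_uminus add_diff_cancel_right')
      hence "{y. on_aff x y} \<subseteq> {y}" using sub by auto
      hence 1: "card {y. on_aff x y} \<le> 1" using card_mono[of "{y}" "{y. on_aff x y}"] by simp
      have "poly D x = 4 * poly gp x + poly hp x * poly hp x"
        unfolding D_def b2_def b4_def b6_def gp_def hp_def by (simp add: algebra_simps power2_eq_square)
      also have "\<dots> = (2 * y + poly hp x) * (2 * y + poly hp x)"
      proof -
        have "poly gp x = y * y + poly hp x * y" using y unfolding on_aff_def by (simp add: power2_eq_square)
        thus ?thesis by (simp add: algebra_simps)
      qed
      finally have "x \<in> R" unfolding R_def e by simp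
      thus ?thesis using 1 by simp
    qed
  qed auto
  have "{P. on_curve cc P} = insert Inf ((\<lambda>(x, y). Aff x y) ` (SIGMA x:UNIV. {y. on_aff x y}))"
    (is "_ = insert _ (?f ` ?A)")
  proof (intro Set.set_eqI)
    fix P :: "'a point"
    show "P \<in> {P. on_curve cc P} \<longleftrightarrow> P \<in> insert Inf (?f ` ?A)"
      by (cases P) (auto simp: image_iff on_aff_iff simp del: on_curve.simps(2))
  qed
  also have "card \<dots> \<le> Suc (card (?f ` ?A))" by (rule card_insert_le_m1) auto
  also have "card (?f ` ?A) \<le> card ?A" by (rule card_image_le) auto
  also have "card ?A = (\<Sum>x\<in>UNIV. card {y. on_aff x y})" by simp
  also have "\<dots> \<le> (\<Sum>x\<in>UNIV. (if x \<in> two_point_xs then 2 else 0) + (if x \<in> R then 1 else 0))"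
    by (rule sum_mono) (rule le)
  also have "\<dots> = 2 * card two_point_xs + card R"
    by (simp add: sum.distrib sum.If_cases)
  finally show ?thesis using R3 by simp
qed

text \<open>The constant 36 is 20 from \<open>height_chain\<close> plus 4 times the 4 exceptional
  points.\<close>

theorem card_points_le:
  assumes "22 < q" shows "4 * card {P. on_curve cc P} \<le> 5 * q + 36"
proof -
  obtain z where "addition_form z (Fract (monom 1 q) 1) = 0" "2 * card two_point_xs \<le> height z" using height_frobenius .
  thus ?thesis using height_chain[of z] card_points_two_point_xs assms by linarith
qed

section \<open>Rational points as places of degree one\<close>

abbreviation pl :: "'a point \<Rightarrow> 'a ff \<Rightarrow> int" where "pl P \<equiv> place_of cc P"

definition curve_points :: "'a point set" where "curve_points = {P. on_curve cc P}"

lemma emb_minus_const: "emb (fsub fX (fconst a)) = pemb [:- a, 1:]" "emb (fsub fY (fconst b)) = yy - pemb [:b:]"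
proof -
  have "[:- a, 1:] = [:0, 1:] - [:a:]" by simp
  thus "emb (fsub fX (fconst a)) = pemb [:- a, 1:]" by (simp only: emb_sub emb_X emb_const pemb_hom)
  show "emb (fsub fY (fconst b)) = yy - pemb [:b:]" by (simp only: emb_sub emb_Y emb_const)
qed

lemma root_norm_const_dvd: "on_aff a b \<longleftrightarrow> [:- a, 1:] dvd root_norm [:b:]"
proof -
  have "poly (root_norm [:b:]) a = b\<^sup>2 + poly hp a * b - poly gp a" by (simp add: root_norm_def power2_eq_square algebra_simps)
  thus ?thesis unfolding on_aff_def by (simp flip: poly_eq_0_iff_dvd)
qed

lemma irreducible_X: "irreducible [:- a, 1 :: 'a:]"
  by (rule irreducible_linear_field_poly) simp

lemma local_param_root:
  assumes "irreducible p" "p dvd root_norm r" shows "\<exists>t. local_param (root_ideal p r) t"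
  using local_param_split[OF assms] local_param_ramified(1)[OF assms] by blast

lemma yy_minus_nz: "yy - pemb r \<noteq> 0"
  using independent[of "- r" 1] by auto

lemma yy_minus_root_ideal: "yy - pemb r \<in> root_ideal p s \<longleftrightarrow> p dvd s - r"
proof -
  have e: "yy - pemb r = pemb (- r) + pemb 1 * yy" by simp
  show ?thesis unfolding e root_ideal_iff by simp
qed

text \<open>Positive values at x - a and y - b fix the centre as the ideal of the point, and a place
  is determined by its centre; this gives the uniqueness that the description in
  \<open>place_of\<close> requires.\<close>

lemma place_of_Aff:
  assumes o: "on_aff a b"
  shows "is_place cc (pl (Aff a b))" "ge (val (pl (Aff a b))) 1 (pemb [:- a, 1:])"
    "ge (val (pl (Aff a b))) 1 (yy - pemb [:b:])" "center (val (pl (Aff a b))) = root_ideal [:- a, 1:] [:b:]"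
    "fin (val (pl (Aff a b)))"
proof -
  let ?p = "[:- a, 1 :: 'a:]" let ?r = "[:b:]"
  note p = irreducible_X[of a]
  have p0: "?p \<noteq> 0" by simp
  have r: "?p dvd root_norm ?r" using o root_norm_const_dvd by simp
  obtain t where L: "local_param (root_ideal ?p ?r) t" using local_param_root[OF p r] by blast
  note y0 = yy_minus_nz[of ?r]
  define PP where "PP v \<longleftrightarrow> is_place cc v \<and> v (fsub fX (fconst a)) > 0 \<and> v (fsub fY (fconst b)) > 0" for v
  have PPi: "PP v \<longleftrightarrow> is_place cc v \<and> ge (val v) 1 (pemb ?p) \<and> ge (val v) 1 (yy - pemb ?r)" for v
  proof -
    have "val v (emb (fsub fX (fconst a))) = v (fsub fX (fconst a))" "val v (emb (fsub fY (fconst b))) = v (fsub fY (fconst b))"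
      by (rule val_emb)+
    thus ?thesis unfolding PP_def emb_minus_const ge_def using p0 y0 by auto
  qed
  have ct: "fin (val v) \<and> center (val v) = root_ideal ?p ?r" if v: "PP v" for v
  proof -
    have v': "is_place cc v" "ge (val v) 1 (pemb ?p)" "ge (val v) 1 (yy - pemb ?r)" using v PPi by auto
    have f: "fin (val v)" by (rule fin_of_ge1[OF place_is_val[OF v'(1)] v'(2) p0])
    show ?thesis using f center_root_ideal_I[OF place_is_val[OF v'(1)] f p v'(2,3)] by simp
  qed
  obtain v where v: "is_place cc v" "fin (val v)" "center (val v) = root_ideal ?p ?r"
    by (rule local_param_place[OF L], rule that)
  have yJ: "yy - pemb ?r \<in> root_ideal ?p ?r" unfolding yy_minus_root_ideal by simp
  have pJ: "pemb ?p \<in> root_ideal ?p ?r" using root_ideal_pemb[of ?p ?p ?r] by simp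
  have Pv: "PP v" unfolding PPi using v yJ pJ unfolding center_def by blast
  have uni: "w = v" if w: "PP w" for w
  proof -
    have wp: "is_place cc w" using w by (simp add: PP_def)
    show ?thesis by (rule local_param_place_unique[OF L wp conjunct1[OF ct[OF w]] conjunct2[OF ct[OF w]] v])
  qed
  have "pl (Aff a b) = (THE v. PP v)" unfolding place_of_def PP_def by simp
  also have "\<dots> = v" by (rule the_equality, rule Pv, rule uni)
  finally have e: "pl (Aff a b) = v" .
  show "is_place cc (pl (Aff a b))" "ge (val (pl (Aff a b))) 1 (pemb [:- a, 1:])"
    "ge (val (pl (Aff a b))) 1 (yy - pemb [:b:])" "center (val (pl (Aff a b))) = root_ideal [:- a, 1:] [:b:]"
    "fin (val (pl (Aff a b)))"
    unfolding e using Pv PPi v by blast+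
qed

lemma place_of_Inf: "pl Inf = inf_place"
proof -
  have nf: "v fX < 0 \<longleftrightarrow> \<not> fin (val v)" for v
  proof -
    have "val v (emb fX) = v fX" by (rule val_emb)
    thus ?thesis unfolding fin_def emb_X by (simp add: not_le)
  qed
  have "pl Inf = (THE v. is_place cc v \<and> \<not> fin (val v))" unfolding place_of_def nf by simp
  also have "\<dots> = inf_place"
  proof (rule the_equality)
    show "is_place cc inf_place \<and> \<not> fin (val inf_place)" using inf_place(1) inf_place_not_fin by simp
    show "v = inf_place" if "is_place cc v \<and> \<not> fin (val v)" for v
      using inf_place_unique[of v] that by simp
  qed
  finally show ?thesis .
qed

lemma curve_points_cases:
  assumes "P \<in> curve_points" obtains "P = Inf" | a b where "P = Aff a b" "on_aff a b"
  using assms by (cases P) (auto simp: curve_points_def on_aff_iff simp del: on_curve.simps(2))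

lemma pl_place: assumes "P \<in> curve_points" shows "is_place cc (pl P)"
  using assms by (rule curve_points_cases) (auto simp: place_of_Inf inf_place(1) place_of_Aff(1))

lemma pl_deg: assumes "P \<in> curve_points" shows "place_deg (pl P) = 1"
  using assms
proof (rule curve_points_cases)
  assume "P = Inf" thus ?thesis using card_quot_inf_place(2) by (simp add: place_of_Inf)
next
  fix a b assume P: "P = Aff a b" "on_aff a b"
  have r: "[:- a, 1:] dvd root_norm [:b:]" using P root_norm_const_dvd by simp
  obtain t where L: "local_param (root_ideal [:- a, 1:] [:b:]) t" using local_param_root[OF irreducible_X r] by blast
  note A = place_of_Aff[OF P(2)]
  show ?thesis using deg_root_ideal(2)[OF irreducible_X r L A(1,5,4)] P(1) by simp
qed

lemma pl_inj: assumes "P \<in> curve_points" "Q \<in> curve_points" "pl P = pl Q" shows "P = Q"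
proof -
  have ni: "pl (Aff a b) \<noteq> inf_place" if "on_aff a b" for a b
    using place_of_Aff(5)[OF that] inf_place_not_fin by metis
  have af: "a = a' \<and> b = b'" if "on_aff a b" "on_aff a' b'" "pl (Aff a b) = pl (Aff a' b')" for a b a' b'
  proof -
    have e: "root_ideal [:- a, 1:] [:b:] = root_ideal [:- a', 1:] [:b':]"
      using place_of_Aff(4)[OF that(1)] place_of_Aff(4)[OF that(2)] that(3) by simp
    have "pemb [:- a', 1:] \<in> root_ideal [:- a, 1:] [:b:]" unfolding e root_ideal_pemb by simp
    hence "[:- a, 1:] dvd [:- a', 1:]" by (simp only: root_ideal_pemb)
    hence aa: "a = a'" by (simp flip: poly_eq_0_iff_dvd)
    have "pemb (- [:b':]) + pemb 1 * yy \<in> root_ideal [:- a, 1:] [:b:]" unfolding e root_ideal_iff by simp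
    hence "[:- a, 1:] dvd - [:b':] + 1 * [:b:]" by (simp only: root_ideal_iff)
    hence "b = b'" by (simp flip: poly_eq_0_iff_dvd)
    thus ?thesis using aa by simp
  qed
  show ?thesis
    using assms(1)
  proof (rule curve_points_cases)
    assume P: "P = Inf"
    show ?thesis using assms(2) by (rule curve_points_cases) (use P assms(3) ni place_of_Inf in metis)+
  next
    fix a b assume P: "P = Aff a b" "on_aff a b"
    show ?thesis using assms(2) by (rule curve_points_cases) (use P assms(3) ni place_of_Inf af in metis)+
  qed
qed

text \<open>Below a finite place of degree one lies a linear p, and the inert case, of degree 2, is
  excluded. The root of p and the value of r there are the coordinates of the point.\<close>

lemma degree_one_place:
  assumes v: "is_place cc v" "place_deg v = 1"
  shows "\<exists>P\<in>curve_points. v = pl P"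
  using v(1)
proof (rule place_cases)
  assume "v = inf_place"
  moreover have "Inf \<in> curve_points" by (simp add: curve_points_def)
  ultimately show ?thesis using place_of_Inf by metis
next
  fix p assume p: "irreducible p" "v \<in> places_above p" "fin (val v)"
  obtain r where r: "degree p = 1" "p dvd root_norm r" "center (val v) = root_ideal p r"
    using places_over(3)[OF p(1,2)] v(2) irreducible_poly_degree_pos[OF p(1)] by auto
  obtain u s where us: "p = pCons u s" by (cases p)
  hence "degree s = 0" using r(1) by (auto split: if_splits)
  then obtain w where "s = [:w:]" by (rule degree_eq_zeroE)
  hence p': "p = [:u, w:]" using us by simp
  have w0: "w \<noteq> 0" using r(1) p' by auto
  define a where "a = - u / w" define b where "b = poly r a"
  have pa: "poly p a = 0" unfolding p' a_def using w0 by simp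
  have dv: "p dvd s" if "poly s a = 0" for s
  proof -
    have "[:- a, 1:] dvd s" using that by (simp add: poly_eq_0_iff_dvd)
    moreover have "p = smult w [:- a, 1:]" unfolding p' a_def using w0 by simp
    ultimately show ?thesis using w0 by (simp only: smult_dvd_iff) simp
  qed
  have "poly (root_norm r) a = 0" using r(2) pa by (auto elim!: dvdE)
  hence o: "on_aff a b" unfolding on_aff_def root_norm_def b_def by (simp add: power2_eq_square algebra_simps)
  have r': "[:- a, 1:] dvd root_norm [:b:]" using o root_norm_const_dvd by simp
  obtain t where L: "local_param (root_ideal [:- a, 1:] [:b:]) t" using local_param_root[OF irreducible_X r'] by blast
  have "pemb [:- a, 1:] \<in> center (val v)" unfolding r(3) root_ideal_pemb by (rule dv) simp
  hence 1: "ge (val v) 1 (pemb [:- a, 1:])" by (simp add: center_def)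
  have "yy - pemb [:b:] \<in> center (val v)" unfolding r(3) yy_minus_root_ideal by (rule dv) (simp add: b_def)
  hence 2: "ge (val v) 1 (yy - pemb [:b:])" by (simp add: center_def)
  have c: "center (val v) = root_ideal [:- a, 1:] [:b:]" by (rule center_root_ideal_I[OF place_is_val[OF v(1)] p(3) irreducible_X 1 2])
  note A = place_of_Aff[OF o]
  have "v = pl (Aff a b)" by (rule local_param_place_unique[OF L v(1) p(3) c A(1,5,4)])
  moreover have "Aff a b \<in> curve_points" using o on_aff_iff by (simp add: curve_points_def)
  ultimately show ?thesis by blast
qed

text \<open>Distinct constants are incongruent, and at a place of degree one there are exactly q
  residue classes, so every class contains a constant.\<close>

lemma residue_const:
  assumes v: "is_place cc v" "place_deg v = 1" and z: "z \<in> LF" "ge (val v) 0 z"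
  shows "\<exists>!a. ge (val v) 1 (z - pemb [:a:])"
proof -
  note \<nu> = place_is_val[OF v(1)]
  let ?Q = "val_ring v // res_rel v"
  let ?f = "\<lambda>a :: 'a. residue_class v (pemb [:a:])"
  have eq: "a = b" if "ge (val v) 1 (pemb [:a:] - pemb [:b:])" for a b
  proof -
    have "pemb [:a:] - pemb [:b:] = pemb [:a - b:]" by (simp flip: pemb_hom)
    hence "ge (val v) 1 (pemb [:a - b:])" using that by (simp only:)
    thus ?thesis using v_const[OF \<nu>, of "a - b"] by (cases "a = b") (simp_all add: ge_def)
  qed
  have inj: "inj ?f"
  proof (rule injI)
    fix a b assume "?f a = ?f b"
    hence "ge (val v) 1 (pemb [:b:] - pemb [:a:])"
      by (intro residue_class(2)[OF v(1)] ge_const[OF \<nu>]) auto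
    thus "a = b" using eq by metis
  qed
  have sub: "range ?f \<subseteq> ?Q" using residue_class(1)[OF v(1) _ ge_const[OF \<nu>]] by auto
  have "card (range ?f) = card ?Q" using card_image[OF inj] card_quot[OF v(1)] v(2) by (simp add: q_def)
  hence "range ?f = ?Q" using sub finite_quot[OF v(1)] card_subset_eq by blast
  moreover have "residue_class v z \<in> ?Q" by (rule residue_class(1)[OF v(1) z])
  ultimately have "residue_class v z \<in> range ?f" by (simp only:)
  then obtain a where a: "residue_class v (pemb [:a:]) = residue_class v z" by (auto dest: sym)
  have 1: "ge (val v) 1 (z - pemb [:a:])"
    by (rule residue_class(2)[OF v(1) _ ge_const[OF \<nu>] z a]) simp
  have "b = a" if "ge (val v) 1 (z - pemb [:b:])" for b
  proof -
    have "ge (val v) 1 ((z - pemb [:a:]) - (z - pemb [:b:]))" by (rule ge_diff[OF \<nu>]) (use 1 that z in auto)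
    hence "ge (val v) 1 (pemb [:b:] - pemb [:a:])" by simp
    thus ?thesis by (rule eq)
  qed
  thus ?thesis using 1 by blast
qed

lemma eval_at_eq_0_iff:
  assumes P: "P \<in> curve_points" and f: "f = fzero \<or> pl P f \<ge> 0"
  shows "eval_at cc P f = 0 \<longleftrightarrow> f = fzero \<or> pl P f > 0"
proof -
  let ?v = "pl P"
  have g: "ge (val ?v) 0 (emb f)" using f by (auto simp: ge_def)
  have e: "fsub f (fconst a) = fzero \<or> ?v (fsub f (fconst a)) > 0 \<longleftrightarrow> ge (val ?v) 1 (emb f - pemb [:a:])" for a
  proof -
    have "ge (val ?v) 1 (emb (fsub f (fconst a))) \<longleftrightarrow> fsub f (fconst a) = fzero \<or> ?v (fsub f (fconst a)) > 0"
      unfolding ge_def by auto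
    thus ?thesis unfolding emb_sub emb_const by simp
  qed
  have ex: "\<exists>!a. ge (val ?v) 1 (emb f - pemb [:a:])"
    by (rule residue_const[OF pl_place[OF P] pl_deg[OF P] emb_LF g])
  have "eval_at cc P f = (THE a. ge (val ?v) 1 (emb f - pemb [:a:]))"
    unfolding eval_at_def Let_def e ..
  hence "eval_at cc P f = 0 \<longleftrightarrow> ge (val ?v) 1 (emb f - pemb [:0:])"
    using ex theI'[OF ex] by (metis the1_equality)
  also have "\<dots> \<longleftrightarrow> f = fzero \<or> pl P f > 0" by (auto simp: ge_def)
  finally show ?thesis .
qed

section \<open>The group of rational points\<close>

definition lin_equiv :: "(('a ff \<Rightarrow> int) \<Rightarrow> int) \<Rightarrow> (('a ff \<Rightarrow> int) \<Rightarrow> int) \<Rightarrow> bool" where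
  "lin_equiv V W \<longleftrightarrow> (\<exists>z\<in>LF. z \<noteq> 0 \<and> (\<forall>v. is_place cc v \<longrightarrow> val v z = V v - W v))"

lemma lin_equiv_refl: "lin_equiv V V"
  unfolding lin_equiv_def by (rule bexI[of _ 1]) (auto simp: v_1[OF place_is_val])

lemma lin_equiv_sym: assumes "lin_equiv V W" shows "lin_equiv W V"
proof -
  obtain z where "z \<in> LF" "z \<noteq> 0" "\<And>v. is_place cc v \<Longrightarrow> val v z = V v - W v" using assms unfolding lin_equiv_def by blast
  thus ?thesis unfolding lin_equiv_def by (intro bexI[of _ "inverse z"]) (auto simp: v_inverse[OF place_is_val])
qed

lemma lin_equiv_add: assumes "lin_equiv V W" "lin_equiv V' W'" shows "lin_equiv (\<lambda>v. V v + V' v) (\<lambda>v. W v + W' v)"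
proof -
  obtain z where z: "z \<in> LF" "z \<noteq> 0" "\<And>v. is_place cc v \<Longrightarrow> val v z = V v - W v" using assms(1) unfolding lin_equiv_def by blast
  obtain w where w: "w \<in> LF" "w \<noteq> 0" "\<And>v. is_place cc v \<Longrightarrow> val v w = V' v - W' v" using assms(2) unfolding lin_equiv_def by blast
  show ?thesis unfolding lin_equiv_def using z w by (intro bexI[of _ "z * w"]) (auto simp: v_mult[OF place_is_val])
qed

lemma lin_equiv_trans: assumes "lin_equiv U V" "lin_equiv V W" shows "lin_equiv U W"
proof -
  obtain z where z: "z \<in> LF" "z \<noteq> 0" "\<And>v. is_place cc v \<Longrightarrow> val v z = U v - V v" using assms(1) unfolding lin_equiv_def by blast
  obtain w where w: "w \<in> LF" "w \<noteq> 0" "\<And>v. is_place cc v \<Longrightarrow> val v w = V v - W v" using assms(2) unfolding lin_equiv_def by blast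
  show ?thesis unfolding lin_equiv_def using z w by (intro bexI[of _ "z * w"]) (auto simp: v_mult[OF place_is_val])
qed

lemma div_deg_add:
  assumes "is_divisor cc V" "is_divisor cc W"
  shows "is_divisor cc (\<lambda>v. V v + W v)" "div_deg (\<lambda>v. V v + W v) = div_deg V + div_deg W"
    "is_divisor cc (\<lambda>v. V v - W v)" "div_deg (\<lambda>v. V v - W v) = div_deg V - div_deg W"
proof -
  let ?S = "{v. V v \<noteq> 0} \<union> {v. W v \<noteq> 0}"
  have S: "finite ?S" using assms by (simp add: is_divisor_def)
  have sub: "{v. V v + W v \<noteq> 0} \<subseteq> ?S" "{v. V v - W v \<noteq> 0} \<subseteq> ?S" by auto
  show "is_divisor cc (\<lambda>v. V v + W v)" "is_divisor cc (\<lambda>v. V v - W v)"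
  proof -
    have pS: "is_place cc v" if "v \<in> ?S" for v using that assms by (auto simp: is_divisor_def)
    show "is_divisor cc (\<lambda>v. V v + W v)" "is_divisor cc (\<lambda>v. V v - W v)"
      unfolding is_divisor_def using finite_subset[OF sub(1) S] finite_subset[OF sub(2) S] sub pS by blast+
  qed
  have d: "div_deg V = weighted_sum V ?S" "div_deg W = weighted_sum W ?S" by (intro div_deg_superset S; auto)+
  show "div_deg (\<lambda>v. V v + W v) = div_deg V + div_deg W"
    unfolding d div_deg_superset[OF S sub(1)] by (simp add: weighted_sum_def sum.distrib distrib_right)
  show "div_deg (\<lambda>v. V v - W v) = div_deg V - div_deg W"
    unfolding d div_deg_superset[OF S sub(2)] by (simp add: weighted_sum_def sum_subtractf left_diff_distrib)
qed

definition point_div :: "'a point \<Rightarrow> ('a ff \<Rightarrow> int) \<Rightarrow> int" where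
  "point_div P = (\<lambda>v. if v = pl P then 1 else 0)"

lemma point_div: assumes "P \<in> curve_points" shows "is_divisor cc (point_div P)" "div_deg (point_div P) = 1"
proof -
  have s: "{v. point_div P v \<noteq> 0} = {pl P}" by (auto simp: point_div_def)
  show "is_divisor cc (point_div P)" unfolding is_divisor_def s using pl_place[OF assms] by (auto simp: point_div_def)
  show "div_deg (point_div P) = 1" unfolding div_deg_def s using pl_deg[OF assms] by (simp add: point_div_def)
qed

lemma Inf_in_curve: "Inf \<in> curve_points" by (simp add: curve_points_def)

text \<open>By Riemann's inequality a divisor of degree one is equivalent to an effective one, that is, to a
  rational point.\<close>

lemma degree_one_class:
  assumes V: "is_divisor cc V" "div_deg V = 1"
  shows "\<exists>P\<in>curve_points. lin_equiv (point_div P) V"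
proof -
  obtain z where z: "z \<in> LF" "z \<noteq> 0" "\<And>v. is_place cc v \<Longrightarrow> val v z \<ge> - V v" using riemann[OF V(1)] V(2) by auto
  define E where "E v = V v + val v z" for v
  define S where "S = {v. V v \<noteq> 0} \<union> supp z"
  have S: "finite S" "\<And>v. v \<in> S \<Longrightarrow> is_place cc v"
    unfolding S_def using V(1) degree_zero(1)[OF z(1,2)] by (auto simp: is_divisor_def supp_def)
  have E0: "E v \<ge> 0" if "is_place cc v" for v using z(3)[OF that] by (simp add: E_def)
  have ES: "E v = 0" if "is_place cc v" "v \<notin> S" for v using that by (auto simp: E_def S_def supp_def)
  have "principal_deg z = (\<Sum>v\<in>S. val v z * int (place_deg v))" by (rule principal_deg_superset) (use S in \<open>auto simp: S_def\<close>)
  hence "(\<Sum>v\<in>S. val v z * int (place_deg v)) = 0" using degree_zero(2)[OF z(1,2)] by simp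
  moreover have "(\<Sum>v\<in>S. V v * int (place_deg v)) = 1"
    using div_deg_superset[OF S(1), of V] V(2) by (auto simp: weighted_sum_def S_def)
  ultimately have sum1: "(\<Sum>v\<in>S. E v * int (place_deg v)) = 1"
    by (simp add: E_def distrib_right sum.distrib)
  have nn: "E v * int (place_deg v) \<ge> 0" if "v \<in> S" for v using E0 S(2) that by simp
  have "\<exists>w\<in>S. E w * int (place_deg w) \<noteq> 0"
  proof (rule ccontr)
    assume "\<not> ?thesis"
    hence "(\<Sum>v\<in>S. E v * int (place_deg v)) = 0" by (intro sum.neutral) blast
    thus False using sum1 by simp
  qed
  then obtain w where w: "w \<in> S" "E w * int (place_deg w) \<noteq> 0" by blast
  have split: "E w * int (place_deg w) + (\<Sum>v\<in>S - {w}. E v * int (place_deg v)) = 1"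
    using sum.remove[OF S(1) w(1), of "\<lambda>v. E v * int (place_deg v)"] sum1 by simp
  have rest: "(\<Sum>v\<in>S - {w}. E v * int (place_deg v)) \<ge> 0" by (rule sum_nonneg) (use nn in auto)
  \<comment> \<open>The terms are nonnegative integers with sum 1, so one of them is 1 and all
    others vanish.\<close>
  have w1: "E w * int (place_deg w) = 1" using split rest nn[OF w(1)] w(2) by linarith
  hence "(\<Sum>v\<in>S - {w}. E v * int (place_deg v)) = 0" using split by simp
  hence others: "E v * int (place_deg v) = 0" if "v \<in> S - {w}" for v
    using sum_nonneg_eq_0_iff[of "S - {w}" "\<lambda>v. E v * int (place_deg v)"] S(1) nn that by auto
  have Ew: "E w = 1" "place_deg w = 1"
    using w1 E0[OF S(2)[OF w(1)]] by (auto simp: zmult_eq_1_iff)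
  obtain P where P: "P \<in> curve_points" "w = pl P" using degree_one_place[OF S(2)[OF w(1)] Ew(2)] by blast
  have "val v z = point_div P v - V v" if v: "is_place cc v" for v
  proof -
    have "E v = point_div P v"
    proof (cases "v = w")
      case True thus ?thesis using Ew P by (simp add: point_div_def)
    next
      case False
      hence "E v = 0" using others[of v] ES[OF v] place_deg_pos[OF v] by (cases "v \<in> S") auto
      thus ?thesis using False P by (simp add: point_div_def)
    qed
    thus ?thesis by (simp add: E_def)
  qed
  thus ?thesis unfolding lin_equiv_def using P(1) z by blast
qed

text \<open>A function with divisor P - Q would have a simple pole at Q as its only pole.\<close>

lemma point_div_inj: assumes PQ: "P \<in> curve_points" "Q \<in> curve_points" and e: "lin_equiv (point_div P) (point_div Q)" shows "P = Q"
proof (rule ccontr)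
  assume "P \<noteq> Q"
  hence ne: "pl P \<noteq> pl Q" using pl_inj[OF PQ] by blast
  obtain z where z: "z \<in> LF" "z \<noteq> 0" "\<And>v. is_place cc v \<Longrightarrow> val v z = point_div P v - point_div Q v" using e unfolding lin_equiv_def by blast
  show False
  proof (rule no_degree_one_function[OF z(1,2) pl_place[OF PQ(2)] pl_deg[OF PQ(2)]])
    have "point_div P (pl Q) = 0" "point_div Q (pl Q) = 1" using ne by (simp_all add: point_div_def)
    thus "val (pl Q) z = - 1" using z(3)[OF pl_place[OF PQ(2)]] by linarith
    show "(if v = pl Q then - 1 else 0) \<le> val v z" if "is_place cc v" for v
    proof -
      have "point_div P v \<ge> 0" "point_div Q v = (if v = pl Q then 1 else 0)" by (simp_all add: point_div_def)
      thus ?thesis unfolding z(3)[OF that] by (auto split: if_splits)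
    qed
  qed
qed

text \<open>The chord and tangent law without formulas: P + Q - \<open>Inf\<close> has degree one
  and is equivalent to exactly one point, by \<open>degree_one_class\<close> and
  \<open>point_div_inj\<close>.\<close>

definition point_add :: "'a point \<Rightarrow> 'a point \<Rightarrow> 'a point" where
  "point_add P Q = (SOME R. R \<in> curve_points \<and> lin_equiv (point_div R) (\<lambda>v. point_div P v + point_div Q v - point_div Inf v))"

lemma point_add:
  assumes "P \<in> curve_points" "Q \<in> curve_points"
  shows "point_add P Q \<in> curve_points" "lin_equiv (point_div (point_add P Q)) (\<lambda>v. point_div P v + point_div Q v - point_div Inf v)"
proof -
  note D = div_deg_add[OF point_div(1)[OF assms(1)] point_div(1)[OF assms(2)]]
  note D' = div_deg_add[OF D(1) point_div(1)[OF Inf_in_curve]]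
  have "div_deg (\<lambda>v. point_div P v + point_div Q v - point_div Inf v) = 1"
    unfolding D'(4) D(2) point_div(2)[OF assms(1)] point_div(2)[OF assms(2)] point_div(2)[OF Inf_in_curve] by (rule add_diff_cancel)
  hence "\<exists>R. R \<in> curve_points \<and> lin_equiv (point_div R) (\<lambda>v. point_div P v + point_div Q v - point_div Inf v)"
    using degree_one_class[OF D'(3)] by blast
  hence "point_add P Q \<in> curve_points \<and> lin_equiv (point_div (point_add P Q)) (\<lambda>v. point_div P v + point_div Q v - point_div Inf v)"
    unfolding point_add_def by (rule someI_ex)
  thus "point_add P Q \<in> curve_points" "lin_equiv (point_div (point_add P Q)) (\<lambda>v. point_div P v + point_div Q v - point_div Inf v)" by auto
qed

lemma point_add_eqI:
  assumes "P \<in> curve_points" "Q \<in> curve_points" "R \<in> curve_points" "lin_equiv (point_div R) (\<lambda>v. point_div P v + point_div Q v - point_div Inf v)"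
  shows "point_add P Q = R"
  using point_div_inj[OF point_add(1)[OF assms(1,2)] assms(3)] lin_equiv_trans[OF point_add(2)[OF assms(1,2)] lin_equiv_sym[OF assms(4)]] by blast

definition point_group :: "'a point monoid" where
  "point_group = \<lparr>carrier = curve_points, monoid.mult = point_add, one = Inf\<rparr>"

lemma point_group_simps [simp]: "carrier point_group = curve_points" "monoid.mult point_group = point_add" "monoid.one point_group = Inf"
  by (simp_all add: point_group_def)

text \<open>The divisor on the right is symmetric in P, Q and R, so associativity follows because
  equivalent points are equal.\<close>

lemma point_add_twice:
  assumes "P \<in> curve_points" "Q \<in> curve_points" "R \<in> curve_points"
  shows "lin_equiv (point_div (point_add (point_add P Q) R)) (\<lambda>v. point_div P v + point_div Q v + point_div R v - 2 * point_div Inf v)"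
proof -
  have 1: "lin_equiv (point_div (point_add (point_add P Q) R)) (\<lambda>v. point_div (point_add P Q) v + (point_div R v - point_div Inf v))"
    using point_add(2)[OF point_add(1)[OF assms(1,2)] assms(3)] by (simp only: add_diff_eq)
  have "lin_equiv (\<lambda>v. point_div (point_add P Q) v + (point_div R v - point_div Inf v)) (\<lambda>v. (point_div P v + point_div Q v - point_div Inf v) + (point_div R v - point_div Inf v))"
    by (rule lin_equiv_add[OF point_add(2)[OF assms(1,2)] lin_equiv_refl])
  from lin_equiv_trans[OF 1 this] show ?thesis by (simp add: algebra_simps)
qed

lemma comm_group_points: "comm_group point_group"
proof (rule comm_groupI)
  show com: "x \<otimes>\<^bsub>point_group\<^esub> y = y \<otimes>\<^bsub>point_group\<^esub> x" if "x \<in> carrier point_group" "y \<in> carrier point_group" for x y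
    unfolding point_add_def point_group_simps by (subst add.commute) (rule refl)
  fix x y z assume xyz: "x \<in> carrier point_group" "y \<in> carrier point_group" "z \<in> carrier point_group"
  have E: "x \<in> curve_points" "y \<in> curve_points" "z \<in> curve_points" using xyz by simp_all
  have 1: "lin_equiv (point_div (point_add (point_add x y) z)) (\<lambda>v. point_div x v + point_div y v + point_div z v - 2 * point_div Inf v)" by (rule point_add_twice[OF E])
  have "lin_equiv (point_div (point_add (point_add y z) x)) (\<lambda>v. point_div y v + point_div z v + point_div x v - 2 * point_div Inf v)" by (rule point_add_twice[OF E(2,3,1)])
  hence 2: "lin_equiv (point_div (point_add (point_add y z) x)) (\<lambda>v. point_div x v + point_div y v + point_div z v - 2 * point_div Inf v)" by (simp add: algebra_simps)
  have "point_add (point_add x y) z = point_add (point_add y z) x"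
    by (rule point_div_inj[OF _ _ lin_equiv_trans[OF 1 lin_equiv_sym[OF 2]]]) (use point_add(1) E in auto)
  also have "\<dots> = point_add x (point_add y z)" using com[of "point_add y z" x] point_add(1)[OF E(2,3)] E by simp
  finally show "x \<otimes>\<^bsub>point_group\<^esub> y \<otimes>\<^bsub>point_group\<^esub> z = x \<otimes>\<^bsub>point_group\<^esub> (y \<otimes>\<^bsub>point_group\<^esub> z)" by simp
next
  fix x y assume "x \<in> carrier point_group" "y \<in> carrier point_group"
  thus "x \<otimes>\<^bsub>point_group\<^esub> y \<in> carrier point_group" using point_add(1) by simp
next
  show "\<one>\<^bsub>point_group\<^esub> \<in> carrier point_group" using Inf_in_curve by simp
next
  fix x assume "x \<in> carrier point_group"
  hence x: "x \<in> curve_points" by simp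
  show "\<one>\<^bsub>point_group\<^esub> \<otimes>\<^bsub>point_group\<^esub> x = x" using point_add_eqI[OF Inf_in_curve x x] lin_equiv_refl by simp
  note D = div_deg_add[OF point_div(1)[OF Inf_in_curve] point_div(1)[OF Inf_in_curve]]
  note D' = div_deg_add[OF D(1) point_div(1)[OF x]]
  obtain y where y: "y \<in> curve_points" "lin_equiv (point_div y) (\<lambda>v. point_div Inf v + point_div Inf v - point_div x v)"
  proof -
    have "div_deg (\<lambda>v. point_div Inf v + point_div Inf v - point_div x v) = 1"
      unfolding D'(4) D(2) point_div(2)[OF x] point_div(2)[OF Inf_in_curve] by (rule add_diff_cancel)
    thus ?thesis using degree_one_class[OF D'(3)] that by blast
  qed
  have "lin_equiv (\<lambda>v. point_div y v + (point_div x v - point_div Inf v)) (\<lambda>v. (point_div Inf v + point_div Inf v - point_div x v) + (point_div x v - point_div Inf v))"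
    by (rule lin_equiv_add[OF y(2) lin_equiv_refl])
  hence "lin_equiv (\<lambda>v. point_div y v + point_div x v - point_div Inf v) (point_div Inf)" by (simp add: algebra_simps)
  hence "point_add y x = Inf" by (rule point_add_eqI[OF y(1) x Inf_in_curve lin_equiv_sym])
  thus "\<exists>y\<in>carrier point_group. y \<otimes>\<^bsub>point_group\<^esub> x = \<one>\<^bsub>point_group\<^esub>" using y by auto
qed

interpretation point_group: comm_group point_group by (rule comm_group_points)

lemma finite_curve_points: "finite curve_points"
proof -
  have "curve_points \<subseteq> insert Inf ((\<lambda>(x, y). Aff x y) ` UNIV)"
  proof
    fix P :: "'a point" assume "P \<in> curve_points"
    show "P \<in> insert Inf ((\<lambda>(x, y). Aff x y) ` UNIV)"
      by (cases P) (auto simp: image_iff)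
  qed
  thus ?thesis by (rule finite_subset) simp
qed

text \<open>Both sides have degree one, which fixes the coefficient of \<open>Inf\<close>. The cast
  to integers matters for the empty set, where the coefficient becomes +1 and the product is
  \<open>Inf\<close> itself.\<close>

lemma finprod_lin_equiv:
  assumes "finite S" "S \<subseteq> curve_points"
  shows "lin_equiv (point_div (finprod point_group (\<lambda>x. x) S)) (\<lambda>v. (\<Sum>P\<in>S. point_div P v) - (int (card S) - 1) * point_div Inf v)"
  using assms
proof (induction S rule: finite_induct)
  case empty
  show ?case using lin_equiv_refl[of "point_div Inf"] by simp
next
  case (insert P S)
  let ?f = "finprod point_group (\<lambda>x. x) S"
  have f: "?f \<in> curve_points" using point_group.finprod_closed[of "\<lambda>x. x" S] insert.prems by auto
  have P: "P \<in> curve_points" using insert.prems by simp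
  have "finprod point_group (\<lambda>x. x) (insert P S) = P \<otimes>\<^bsub>point_group\<^esub> ?f"
    by (rule point_group.finprod_insert) (use insert in auto)
  hence e: "finprod point_group (\<lambda>x. x) (insert P S) = point_add P ?f" by simp
  have 1: "lin_equiv (point_div (point_add P ?f)) (\<lambda>v. point_div ?f v + (point_div P v - point_div Inf v))"
    using point_add(2)[OF P f] by (simp add: algebra_simps)
  have IH: "lin_equiv (point_div ?f) (\<lambda>v. (\<Sum>P\<in>S. point_div P v) - (int (card S) - 1) * point_div Inf v)" using insert by simp
  have "lin_equiv (\<lambda>v. point_div ?f v + (point_div P v - point_div Inf v))
    (\<lambda>v. ((\<Sum>P\<in>S. point_div P v) - (int (card S) - 1) * point_div Inf v) + (point_div P v - point_div Inf v))"
    by (rule lin_equiv_add[OF IH lin_equiv_refl])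
  from lin_equiv_trans[OF 1 this] show ?case unfolding e using insert.hyps by (simp add: algebra_simps)
qed

lemma div_deg_multiple:
  assumes "P \<in> curve_points" shows "is_divisor cc (\<lambda>v. c * point_div P v)" "div_deg (\<lambda>v. c * point_div P v) = c"
proof -
  have sub: "{v. c * point_div P v \<noteq> 0} \<subseteq> {pl P}" by (auto simp: point_div_def)
  show "is_divisor cc (\<lambda>v. c * point_div P v)" unfolding is_divisor_def
    using finite_subset[OF sub] pl_place[OF assms] by (auto simp: point_div_def)
  show "div_deg (\<lambda>v. c * point_div P v) = c"
    using div_deg_superset[OF _ sub] pl_deg[OF assms] by (simp add: weighted_sum_def point_div_def)
qed

section \<open>The code\<close>

text \<open>V minus k - 1 times \<open>Inf\<close> is equivalent to a point R. Choosing k points of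
  D with sum R makes their divisor equivalent to V, and the function realising this vanishes at all
  of them, since V is zero there.\<close>

theorem exists_function_with_zeros:
  assumes V: "is_divisor cc V" "div_deg V = int k"
    and D: "D \<subseteq> curve_points" "card D \<ge> q + 2" "\<forall>P\<in>D. V (pl P) = 0"
    and q: "64 < q" and k: "3 < k" "k < q - 1"
  shows "\<exists>f\<in>LL cc V. f \<noteq> fzero \<and> k \<le> card {P\<in>D. pl P f > 0}"
proof -
  have finD: "finite D" using D(1) finite_curve_points finite_subset by blast
  obtain D0 where D0: "D0 \<subseteq> D" "card D0 = q + 2" using obtain_subset_with_card_n[OF D(2)] by metis
  note M = div_deg_multiple[OF Inf_in_curve, of "int k - 1"]
  note W = div_deg_add[OF V(1) M(1)]
  obtain R where R: "R \<in> curve_points" "lin_equiv (point_div R) (\<lambda>v. V v - (int k - 1) * point_div Inf v)"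
    using degree_one_class[OF W(3)] W(4) V(2) M(2) by auto
  have N: "4 * card curve_points \<le> 5 * q + 36" unfolding curve_points_def by (rule card_points_le) (use q in simp)
  have "\<exists>S\<subseteq>D0. card S = k \<and> finprod point_group (\<lambda>x. x) S = R"
  proof (rule point_group.subset_products_large)
    show "finite (carrier point_group)" using finite_curve_points by simp
    show "D0 \<subseteq> carrier point_group" using D0 D by simp
    show "R \<in> carrier point_group" using R by simp
    show "65 \<le> q" "card D0 = q + 2" "4 \<le> k" "k \<le> q - 2" using q D0 k by auto
    show "4 * Coset.order point_group \<le> 5 * q + 36" using N by (simp add: Coset.order_def)
  qed
  then obtain S where S: "S \<subseteq> D0" "card S = k" "finprod point_group (\<lambda>x. x) S = R" by blast
  have SE: "S \<subseteq> curve_points" "S \<subseteq> D" "finite S" using S D0 D finite_subset[OF _ finD, of S] by auto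
  have 1: "lin_equiv (point_div R) (\<lambda>v. (\<Sum>P\<in>S. point_div P v) - (int k - 1) * point_div Inf v)"
    using finprod_lin_equiv[OF SE(3,1)] S by simp
  have 2: "lin_equiv (\<lambda>v. (\<Sum>P\<in>S. point_div P v) - (int k - 1) * point_div Inf v) (\<lambda>v. V v - (int k - 1) * point_div Inf v)"
    by (rule lin_equiv_trans[OF lin_equiv_sym[OF 1] R(2)])
  have "lin_equiv (\<lambda>v. \<Sum>P\<in>S. point_div P v) V"
    using lin_equiv_add[OF 2 lin_equiv_refl[of "\<lambda>v. (int k - 1) * point_div Inf v"]] by simp
  then obtain z where z: "z \<in> LF" "z \<noteq> 0" "\<And>v. is_place cc v \<Longrightarrow> val v z = (\<Sum>P\<in>S. point_div P v) - V v"
    unfolding lin_equiv_def by blast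
  define f where "f = iemb z"
  have fz: "emb f = z" using z by (simp add: f_def)
  have vf: "v f = (\<Sum>P\<in>S. point_div P v) - V v" if "is_place cc v" for v using z(3)[OF that] by (simp add: f_def val_def)
  have f0: "f \<noteq> fzero" using fz z(2) by auto
  have "(\<Sum>P\<in>S. point_div P v) \<ge> 0" for v by (rule sum_nonneg) (simp add: point_div_def)
  hence fL: "f \<in> LL cc V" by (simp add: LL_def vf)
  have "pl P f > 0" if P: "P \<in> S" for P
  proof -
    have "point_div P (pl P) \<le> (\<Sum>Q\<in>S. point_div Q (pl P))"
      by (rule member_le_sum[OF P _ SE(3)]) (simp add: point_div_def)
    moreover have "point_div P (pl P) = 1" by (simp add: point_div_def)
    moreover have "V (pl P) = 0" using D(3) P SE by blast
    ultimately show ?thesis using vf[OF pl_place] P SE(1) by fastforce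
  qed
  hence "S \<subseteq> {P\<in>D. pl P f > 0}" using SE by auto
  hence "card S \<le> card {P\<in>D. pl P f > 0}" by (rule card_mono[rotated]) (use finD in simp)
  thus ?thesis using S fL f0 by blast
qed

text \<open>V + div(f) is effective of degree k, and on D, where V is zero, each zero of f
  contributes at least 1.\<close>

theorem card_zeros_le:
  assumes V: "is_divisor cc V" "div_deg V = int k" and D: "D \<subseteq> curve_points" "\<forall>P\<in>D. V (pl P) = 0"
    and f: "f \<in> LL cc V" "f \<noteq> fzero"
  shows "card {P\<in>D. pl P f > 0} \<le> k"
proof -
  define Z where "Z = {P\<in>D. pl P f > 0}"
  have finZ: "finite Z" using finite_subset[OF D(1) finite_curve_points] unfolding Z_def by simp
  define z where "z = emb f"
  have z: "z \<in> LF" "z \<noteq> 0" using f by (auto simp: z_def)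
  have vz: "val v z = v f" for v by (simp add: z_def)
  define S where "S = {v. V v \<noteq> 0} \<union> supp z"
  have S: "finite S" "\<And>v. v \<in> S \<Longrightarrow> is_place cc v"
    unfolding S_def using V(1) degree_zero(1)[OF z] by (auto simp: is_divisor_def supp_def)
  have "principal_deg z = (\<Sum>v\<in>S. val v z * int (place_deg v))" by (rule principal_deg_superset) (use S in \<open>auto simp: S_def\<close>)
  hence "(\<Sum>v\<in>S. val v z * int (place_deg v)) = 0" using degree_zero(2)[OF z] by simp
  moreover have "(\<Sum>v\<in>S. V v * int (place_deg v)) = int k"
    using div_deg_superset[OF S(1), of V] V(2) by (auto simp: weighted_sum_def S_def)
  ultimately have sumk: "(\<Sum>v\<in>S. (V v + val v z) * int (place_deg v)) = int k"
    by (simp add: distrib_right sum.distrib)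
  have nn: "V v + val v z \<ge> 0" if "v \<in> S" for v using f S(2)[OF that] by (force simp: LL_def vz)
  have plS: "pl ` Z \<subseteq> S"
  proof
    fix v assume "v \<in> pl ` Z"
    then obtain P where P: "P \<in> Z" "v = pl P" by blast
    hence "is_place cc v" using pl_place D by (auto simp: Z_def)
    thus "v \<in> S" using P by (auto simp: S_def supp_def vz Z_def)
  qed
  have inj: "inj_on pl Z" using pl_inj D by (auto simp: inj_on_def Z_def)
  have "int (card Z) = (\<Sum>v\<in>pl ` Z. 1)" using card_image[OF inj] by simp
  also have "\<dots> \<le> (\<Sum>v\<in>pl ` Z. (V v + val v z) * int (place_deg v))"
  proof (rule sum_mono)
    fix v assume "v \<in> pl ` Z"
    then obtain P where P: "P \<in> D" "v = pl P" "pl P f > 0" by (auto simp: Z_def)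
    thus "1 \<le> (V v + val v z) * int (place_deg v)" using D pl_deg[of P] by (auto simp: vz)
  qed
  also have "\<dots> \<le> (\<Sum>v\<in>S. (V v + val v z) * int (place_deg v))"
    by (rule sum_mono2[OF S(1) plS]) (use nn in auto)
  finally show ?thesis using sumk by (simp add: Z_def)
qed

theorem min_distance_code:
  assumes V: "is_divisor cc V" "div_deg V = int k"
    and Ps: "distinct Ps" "\<forall>P\<in>set Ps. on_curve cc P" "length Ps \<ge> q + 2" "\<forall>P\<in>set Ps. V (pl P) = 0"
    and q: "64 < q" and k: "3 < k" "k < q - 1"
  shows "min_distance (ag_code cc Ps V) = length Ps - k"
proof -
  let ?n = "length Ps" let ?D = "set Ps"
  define w where "w f = (\<lambda>i. if i < ?n then eval_at cc (Ps ! i) f else 0)" for f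
  have D: "?D \<subseteq> curve_points" using Ps by (auto simp: curve_points_def)
  have cD: "card ?D = ?n" using Ps by (simp add: distinct_card)
  have ev: "eval_at cc P f = 0 \<longleftrightarrow> f = fzero \<or> pl P f > 0" if P: "P \<in> ?D" and f: "f \<in> LL cc V" for P f
  proof (rule eval_at_eq_0_iff)
    show "P \<in> curve_points" using P D by blast
    show "f = fzero \<or> pl P f \<ge> 0" using f P Ps(4) pl_place[of P] D by (force simp: LL_def)
  qed
  have wt: "hweight (w f) + card {P\<in>?D. pl P f > 0} = ?n" if f: "f \<in> LL cc V" "f \<noteq> fzero" for f
  proof -
    have "{i. w f i \<noteq> 0} = {i. i < ?n \<and> \<not> pl (Ps ! i) f > 0}"
      unfolding w_def using ev[OF nth_mem f(1)] f(2) by auto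
    moreover have "card {i. i < ?n \<and> \<not> pl (Ps ! i) f > 0} = card {P\<in>?D. \<not> pl P f > 0}"
    proof (rule bij_betw_same_card[of "\<lambda>i. Ps ! i"])
      have "inj_on ((!) Ps) {i. i < ?n \<and> \<not> pl (Ps ! i) f > 0}" using Ps(1) by (auto simp: inj_on_def nth_eq_iff_index_eq)
      thus "bij_betw ((!) Ps) {i. i < ?n \<and> \<not> pl (Ps ! i) f > 0} {P\<in>?D. \<not> pl P f > 0}"
        by (auto simp: bij_betw_def in_set_conv_nth)
    qed
    moreover have "card {P\<in>?D. \<not> pl P f > 0} + card {P\<in>?D. pl P f > 0} = card ?D"
      by (subst card_Un_disjoint[symmetric]) (auto intro: arg_cong[of _ _ card])
    ultimately show ?thesis unfolding hweight_def using cD by simp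
  qed
  have code: "ag_code cc Ps V = w ` LL cc V" by (simp add: ag_code_def w_def)
  have w0: "w fzero = (\<lambda>_. 0)"
  proof
    fix i show "w fzero i = 0" unfolding w_def using ev[OF nth_mem, of i fzero] by (simp add: LL_def)
  qed
  have kn: "k < ?n" using k Ps(3) by simp
  have lb: "?n - k \<le> hweight (w f)" if f: "f \<in> LL cc V" "f \<noteq> fzero" for f
    using wt[OF f] card_zeros_le[OF V D Ps(4) f] by linarith
  \<comment> \<open>As k < n, no nonzero function evaluates to the zero word, so removing the zero
    word from the code amounts to removing the zero function.\<close>
  have nz: "w f \<noteq> (\<lambda>_. 0)" if f: "f \<in> LL cc V" "f \<noteq> fzero" for f
  proof
    assume "w f = (\<lambda>_. 0)"
    hence "hweight (w f) = 0" by (simp add: hweight_def)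
    thus False using lb[OF f] kn by simp
  qed
  have C: "ag_code cc Ps V - {\<lambda>_. 0} = w ` (LL cc V - {fzero})"
    unfolding code using w0 nz by auto
  obtain f where f: "f \<in> LL cc V" "f \<noteq> fzero" "k \<le> card {P\<in>?D. pl P f > 0}"
    using exists_function_with_zeros[OF V D _ Ps(4) q k] cD Ps(3) by auto
  have fw: "hweight (w f) = ?n - k" using wt[OF f(1,2)] f(3) lb[OF f(1,2)] by linarith
  show ?thesis unfolding min_distance_def C
  proof (rule Min_eqI)
    have "hweight ` w ` (LL cc V - {fzero}) \<subseteq> {..?n}" using wt by fastforce
    thus "finite (hweight ` w ` (LL cc V - {fzero}))" by (rule finite_subset) simp
    show "?n - k \<le> y" if "y \<in> hweight ` w ` (LL cc V - {fzero})" for y using that lb by auto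
    show "?n - k \<in> hweight ` w ` (LL cc V - {fzero})"
      unfolding fw[symmetric] by (intro imageI) (use f in simp)
  qed
qed

end

theorem theorem1p2:
  fixes c :: "'a::{finite,field} wcoeffs"
    and Ps :: "'a point list"
    and G :: "('a ff \<Rightarrow> int) \<Rightarrow> int"
    and k :: nat
  assumes "card (UNIV :: 'a set) > 64"
    and "elliptic c"
    and "distinct Ps" and "\<forall>P\<in>set Ps. on_curve c P"
    and "length Ps \<ge> card (UNIV :: 'a set) + 2"
    and "3 < k" and "k < card (UNIV :: 'a set) - 1"
    and "is_divisor c G" and "div_deg G = int k"
    and "\<forall>P\<in>set Ps. G (place_of c P) = 0"
  shows "min_distance (ag_code c Ps G) = length Ps - k"
proof -
  obtain a1 a2 a3 a4 a6 where c: "c = (a1, a2, a3, a4, a6)" by (cases c)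
  interpret weierstrass a1 a2 a3 a4 a6 "card (UNIV :: 'a set)"
    by unfold_locales (use assms(2) c in \<open>simp_all add: elliptic_def\<close>)
  show ?thesis unfolding c by (rule min_distance_code) (use assms c in simp_all)
qed

end
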